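(* Let $\mathcal M$ be a model of a $b$-minimal theory. Let $Y$ be a definable set, let $X$ and $X'$ be definable sets over $Y$, and let $f:X\to X'$ be a definable function over $Y$ (that is, compatible with the maps to $Y$). Then: (3) $\dim(X)\ge\dim(f(X))$, hence also $\dim(X/Y)\ge\dim(f(X)/Y)$. (4) For each integer $d\ge0$ the set $S_f(d):=\{x'\in X'\mid \dim(f^{-1}(x')/Y)=d\}$ is definable and $$\dim(f^{-1}(S_f(d))/Y)=\dim(S_f(d)/Y)+d,$$ with the convention $-\infty+d=-\infty$. (5) If $Y$ is auxiliary, then $\dim(X/Y)=\dim(X)$.
   Context: **Conventions.** Languages are first-order and many-sorted, with a unique main sort and a distinguished collection of auxiliary sorts; the universe of the main sort of $\mathcal M$ is denoted $M$. "Definable" means definable with parameters (from any sorts); "$A$-definable" means definable with parameters in $A$. A point is a singleton. A definable set is auxiliary if it is a subset of a finite Cartesian product of universes of auxiliary sorts. The zeroth Cartesian power of any sort is one fixed $\emptyset$-definable point. **Balls.** $\mathcal L_B$ is the language with one predicate $B$, interpreted in a model $\mathcal M$ as a nonempty set $B(\mathcal M)\subset A_B\times M$, with $A_B$ a finite Cartesian product of sorts. For $a\in A_B$ put $B(a)=\{m\in M\mid (a,m)\in B(\mathcal M)\}$; if $B(a)$ is nonempty it is called a ball. **$b$-minimality.** Let $\mathcal L$ be an expansion of $\mathcal L_B$. An $\mathcal L$-model $\mathcal M$ is $b$-minimal if for every set of parameters $A$ (from any sorts), every $A$-definable $X\subset M$ and every $A$-definable $F:X\to M$: (b1) there is an $A$-definable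 $f:X\to S$ with $S$ auxiliary such that for each $s\in f(X)$ the fiber $f^{-1}(s)$ is a point or a ball; (b2) if $g$ is a definable function from an auxiliary set to a ball, then $g$ is not surjective; (b3) there is an $A$-definable $f:X\to S$ with $S$ auxiliary such that for each $s\in f(X)$ the restriction $F_{|f^{-1}(s)}$ is injective or constant. An $\mathcal L$-theory is $b$-minimal if all its models are. **Sets over $Y$.** A definable set $X$ over $Y$ is a definable set with a definable map $X\to Y$ (subsets carry the restricted map). A function between sets over $Y$ is over $Y$ if it commutes with the maps to $Y$. **Cells.** For $X\subset M$ definable and $f:X\to S$ definable with $S$ auxiliary, $X$ is a $(1)$-cell (resp. $(0)$-cell) with presentation $f$ if all nonempty fibers of $f$ are balls (resp. points). Inductively, for $n\ge2$ and $(j_1,\dots,j_n)\in\{0,1\}^n$, a definable $X\subset M^n$ is a $(j_1,\dots,j_n)$-cell with presentation $f:X\to S$ ($S$ auxiliary, $f$ definable) if, with $p:X\to M^{n-1}$ the projection forgetting $x_n$: for each $\hat x\in p(X)$ the fiber $p^{-1}(\hat x)$, viewed in $M$ via $x_n$, is a $(j_n)$-cell with presentation $x_n\mapsto f(\hat x,x_n)$, and $p(X)$ is a $(j_1,\dots,j_{n-1})$-cell with some presentation $f':p(X)\to S'$ with $f'\circ p=p'\circ f$ for some definable $p':S\to S'$. The tuple $(j_1,\dots,j_n)$ is the type of the (nonempty) cell. The notion depends on an ordering of the factors of $M^n$. **Dimension.** For nonempty definable $X\subset M^n$, $\dim X$ is the maximum of the sums $i_1+\cdots+i_n$ over the types $(i_1,\dots,i_n)$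 of all (nonempty) cells contained in $X$, for all orderings of the $n$ factors of $M^n$; $\dim\emptyset=-\infty$. If $X\subset S\times M^n$ is definable with $S$ auxiliary, $\dim X:=\dim p(X)$ with $p:S\times M^n\to M^n$ the projection. For $F:X\to Y$ definable, $\dim(X/Y)$ is the maximum of $\dim F^{-1}(y)$ over $y\in Y$.
   Formalization: The universe M of the main sort is assumed not to have exactly two elements; in every two-element b-minimal model M is the only ball and part (3) fails (four tuples of M^4 with exactly one coordinate b have dimension 1 but map bijectively onto M^2). *)

theory Defs
  imports "HOL-Library.Extended_Real" "HOL-Combinatorics.Permutations"
begin

section \<open>Many-sorted first-order logic\<close>

datatype 'f trm = Var nat | App 'f "'f trm list"

text \<open>Variables are de Bruijn indices; a formula is read in a context, the list of the sorts of
  its free variables.\<close>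

datatype ('f, 'r, 's) fm =
    Eq "'f trm" "'f trm"
  | Rel 'r "'f trm list"
  | Neg "('f, 'r, 's) fm"
  | Conj "('f, 'r, 's) fm" "('f, 'r, 's) fm"
  | Exists 's "('f, 'r, 's) fm"

text \<open>Sorts that are neither \<open>main\<close> nor in \<open>aux\<close> are permitted. The relation
  symbol \<open>ball\<close> is the predicate $B$ of $\mathcal L_B$.\<close>

record ('s, 'f, 'r) lang =
  main :: 's
  aux :: "'s set"
  funs :: "'f set"
  rels :: "'r set"
  arg_sorts :: "'f \<Rightarrow> 's list"
  res_sort :: "'f \<Rightarrow> 's"
  rel_sorts :: "'r \<Rightarrow> 's list"
  ball :: 'r

text \<open>An expansion of $\mathcal L_B$: the predicate $B$ lives on $A_B \times M$ for a finite
  product $A_B$ of sorts.\<close>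

definition language :: "('s, 'f, 'r) lang \<Rightarrow> bool" where
  "language L \<longleftrightarrow> main L \<notin> aux L \<and> ball L \<in> rels L \<and>
     (\<exists>as. rel_sorts L (ball L) = as @ [main L])"

inductive wf_trm :: "('s, 'f, 'r) lang \<Rightarrow> 's list \<Rightarrow> 'f trm \<Rightarrow> 's \<Rightarrow> bool"
  for L :: "('s, 'f, 'r) lang" and \<Gamma> :: "'s list" where
  Var: "i < length \<Gamma> \<Longrightarrow> wf_trm L \<Gamma> (Var i) (\<Gamma> ! i)"
| App: "g \<in> funs L \<Longrightarrow> list_all2 (wf_trm L \<Gamma>) us (arg_sorts L g) \<Longrightarrow>
    wf_trm L \<Gamma> (App g us) (res_sort L g)"

fun wf_fm :: "('s, 'f, 'r) lang \<Rightarrow> 's list \<Rightarrow> ('f, 'r, 's) fm \<Rightarrow> bool" where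
  "wf_fm L \<Gamma> (Eq t u) \<longleftrightarrow> (\<exists>s. wf_trm L \<Gamma> t s \<and> wf_trm L \<Gamma> u s)"
| "wf_fm L \<Gamma> (Rel r us) \<longleftrightarrow> r \<in> rels L \<and> list_all2 (wf_trm L \<Gamma>) us (rel_sorts L r)"
| "wf_fm L \<Gamma> (Neg \<phi>) \<longleftrightarrow> wf_fm L \<Gamma> \<phi>"
| "wf_fm L \<Gamma> (Conj \<phi> \<psi>) \<longleftrightarrow> wf_fm L \<Gamma> \<phi> \<and> wf_fm L \<Gamma> \<psi>"
| "wf_fm L \<Gamma> (Exists s \<phi>) \<longleftrightarrow> wf_fm L (s # \<Gamma>) \<phi>"

record ('s, 'f, 'r, 'u) struct =
  carr :: "'s \<Rightarrow> 'u set"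
  fint :: "'f \<Rightarrow> 'u list \<Rightarrow> 'u"
  rint :: "'r \<Rightarrow> 'u list set"

definition tuples :: "('s, 'f, 'r, 'u) struct \<Rightarrow> 's list \<Rightarrow> 'u list set" where
  "tuples M ss = {xs. list_all2 (\<lambda>x s. x \<in> carr M s) xs ss}"

fun eval_trm :: "('s, 'f, 'r, 'u) struct \<Rightarrow> 'u list \<Rightarrow> 'f trm \<Rightarrow> 'u" where
  "eval_trm M e (Var i) = e ! i"
| "eval_trm M e (App g us) = fint M g (map (eval_trm M e) us)"

fun sat :: "('s, 'f, 'r, 'u) struct \<Rightarrow> 'u list \<Rightarrow> ('f, 'r, 's) fm \<Rightarrow> bool" where
  "sat M e (Eq t u) \<longleftrightarrow> eval_trm M e t = eval_trm M e u"
| "sat M e (Rel r us) \<longleftrightarrow> map (eval_trm M e) us \<in> rint M r"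
| "sat M e (Neg \<phi>) \<longleftrightarrow> \<not> sat M e \<phi>"
| "sat M e (Conj \<phi> \<psi>) \<longleftrightarrow> sat M e \<phi> \<and> sat M e \<psi>"
| "sat M e (Exists s \<phi>) \<longleftrightarrow> (\<exists>a\<in>carr M s. sat M (a # e) \<phi>)"

text \<open>As for every model of $\mathcal L_B$, the interpretation of $B$ is nonempty.\<close>

definition is_structure :: "('s, 'f, 'r) lang \<Rightarrow> ('s, 'f, 'r, 'u) struct \<Rightarrow> bool" where
  "is_structure L M \<longleftrightarrow>
     (\<forall>g\<in>funs L. \<forall>xs\<in>tuples M (arg_sorts L g). fint M g xs \<in> carr M (res_sort L g)) \<and>
     (\<forall>r\<in>rels L. rint M r \<subseteq> tuples M (rel_sorts L r)) \<and>
     rint M (ball L) \<noteq> {}"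

definition is_theory :: "('s, 'f, 'r) lang \<Rightarrow> ('f, 'r, 's) fm set \<Rightarrow> bool" where
  "is_theory L T \<longleftrightarrow> (\<forall>\<phi>\<in>T. wf_fm L [] \<phi>)"

definition is_model ::
  "('s, 'f, 'r) lang \<Rightarrow> ('f, 'r, 's) fm set \<Rightarrow> ('s, 'f, 'r, 'u) struct \<Rightarrow> bool" where
  "is_model L T M \<longleftrightarrow> is_structure L M \<and> (\<forall>\<phi>\<in>T. sat M [] \<phi>)"

section \<open>Definable sets and maps\<close>

text \<open>Parameters are tagged with their sort, since the universes of distinct sorts may
  overlap inside \<open>'u\<close>.\<close>

definition elems :: "('s, 'f, 'r, 'u) struct \<Rightarrow> ('s \<times> 'u) set" where
  "elems M = {(s, a). a \<in> carr M s}"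

definition definable ::
  "('s, 'f, 'r) lang \<Rightarrow> ('s, 'f, 'r, 'u) struct \<Rightarrow> ('s \<times> 'u) set \<Rightarrow> 's list \<Rightarrow> 'u list set \<Rightarrow> bool"
  where
  "definable L M A ss X \<longleftrightarrow>
     (\<exists>\<phi> ps. set ps \<subseteq> A \<and> wf_fm L (ss @ map fst ps) \<phi> \<and>
        X = {xs \<in> tuples M ss. sat M (xs @ map snd ps) \<phi>})"

text \<open>Only the restriction of \<open>h\<close> to \<open>X\<close> matters.\<close>

definition definable_map ::
  "('s, 'f, 'r) lang \<Rightarrow> ('s, 'f, 'r, 'u) struct \<Rightarrow> ('s \<times> 'u) set \<Rightarrow>
    's list \<Rightarrow> 'u list set \<Rightarrow> 's list \<Rightarrow> 'u list set \<Rightarrow> ('u list \<Rightarrow> 'u list) \<Rightarrow> bool"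
  where
  "definable_map L M A ss X ts Y h \<longleftrightarrow>
     definable L M A ss X \<and> definable L M A ts Y \<and> h ` X \<subseteq> Y \<and>
     definable L M A (ss @ ts) {x @ h x |x. x \<in> X}"

text \<open>A definable set in the product of the sorts \<open>ss\<close> is auxiliary if \<open>set ss \<subseteq> aux L\<close>;
  the empty product, whose only element is the empty tuple, is included.\<close>

definition fiber :: "('a \<Rightarrow> 'b) \<Rightarrow> 'a set \<Rightarrow> 'b \<Rightarrow> 'a set" where
  "fiber h X s = {x \<in> X. h x = s}"

section \<open>Balls and b-minimality\<close>

text \<open>The main sort $M$ is identified with $M^1$: its subsets are sets of lists of length one.\<close>

definition is_ball :: "('s, 'f, 'r) lang \<Rightarrow> ('s, 'f, 'r, 'u) struct \<Rightarrow> 'u list set \<Rightarrow> bool" where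
  "is_ball L M D \<longleftrightarrow>
     D \<noteq> {} \<and>
     (\<exists>a\<in>tuples M (butlast (rel_sorts L (ball L))). D = {[m] |m. a @ [m] \<in> rint M (ball L)})"

definition is_point :: "'a set \<Rightarrow> bool" where
  "is_point D \<longleftrightarrow> (\<exists>x. D = {x})"

definition b_minimal :: "('s, 'f, 'r) lang \<Rightarrow> ('s, 'f, 'r, 'u) struct \<Rightarrow> bool" where
  "b_minimal L M \<longleftrightarrow>
     (\<forall>A X F. A \<subseteq> elems M \<and> definable L M A [main L] X \<and>
         definable_map L M A [main L] X [main L] (tuples M [main L]) F \<longrightarrow>
       (\<exists>ss S h. set ss \<subseteq> aux L \<and> definable_map L M A [main L] X ss S h \<and>
          (\<forall>s\<in>h ` X. is_point (fiber h X s) \<or> is_ball L M (fiber h X s))) \<and>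
       (\<forall>ss S D g. set ss \<subseteq> aux L \<and> is_ball L M D \<and>
          definable_map L M (elems M) ss S [main L] D g \<longrightarrow> g ` S \<noteq> D) \<and>
       (\<exists>ss S h. set ss \<subseteq> aux L \<and> definable_map L M A [main L] X ss S h \<and>
          (\<forall>s\<in>h ` X. inj_on F (fiber h X s) \<or> (\<exists>c. \<forall>x\<in>fiber h X s. F x = c))))"

text \<open>The type argument fixes where the universes of the models of \<open>T\<close> live. A failure of
  $b$-minimality involves finitely many parameters and passes to elementary substructures, so by
  the downward Loewenheim-Skolem theorem every model of \<open>T\<close>, of any cardinality, is
  $b$-minimal as soon as this holds for \<open>'u\<close> infinite and at least as large as the set of
  formulas.\<close>

definition b_minimal_theory ::
  "'u itself \<Rightarrow> ('s, 'f, 'r) lang \<Rightarrow> ('f, 'r, 's) fm set \<Rightarrow> bool" where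
  "b_minimal_theory _ L T \<longleftrightarrow>
     (\<forall>M :: ('s, 'f, 'r, 'u) struct. is_model L T M \<longrightarrow> b_minimal L M)"

text \<open>For a structure with universes in \<open>'u\<close>, the type \<open>('f, 'r, 's, 'u) big\<close> is of
  this kind, and it has room for the ultrapowers of the structure indexed by sets of formulas with
  parameters. (If \<open>'u\<close> has only one element then so does this type; but a one-element main
  sort is a ball and an image of the empty product of sorts, hence never $b$-minimal.)\<close>

type_synonym ('f, 'r, 's, 'u) big = "(('f, 'r, 's) fm \<times> 'u list) set \<Rightarrow> 'u"

section \<open>Cells and dimension\<close>

text \<open>\<open>cell L M js X ss S h\<close>: the set \<open>X\<close> is a \<open>js\<close>-cell in $M^n$, \<open>n = length js\<close>, with
  presentation $h : X \to S$, where \<open>S\<close> lies in the product of the sorts \<open>ss\<close>. The case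
  \<open>Nil\<close> is the convention that the point $M^0$ is a cell of the empty type, so that
  $\dim M^0 = 0$; it is not used by the inductive step, which starts at $n = 2$.\<close>

inductive cell ::
  "('s, 'f, 'r) lang \<Rightarrow> ('s, 'f, 'r, 'u) struct \<Rightarrow> nat list \<Rightarrow> 'u list set \<Rightarrow>
    's list \<Rightarrow> 'u list set \<Rightarrow> ('u list \<Rightarrow> 'u list) \<Rightarrow> bool"
  for L :: "('s, 'f, 'r) lang" and M :: "('s, 'f, 'r, 'u) struct" where
  Nil:
    "set ss \<subseteq> aux L \<Longrightarrow> definable_map L M (elems M) [] X ss S h \<Longrightarrow> cell L M [] X ss S h"
| Zero:
    "set ss \<subseteq> aux L \<Longrightarrow> definable_map L M (elems M) [main L] X ss S h \<Longrightarrow>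
     (\<forall>s\<in>h ` X. is_point (fiber h X s)) \<Longrightarrow> cell L M [0] X ss S h"
| One:
    "set ss \<subseteq> aux L \<Longrightarrow> definable_map L M (elems M) [main L] X ss S h \<Longrightarrow>
     (\<forall>s\<in>h ` X. is_ball L M (fiber h X s)) \<Longrightarrow> cell L M [1] X ss S h"
| Step:
    "js \<noteq> [] \<Longrightarrow> set ss \<subseteq> aux L \<Longrightarrow>
     definable_map L M (elems M) (replicate (length js + 1) (main L)) X ss S h \<Longrightarrow>
     (\<forall>y\<in>butlast ` X. cell L M [j] {[m] |m. y @ [m] \<in> X} ss S (\<lambda>z. h (y @ z))) \<Longrightarrow>
     cell L M js (butlast ` X) ss' S' h' \<Longrightarrow>
     definable_map L M (elems M) ss S ss' S' q \<Longrightarrow>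
     (\<forall>x\<in>X. h' (butlast x) = q (h x)) \<Longrightarrow>
     cell L M (js @ [j]) X ss S h"

text \<open>Orderings of the $n$ factors of $M^n$ are permutations of the coordinates. The set of sums
  is bounded by \<open>n\<close>, and nonempty when \<open>X\<close> is, so \<open>Sup\<close> is a maximum, with value
  $-\infty$ for the empty set.\<close>

definition dim_main ::
  "('s, 'f, 'r) lang \<Rightarrow> ('s, 'f, 'r, 'u) struct \<Rightarrow> nat \<Rightarrow> 'u list set \<Rightarrow> ereal" where
  "dim_main L M n X =
     Sup {ereal (real (sum_list js)) |js.
       length js = n \<and>
       (\<exists>C \<sigma> ss S h. C \<noteq> {} \<and> C \<subseteq> X \<and> \<sigma> permutes {..<n} \<and>
          cell L M js (permute_list \<sigma> ` C) ss S h)}"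

text \<open>The projection to the main coordinates, for coordinates of sorts \<open>ts\<close>. Main and
  auxiliary coordinates may be interleaved; for \<open>ts = ss @ replicate n (main L)\<close> with
  \<open>set ss \<subseteq> aux L\<close> this is $p : S \times M^n \to M^n$.\<close>

definition main_part :: "('s, 'f, 'r) lang \<Rightarrow> 's list \<Rightarrow> 'u list \<Rightarrow> 'u list" where
  "main_part L ts xs = map fst (filter (\<lambda>(x, s). s = main L) (zip xs ts))"

definition dim ::
  "('s, 'f, 'r) lang \<Rightarrow> ('s, 'f, 'r, 'u) struct \<Rightarrow> 's list \<Rightarrow> 'u list set \<Rightarrow> ereal" where
  "dim L M ts X = dim_main L M (count_list ts (main L)) (main_part L ts ` X)"

text \<open>$\dim(X/Y)$ for \<open>X\<close> over \<open>Y\<close> by \<open>\<pi>\<close>; it is $-\infty$ if \<open>Y\<close> is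
  empty.\<close>

definition dim_over ::
  "('s, 'f, 'r) lang \<Rightarrow> ('s, 'f, 'r, 'u) struct \<Rightarrow> 's list \<Rightarrow> 'u list set \<Rightarrow>
    ('u list \<Rightarrow> 'u list) \<Rightarrow> 'u list set \<Rightarrow> ereal" where
  "dim_over L M ts Y \<pi> X = (SUP y\<in>Y. dim L M ts (fiber \<pi> X y))"

text \<open>A pitfall: if $M = \{a, b\}$ is the only ball and there are no auxiliary sorts, or only
  one-element ones, then (b1) to (b3) hold, but monotonicity of \<open>dim\<close> under images fails. For
  example a set of four points of $M^4$, each having a single coordinate equal to \<open>b\<close>, contains no
  two-dimensional cell, but it is in definable bijection with $M^2$. In all other $b$-minimal
  structures $M$ is infinite: by (b3), if \<open>M\<close> has at least three elements then some
  auxiliary set has at least two, and then every finite set is the image of an auxiliary set, so balls are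
  infinite by (b2).\<close>

text \<open>The locus of the \<open>x'\<close> in \<open>X'\<close> with $\dim(h^{-1}(x')/Y) = d$.\<close>

definition dim_locus ::
  "('s, 'f, 'r) lang \<Rightarrow> ('s, 'f, 'r, 'u) struct \<Rightarrow> 's list \<Rightarrow> 'u list set \<Rightarrow>
    ('u list \<Rightarrow> 'u list) \<Rightarrow> 'u list set \<Rightarrow> 'u list set \<Rightarrow> ('u list \<Rightarrow> 'u list) \<Rightarrow>
    nat \<Rightarrow> 'u list set" where
  "dim_locus L M ts Y \<pi> X X' h d =
     {x' \<in> X'. dim_over L M ts Y \<pi> (fiber h X x') = ereal (real d)}"

end

theory Submission
  imports Defs
begin

text \<open>Call a definable subset of the main sort big if it contains a ball. Applied in an
  ultrapower realizing all types over the structure, (b1) and (b3) give, by compactness, auxiliary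
  covers that are uniform in definable families. Together with (b2) it follows that bigness is a
  definable quantifier and that an auxiliary family of sets whose union is big has a big member.
  For a sequence \<open>js\<close> of zeros and ones, iterate ``there is'' (for 0) and ``for a big set
  of'' (for 1); a set contains a cell of type \<open>js\<close> only if \<open>many js\<close> holds of it, and if
  \<open>many js\<close> holds then it contains a cell of at least that dimension. This makes dimension
  definable in families. The exchange argument based on (b3) shows that a subset of $M^d$ has no
  definable image that is big in all $e$ coordinates unless $e \<le> d$; so \<open>dim X \<ge> e\<close> means
  that some partial definable map $X \to M^e$ has such an image. In this form invariance under
  permutations of coordinates, under images and under auxiliary fibres is evident, and additivity
  follows by splitting a graph into cells with constant presentation.\<close>

section \<open>Ultrapowers\<close>

text \<open>The obstacle is uniformity. (b1) and (b3) provide, for one set of parameters at a time,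
  an auxiliary product and a map that may change with the parameters, while the arguments below
  handle whole definable families and need one formula for each. If no finite list of formulas
  served all parameters of a family, some parameter in a suitable ultrapower would escape every one
  of them, against b-minimality of the ultrapower over that parameter. This explains the index set:
  sets of pairs of a formula and a parameter tuple, with an ultrafilter concentrated on the finite
  ones. The assumption that the main sort does not have exactly two elements enters through a single
  fact: some auxiliary product has two distinct elements, so that the union of two sets is an
  auxiliary union. Dimension is only ever compared with natural numbers. Its description by partial
  maps mentions neither cells nor orderings; cells return when a set has to be thinned out until its
  coordinates of type 1 determine the point, which is what allows the exchange argument to count
  them.\<close>

locale ultrafilter =
  fixes ev :: "('i \<Rightarrow> bool) \<Rightarrow> bool"
  assumes ev_conj: "ev (\<lambda>i. P i \<and> Q i) \<longleftrightarrow> ev P \<and> ev Q"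
    and ev_not: "ev (\<lambda>i. \<not> P i) \<longleftrightarrow> \<not> ev P"
begin

lemma ev_mono: "ev P \<Longrightarrow> (\<And>i. P i \<Longrightarrow> Q i) \<Longrightarrow> ev Q"
proof -
  assume "ev P" "\<And>i. P i \<Longrightarrow> Q i"
  then have "P = (\<lambda>i. P i \<and> Q i)" by auto
  then show "ev Q" using \<open>ev P\<close> ev_conj[of P Q] by simp
qed

lemma ev_mp: "ev P \<Longrightarrow> ev (\<lambda>i. P i \<longrightarrow> Q i) \<Longrightarrow> ev Q"
  using ev_conj[of P "\<lambda>i. P i \<longrightarrow> Q i"] ev_mono[of "\<lambda>i. P i \<and> (P i \<longrightarrow> Q i)" Q] by blast

lemma ev_const [simp]: "ev (\<lambda>i. c) \<longleftrightarrow> c"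
  using ev_not[of "\<lambda>i. True"] ev_conj[of "\<lambda>i. True" "\<lambda>i. False"] ev_mono[of "\<lambda>i. False" "\<lambda>i. True"]
  by (cases c) auto

lemma ev_list_all2: "ev (\<lambda>i. list_all2 (\<lambda>x y. P i x y) xs ys) \<longleftrightarrow> list_all2 (\<lambda>x y. ev (\<lambda>i. P i x y)) xs ys"
proof (induction xs arbitrary: ys)
  case Nil
  then show ?case by (cases ys) auto
next
  case (Cons a xs)
  then show ?case by (cases ys) (auto simp: ev_conj)
qed

definition rep :: "('i \<Rightarrow> 'u) \<Rightarrow> 'i \<Rightarrow> 'u" where
  "rep x = (SOME y. ev (\<lambda>i. x i = y i))"

lemma rep_ev: "ev (\<lambda>i. x i = rep x i)"
  unfolding rep_def by (rule someI[of _ x]) simp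

text \<open>The choice in \<open>rep\<close> sees a function only through its class: equivalent
  functions hand one and the same predicate to the choice operator.\<close>

lemma rep_eq: "ev (\<lambda>i. x i = y i) \<Longrightarrow> rep x = rep y"
proof -
  assume xy: "ev (\<lambda>i. x i = y i)"
  have "ev (\<lambda>i. x i = z i) = ev (\<lambda>i. y i = z i)" for z
  proof
    assume "ev (\<lambda>i. x i = z i)"
    then have "ev (\<lambda>i. x i = y i \<and> x i = z i)" using xy by (simp add: ev_conj)
    then show "ev (\<lambda>i. y i = z i)" by (rule ev_mono) auto
  next
    assume "ev (\<lambda>i. y i = z i)"
    then have "ev (\<lambda>i. x i = y i \<and> y i = z i)" using xy by (simp add: ev_conj)
    then show "ev (\<lambda>i. x i = z i)" by (rule ev_mono) auto
  qed
  then show ?thesis unfolding rep_def by simp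
qed

lemma rep_rep [simp]: "rep (rep x) = rep x"
proof -
  have "rep x = rep (rep x)" by (rule rep_eq) (rule rep_ev)
  then show ?thesis by simp
qed

lemma rep_eq_iff:
  assumes "rep x = x" "rep y = y"
  shows "x = y \<longleftrightarrow> ev (\<lambda>i. x i = y i)"
proof
  assume "ev (\<lambda>i. x i = y i)"
  then have "rep x = rep y" by (rule rep_eq)
  then show "x = y" by (simp only: assms)
qed simp

text \<open>Elements of the ultrapower are canonical representatives of the classes modulo the
  ultrafilter, because equality of the universes is equality of the type.\<close>

definition coord :: "'i \<Rightarrow> ('i \<Rightarrow> 'u) list \<Rightarrow> 'u list" where
  "coord i xs = map (\<lambda>x. x i) xs"

definition upow :: "('s, 'f, 'r) lang \<Rightarrow> ('s, 'f, 'r, 'u) struct \<Rightarrow> ('s, 'f, 'r, 'i \<Rightarrow> 'u) struct" where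
  "upow L M = \<lparr>carr = (\<lambda>s. {x. rep x = x \<and> ev (\<lambda>i. x i \<in> carr M s)}),
     fint = (\<lambda>g xs. rep (\<lambda>i. fint M g (coord i xs))),
     rint = (\<lambda>r. {xs. list_all2 (\<lambda>x s. rep x = x \<and> ev (\<lambda>i. x i \<in> carr M s)) xs (rel_sorts L r) \<and>
       ev (\<lambda>i. coord i xs \<in> rint M r)})\<rparr>"

lemma coord_simps [simp]: "coord i [] = []" "coord i (x # xs) = x i # coord i xs" "coord i (xs @ ys) = coord i xs @ coord i ys"
  "length (coord i xs) = length xs"
  by (auto simp: coord_def)

lemma upow_carr: "x \<in> carr (upow L M) s \<longleftrightarrow> rep x = x \<and> ev (\<lambda>i. x i \<in> carr M s)"
  by (simp add: upow_def)

lemma upow_tuples: "xs \<in> tuples (upow L M) ss \<Longrightarrow> ev (\<lambda>i. coord i xs \<in> tuples M ss)"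
proof -
  assume "xs \<in> tuples (upow L M) ss"
  then have "list_all2 (\<lambda>x s. ev (\<lambda>i. x i \<in> carr M s)) xs ss"
    by (auto simp: tuples_def upow_carr elim!: list_all2_mono)
  then show ?thesis
    by (simp flip: ev_list_all2 add: tuples_def coord_def list_all2_map1)
qed

lemma upow_tuples_rep: "xs \<in> tuples (upow L M) ss \<Longrightarrow> x \<in> set xs \<Longrightarrow> rep x = x"
  by (auto simp: tuples_def upow_carr list_all2_conv_all_nth in_set_conv_nth)

lemma upow_tuples_eq:
  assumes "xs \<in> tuples (upow L M) ss" "ys \<in> tuples (upow L M) ss"
  shows "xs = ys \<longleftrightarrow> ev (\<lambda>i. coord i xs = coord i ys)"
proof -
  have "xs = ys \<longleftrightarrow> list_all2 (=) xs ys" by (simp add: list_all2_eq)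
  also have "\<dots> \<longleftrightarrow> list_all2 (\<lambda>x y. ev (\<lambda>i. x i = y i)) xs ys"
    using upow_tuples_rep[OF assms(1)] upow_tuples_rep[OF assms(2)] rep_eq_iff
    by (intro list.rel_cong) auto
  also have "\<dots> \<longleftrightarrow> ev (\<lambda>i. coord i xs = coord i ys)"
    by (simp flip: ev_list_all2 add: list_all2_eq coord_def list_all2_map1 list_all2_map2)
  finally show ?thesis .
qed

text \<open>Taking representatives entry by entry turns a choice made index by index into one tuple
  of the ultrapower. Counterexamples picked separately at each index become a single parameter this
  way.\<close>

lemma upow_lift:
  assumes "ev (\<lambda>i. x i \<in> tuples M ss)"
  obtains xs where "xs \<in> tuples (upow L M) ss" "ev (\<lambda>i. coord i xs = x i)"
proof -
  have "\<exists>xs. xs \<in> tuples (upow L M) ss \<and> ev (\<lambda>i. coord i xs = x i)"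
    using assms
  proof (induction ss arbitrary: x)
    case Nil
    then show ?case by (intro exI[of _ "[]"]) (auto simp: tuples_def elim: ev_mono)
  next
    case (Cons s ss)
    have e1: "ev (\<lambda>i. tl (x i) \<in> tuples M ss)"
      using Cons.prems by (rule ev_mono) (auto simp: tuples_def list_all2_Cons2)
    have e2: "ev (\<lambda>i. hd (x i) \<in> carr M s \<and> x i = hd (x i) # tl (x i))"
      using Cons.prems by (rule ev_mono) (auto simp: tuples_def list_all2_Cons2)
    obtain xs where xs: "xs \<in> tuples (upow L M) ss" "ev (\<lambda>i. coord i xs = tl (x i))"
      using Cons.IH[OF e1] by blast
    define h where "h = rep (\<lambda>i. hd (x i))"
    have h: "ev (\<lambda>i. hd (x i) = h i)" unfolding h_def by (rule rep_ev)
    have "ev (\<lambda>i. (hd (x i) = h i \<and> coord i xs = tl (x i)) \<and> (hd (x i) \<in> carr M s \<and> x i = hd (x i) # tl (x i)))"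
      using h xs(2) e2 by (simp add: ev_conj)
    then have "ev (\<lambda>i. h i \<in> carr M s \<and> coord i (h # xs) = x i)"
      by (rule ev_mono) auto
    moreover have "rep h = h" by (simp add: h_def)
    ultimately show ?case using xs(1)
      by (intro exI[of _ "h # xs"]) (auto simp: tuples_def upow_carr ev_conj)
  qed
  then show ?thesis using that by blast
qed

text \<open>The induction must also carry that the value is an element of the ultrapower, in
  particular a canonical representative; only then does equality of terms mean equality almost
  everywhere.\<close>

lemma upow_eval:
  assumes "is_structure L M" "wf_trm L \<Gamma> t s" "e \<in> tuples (upow L M) \<Gamma>"
  shows "eval_trm (upow L M) e t \<in> carr (upow L M) s \<and>
    ev (\<lambda>i. eval_trm (upow L M) e t i = eval_trm M (coord i e) t)"
  using assms(2)
proof induction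
  case (Var i)
  then show ?case using assms(3)
    by (auto simp: tuples_def list_all2_conv_all_nth coord_def)
next
  case (App g us)
  let ?N = "upow L M"
  have "list_all2 (\<lambda>u s. eval_trm ?N e u \<in> carr ?N s) us (arg_sorts L g)"
    using App(2) by (rule list_all2_mono) auto
  then have t: "map (eval_trm ?N e) us \<in> tuples ?N (arg_sorts L g)"
    by (simp add: tuples_def list_all2_map1)
  from upow_tuples[OF this] have "ev (\<lambda>i. coord i (map (eval_trm ?N e) us) \<in> tuples M (arg_sorts L g))" .
  then have c: "ev (\<lambda>i. fint M g (coord i (map (eval_trm ?N e) us)) \<in> carr M (res_sort L g))"
    by (rule ev_mono) (use assms(1) App(1) in \<open>auto simp: is_structure_def\<close>)
  define y where "y = (\<lambda>i. fint M g (coord i (map (eval_trm ?N e) us)))"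
  have app: "eval_trm ?N e (App g us) = rep y"
    by (simp add: upow_def y_def)
  have ry: "ev (\<lambda>i. y i = rep y i)" by (rule rep_ev)
  have "ev (\<lambda>i. y i \<in> carr M (res_sort L g) \<and> y i = rep y i)"
    using c ry by (simp add: ev_conj y_def)
  then have "ev (\<lambda>i. rep y i \<in> carr M (res_sort L g))" by (rule ev_mono) auto
  moreover have "list_all2 (\<lambda>u s. ev (\<lambda>i. eval_trm ?N e u i = eval_trm M (coord i e) u)) us (arg_sorts L g)"
    using App(2) by (rule list_all2_mono) auto
  then have "ev (\<lambda>i. list_all2 (\<lambda>u s. eval_trm ?N e u i = eval_trm M (coord i e) u) us (arg_sorts L g))"
    by (simp add: ev_list_all2)
  then have "ev (\<lambda>i. coord i (map (eval_trm ?N e) us) = map (eval_trm M (coord i e)) us)"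
    by (rule ev_mono) (auto simp: list_all2_conv_all_nth coord_def in_set_conv_nth)
  then have "ev (\<lambda>i. coord i (map (eval_trm ?N e) us) = map (eval_trm M (coord i e)) us \<and> y i = rep y i)"
    using ry by (simp add: ev_conj)
  then have "ev (\<lambda>i. rep y i = eval_trm M (coord i e) (App g us))"
    by (rule ev_mono) (auto simp: y_def)
  ultimately show ?case unfolding app by (simp add: upow_carr)
qed

lemma upow_evals:
  assumes "is_structure L M" "list_all2 (wf_trm L \<Gamma>) us ss" "e \<in> tuples (upow L M) \<Gamma>"
  shows "map (eval_trm (upow L M) e) us \<in> tuples (upow L M) ss"
    and "ev (\<lambda>i. coord i (map (eval_trm (upow L M) e) us) = map (eval_trm M (coord i e)) us)"
proof -
  let ?N = "upow L M"
  have *: "list_all2 (\<lambda>u s. eval_trm (upow L M) e u \<in> carr (upow L M) s \<and>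
    ev (\<lambda>i. eval_trm (upow L M) e u i = eval_trm M (coord i e) u)) us ss"
    using assms(2) by (rule list_all2_mono) (use upow_eval[OF assms(1) _ assms(3)] in auto)
  then show "map (eval_trm (upow L M) e) us \<in> tuples (upow L M) ss"
    by (auto simp: tuples_def list_all2_map1 elim: list_all2_mono)
  from * have "list_all2 (\<lambda>u s. ev (\<lambda>i. eval_trm ?N e u i = eval_trm M (coord i e) u)) us ss"
    by (auto elim: list_all2_mono)
  then have "ev (\<lambda>i. list_all2 (\<lambda>u s. eval_trm ?N e u i = eval_trm M (coord i e) u) us ss)"
    by (simp add: ev_list_all2)
  then show "ev (\<lambda>i. coord i (map (eval_trm ?N e) us) = map (eval_trm M (coord i e)) us)"
    by (rule ev_mono) (auto simp: list_all2_conv_all_nth coord_def in_set_conv_nth)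
qed

lemma ev_cong: "ev (\<lambda>i. P i = Q i) \<Longrightarrow> ev P = ev Q"
  using ev_mp[of P Q] ev_mp[of Q P] ev_mono[of "\<lambda>i. P i = Q i" "\<lambda>i. P i \<longrightarrow> Q i"]
    ev_mono[of "\<lambda>i. P i = Q i" "\<lambda>i. Q i \<longrightarrow> P i"] by blast

text \<open>Conjunction and negation are the two axioms of \<open>ultrafilter\<close>; the
  quantifier needs witnesses chosen at almost all indices simultaneously.\<close>

theorem Los:
  assumes "is_structure L M" "wf_fm L \<Gamma> \<phi>" "e \<in> tuples (upow L M) \<Gamma>"
  shows "sat (upow L M) e \<phi> \<longleftrightarrow> ev (\<lambda>i. sat M (coord i e) \<phi>)"
  using assms(2,3)
proof (induction \<phi> arbitrary: \<Gamma> e)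
  case (Eq t u)
  then obtain s where s: "wf_trm L \<Gamma> t s" "wf_trm L \<Gamma> u s" by auto
  note t = upow_eval[OF assms(1) s(1) Eq(2)] and u = upow_eval[OF assms(1) s(2) Eq(2)]
  have "eval_trm (upow L M) e t = eval_trm (upow L M) e u \<longleftrightarrow>
      ev (\<lambda>i. eval_trm (upow L M) e t i = eval_trm (upow L M) e u i)"
    using t u rep_eq_iff by (auto simp: upow_carr)
  also have "\<dots> \<longleftrightarrow> ev (\<lambda>i. eval_trm M (coord i e) t = eval_trm M (coord i e) u)"
  proof (rule ev_cong)
    have "ev (\<lambda>i. eval_trm (upow L M) e t i = eval_trm M (coord i e) t \<and> eval_trm (upow L M) e u i = eval_trm M (coord i e) u)"
      using t u by (simp add: ev_conj)
    then show "ev (\<lambda>i. (eval_trm (upow L M) e t i = eval_trm (upow L M) e u i) = (eval_trm M (coord i e) t = eval_trm M (coord i e) u))"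
      by (rule ev_mono) auto
  qed
  finally show ?case by simp
next
  case (Rel r us)
  then have w: "r \<in> rels L" "list_all2 (wf_trm L \<Gamma>) us (rel_sorts L r)" by auto
  note us = upow_evals[OF assms(1) w(2) Rel(2)]
  have "sat (upow L M) e (Rel r us) \<longleftrightarrow> ev (\<lambda>i. coord i (map (eval_trm (upow L M) e) us) \<in> rint M r)"
    using us(1) by (auto simp: upow_def tuples_def)
  also have "\<dots> \<longleftrightarrow> ev (\<lambda>i. map (eval_trm M (coord i e)) us \<in> rint M r)"
    by (rule ev_cong, rule ev_mono[OF us(2)]) auto
  finally show ?case by simp
next
  case (Neg \<phi>)
  then show ?case by (simp add: ev_not)
next
  case (Conj \<phi> \<psi>)
  from Conj.prems have w: "wf_fm L \<Gamma> \<phi>" "wf_fm L \<Gamma> \<psi>" by auto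
  show ?case using Conj.IH(1)[OF w(1) Conj.prems(2)] Conj.IH(2)[OF w(2) Conj.prems(2)]
    by (simp only: sat.simps ev_conj)
next
  case (Exists s \<phi>)
  have IH: "sat (upow L M) (a # e) \<phi> \<longleftrightarrow> ev (\<lambda>i. sat M (a i # coord i e) \<phi>)"
    if "a \<in> carr (upow L M) s" for a
    using Exists.IH[of "s # \<Gamma>" "a # e"] Exists.prems that by (simp add: tuples_def)
  show ?case
  proof
    assume "sat (upow L M) e (Exists s \<phi>)"
    then obtain a where a: "a \<in> carr (upow L M) s" "sat (upow L M) (a # e) \<phi>" by auto
    then have "ev (\<lambda>i. a i \<in> carr M s \<and> sat M (a i # coord i e) \<phi>)"
      using IH by (simp add: ev_conj upow_carr)
    then show "ev (\<lambda>i. sat M (coord i e) (Exists s \<phi>))" by (rule ev_mono) auto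
  next
    assume *: "ev (\<lambda>i. sat M (coord i e) (Exists s \<phi>))"
    \<comment> \<open>Witnesses chosen index by index. The function \<open>x\<close> need not be
      canonical, so the element of the ultrapower is \<open>rep x\<close>.\<close>
    define x where "x i = (SOME a. a \<in> carr M s \<and> sat M (a # coord i e) \<phi>)" for i
    have x: "ev (\<lambda>i. x i \<in> carr M s \<and> sat M (x i # coord i e) \<phi>)"
      using * by (rule ev_mono) (simp add: x_def, rule someI_ex, blast)
    have "ev (\<lambda>i. (x i \<in> carr M s \<and> sat M (x i # coord i e) \<phi>) \<and> x i = rep x i)"
      using x rep_ev[of x] by (simp add: ev_conj)
    then have "ev (\<lambda>i. rep x i \<in> carr M s \<and> sat M (rep x i # coord i e) \<phi>)"
      by (rule ev_mono) auto
    then have "rep x \<in> carr (upow L M) s" "sat (upow L M) (rep x # e) \<phi>"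
      using IH[of "rep x"] by (auto simp: upow_carr ev_conj)
    then show "sat (upow L M) e (Exists s \<phi>)" by auto
  qed
qed

text \<open>The diagonal embedding. A constant function need not be the chosen representative of its
  class, hence \<open>rep\<close>.\<close>

definition diag :: "'u list \<Rightarrow> ('i \<Rightarrow> 'u) list" where
  "diag xs = map (\<lambda>x. rep (\<lambda>i. x)) xs"

lemma diag_simps [simp]: "diag [] = []" "diag (x # xs) = rep (\<lambda>i. x) # diag xs"
    "diag (xs @ ys) = diag xs @ diag ys" "length (diag xs) = length xs"
  by (auto simp: diag_def)

lemma ev_diag: "ev (\<lambda>i. coord i (diag xs) = xs)"
proof (induction xs)
  case (Cons x xs)
  have "ev (\<lambda>i. x = rep (\<lambda>i. x) i \<and> coord i (diag xs) = xs)"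
    using Cons rep_ev[of "\<lambda>i. x"] by (simp add: ev_conj)
  then show ?case by (rule ev_mono) auto
qed simp

lemma rep_const_in: "a \<in> carr M s \<Longrightarrow> rep (\<lambda>i. a) \<in> carr (upow L M) s"
  using ev_mono[OF rep_ev[of "\<lambda>i. a"], of "\<lambda>i. rep (\<lambda>i. a) i \<in> carr M s"] by (auto simp: upow_carr)

lemma diag_in: "xs \<in> tuples M ss \<Longrightarrow> diag xs \<in> tuples (upow L M) ss"
  by (auto simp: tuples_def list_all2_map1 diag_def rep_const_in elim!: list_all2_mono)

lemma upow_structure:
  assumes "is_structure L M" "ball L \<in> rels L"
  shows "is_structure L (upow L M)"
  unfolding is_structure_def
proof (intro conjI ballI)
  fix g xs assume g: "g \<in> funs L" "xs \<in> tuples (upow L M) (arg_sorts L g)"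
  have "ev (\<lambda>i. fint M g (coord i xs) \<in> carr M (res_sort L g))"
    by (rule ev_mono[OF upow_tuples[OF g(2)]]) (use assms g(1) in \<open>auto simp: is_structure_def\<close>)
  then have "ev (\<lambda>i. fint M g (coord i xs) \<in> carr M (res_sort L g) \<and> fint M g (coord i xs) = rep (\<lambda>i. fint M g (coord i xs)) i)"
    by (simp only: ev_conj rep_ev[of "\<lambda>i. fint M g (coord i xs)"] simp_thms)
  then have "ev (\<lambda>i. rep (\<lambda>i. fint M g (coord i xs)) i \<in> carr M (res_sort L g))"
    by (rule ev_mono) auto
  then show "fint (upow L M) g xs \<in> carr (upow L M) (res_sort L g)"
    by (simp add: upow_def)
next
  fix r show "rint (upow L M) r \<subseteq> tuples (upow L M) (rel_sorts L r)"
    by (auto simp: upow_def tuples_def)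
next
  obtain xs where xs: "xs \<in> rint M (ball L)" using assms by (auto simp: is_structure_def)
  then have "xs \<in> tuples M (rel_sorts L (ball L))" using assms by (auto simp: is_structure_def)
  then have "diag xs \<in> tuples (upow L M) (rel_sorts L (ball L))" by (rule diag_in)
  moreover have "ev (\<lambda>i. coord i (diag xs) \<in> rint M (ball L))"
    by (rule ev_mono[OF ev_diag[of xs]]) (use xs in simp)
  ultimately have "diag xs \<in> rint (upow L M) (ball L)"
    by (auto simp: upow_def tuples_def)
  then show "rint (upow L M) (ball L) \<noteq> {}" by blast
qed

text \<open>Los's theorem for sentences. The hypothesis on the theory, rather than on
  \<open>M\<close> alone, is used through this lemma.\<close>

lemma upow_model:
  assumes "is_model L T M" "is_theory L T" "ball L \<in> rels L"
  shows "is_model L T (upow L M)"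
  using assms upow_structure[of L M] Los[of L M "[]" _ "[]"]
  by (auto simp: is_model_def is_theory_def tuples_def)

end

text \<open>A family maximal among those that together with \<open>B\<close> have the finite
  intersection property is an ultrafilter; Zorn's lemma provides one.\<close>

lemma ultrafilter_ex:
  fixes B :: "'i set set"
  assumes fip: "\<And>K. finite K \<Longrightarrow> K \<subseteq> B \<Longrightarrow> \<Inter>K \<noteq> {}"
  obtains ev where "ultrafilter ev" "\<And>b. b \<in> B \<Longrightarrow> ev (\<lambda>i. i \<in> b)"
proof -
  define \<F> where "\<F> = {F. \<forall>K. finite K \<longrightarrow> K \<subseteq> F \<union> B \<longrightarrow> \<Inter>K \<noteq> {}}"
  have fipD: "\<Inter>K \<noteq> {}" if "F \<in> \<F>" "finite K" "K \<subseteq> F \<union> B" for F K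
    using that by (simp add: \<F>_def)
  have "\<Union>C \<in> \<F>" if C: "subset.chain \<F> C" for C
  proof -
    have "\<Inter>K \<noteq> {}" if K: "finite K" "K \<subseteq> \<Union>C \<union> B" for K
    proof (cases "C = {}")
      case True
      then show ?thesis using K by (intro fip) auto
    next
      case False
      have "finite (K - B)" "K - B \<subseteq> \<Union>C" using K by auto
      then obtain F where F: "F \<in> C" "K - B \<subseteq> F"
        using finite_subset_Union_chain[OF _ _ False C] by blast
      then have "F \<in> \<F>" using C by (auto simp: subset.chain_def)
      then show ?thesis using K F(2) by (intro fipD[of F]) auto
    qed
    then show ?thesis by (simp add: \<F>_def)
  qed
  from subset_Zorn'[of \<F>, OF this] obtain F where F: "F \<in> \<F>"
    and max: "\<forall>X\<in>\<F>. F \<subseteq> X \<longrightarrow> X = F" by (rule bexE)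
  have "F \<union> B \<in> \<F>" unfolding \<F>_def mem_Collect_eq
    using fipD[OF F] by (simp add: Un_assoc)
  then have BF: "B \<subseteq> F" using max by (metis Un_upper1 Un_upper2)
  \<comment> \<open>Maximality in usable form: a set that meets every finite intersection of members
    of \<open>F\<close> could be added to \<open>F\<close>, so it already belongs to it.\<close>
  have mem: "A \<in> F" if A: "\<And>K. finite K \<Longrightarrow> K \<subseteq> F \<Longrightarrow> A \<inter> \<Inter>K \<noteq> {}" for A
  proof -
    have "\<Inter>K \<noteq> {}" if K: "finite K" "K \<subseteq> insert A F \<union> B" for K
    proof -
      have "A \<inter> \<Inter>(K - {A}) \<noteq> {}" using K BF by (intro A) auto
      then show "\<Inter>K \<noteq> {}" by blast
    qed
    then have "insert A F \<in> \<F>" by (simp add: \<F>_def)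
    then show ?thesis using max by (metis insertI1 subset_insertI)
  qed
  have F_fip: "\<Inter>K \<noteq> {}" if "finite K" "K \<subseteq> F" for K using F that by (intro fipD) auto
  have F_int: "A1 \<inter> A2 \<in> F \<longleftrightarrow> A1 \<in> F \<and> A2 \<in> F" for A1 A2
  proof
    assume *: "A1 \<inter> A2 \<in> F"
    have "A \<in> F" if "A1 \<inter> A2 \<subseteq> A" for A
    proof (rule mem)
      fix K assume "finite K" "K \<subseteq> F"
      then have "\<Inter>(insert (A1 \<inter> A2) K) \<noteq> {}" using * by (intro F_fip) auto
      then show "A \<inter> \<Inter>K \<noteq> {}" using that by auto
    qed
    then show "A1 \<in> F \<and> A2 \<in> F" by blast
  next
    assume *: "A1 \<in> F \<and> A2 \<in> F"
    show "A1 \<inter> A2 \<in> F"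
    proof (rule mem)
      fix K assume "finite K" "K \<subseteq> F"
      then have "\<Inter>(insert A1 (insert A2 K)) \<noteq> {}" using * by (intro F_fip) auto
      then show "A1 \<inter> A2 \<inter> \<Inter>K \<noteq> {}" by auto
    qed
  qed
  have F_neg: "- A \<in> F \<longleftrightarrow> A \<notin> F" for A
  proof
    assume "- A \<in> F"
    then show "A \<notin> F" using F_fip[of "{A, - A}"] by auto
  next
    assume "A \<notin> F"
    then have "\<not> (\<forall>K. finite K \<longrightarrow> K \<subseteq> F \<longrightarrow> A \<inter> \<Inter>K \<noteq> {})" by (metis mem)
    \<comment> \<open>Some finite intersection misses \<open>A\<close>, so it lies inside the
      complement of \<open>A\<close>.\<close>
    then obtain K where K: "finite K" "K \<subseteq> F" "A \<inter> \<Inter>K = {}" by auto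
    show "- A \<in> F"
    proof (rule mem)
      fix K' assume K': "finite K'" "K' \<subseteq> F"
      then have "\<Inter>(K \<union> K') \<noteq> {}" using K by (intro F_fip) auto
      then show "- A \<inter> \<Inter>K' \<noteq> {}" using K(3) by auto
    qed
  qed
  have "ultrafilter (\<lambda>P. {i. P i} \<in> F)"
    by unfold_locales (simp_all only: Collect_conj_eq Collect_neg_eq F_int F_neg)
  then show ?thesis by (rule that) (use BF in auto)
qed

section \<open>Definability calculus\<close>

fun ren_trm :: "(nat \<Rightarrow> nat) \<Rightarrow> 'f trm \<Rightarrow> 'f trm" where
  "ren_trm \<rho> (Var i) = Var (\<rho> i)"
| "ren_trm \<rho> (App g us) = App g (map (ren_trm \<rho>) us)"

fun ren_fm :: "(nat \<Rightarrow> nat) \<Rightarrow> ('f, 'r, 's) fm \<Rightarrow> ('f, 'r, 's) fm" where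
  "ren_fm \<rho> (Eq t u) = Eq (ren_trm \<rho> t) (ren_trm \<rho> u)"
| "ren_fm \<rho> (Rel r us) = Rel r (map (ren_trm \<rho>) us)"
| "ren_fm \<rho> (Neg \<phi>) = Neg (ren_fm \<rho> \<phi>)"
| "ren_fm \<rho> (Conj \<phi> \<psi>) = Conj (ren_fm \<rho> \<phi>) (ren_fm \<rho> \<psi>)"
| "ren_fm \<rho> (Exists s \<phi>) = Exists s (ren_fm (case_nat 0 (\<lambda>k. Suc (\<rho> k))) \<phi>)"

lemma wf_ren_trm:
  "wf_trm L \<Gamma> t s \<Longrightarrow> (\<And>i. i < length \<Gamma> \<Longrightarrow> \<rho> i < length \<Delta> \<and> \<Delta> ! \<rho> i = \<Gamma> ! i) \<Longrightarrow>
    wf_trm L \<Delta> (ren_trm \<rho> t) s"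
proof (induction rule: wf_trm.induct)
  case (Var i)
  then show ?case using wf_trm.Var[of "\<rho> i" \<Delta> L] by simp
next
  case (App g us)
  then have "list_all2 (wf_trm L \<Delta>) (map (ren_trm \<rho>) us) (arg_sorts L g)"
    by (auto simp: list_all2_map1 elim!: list_all2_mono)
  with App show ?case by (simp add: wf_trm.App)
qed

lemma eval_ren_trm:
  "wf_trm L \<Gamma> t s \<Longrightarrow> (\<And>i. i < length \<Gamma> \<Longrightarrow> e' ! \<rho> i = e ! i) \<Longrightarrow>
    eval_trm M e' (ren_trm \<rho> t) = eval_trm M e t"
proof (induction rule: wf_trm.induct)
  case (App g us)
  then have "list_all2 (\<lambda>u s. eval_trm M e' (ren_trm \<rho> u) = eval_trm M e u) us (arg_sorts L g)"
    by (auto elim!: list_all2_mono)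
  then have "map (eval_trm M e' \<circ> ren_trm \<rho>) us = map (eval_trm M e) us"
    by (auto simp: list_all2_conv_all_nth in_set_conv_nth)
  then show ?case by (simp only: ren_trm.simps eval_trm.simps map_map)
qed simp

lemma wf_ren_fm:
  "wf_fm L \<Gamma> \<phi> \<Longrightarrow> (\<And>i. i < length \<Gamma> \<Longrightarrow> \<rho> i < length \<Delta> \<and> \<Delta> ! \<rho> i = \<Gamma> ! i) \<Longrightarrow>
    wf_fm L \<Delta> (ren_fm \<rho> \<phi>)"
proof (induction \<phi> arbitrary: \<Gamma> \<Delta> \<rho>)
  case (Eq t u)
  then show ?case by (auto intro: wf_ren_trm)
next
  case (Rel r us)
  then have "list_all2 (wf_trm L \<Delta>) (map (ren_trm \<rho>) us) (rel_sorts L r)"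
    by (auto simp: list_all2_map1 intro: wf_ren_trm elim!: list_all2_mono)
  with Rel show ?case by simp
next
  case (Exists s \<phi>)
  have "wf_fm L (s # \<Delta>) (ren_fm (case_nat 0 (\<lambda>k. Suc (\<rho> k))) \<phi>)"
    by (rule Exists.IH[of "s # \<Gamma>"]) (use Exists.prems in \<open>auto split: nat.split simp: less_Suc_eq_0_disj\<close>)
  then show ?case by simp
qed auto

lemma sat_ren_fm:
  "wf_fm L \<Gamma> \<phi> \<Longrightarrow> (\<And>i. i < length \<Gamma> \<Longrightarrow> e' ! \<rho> i = e ! i) \<Longrightarrow>
    sat M e' (ren_fm \<rho> \<phi>) \<longleftrightarrow> sat M e \<phi>"
proof (induction \<phi> arbitrary: \<Gamma> e e' \<rho>)
  case (Eq t u)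
  then show ?case by (auto simp: eval_ren_trm)
next
  case (Rel r us)
  then have "list_all2 (\<lambda>u s. eval_trm M e' (ren_trm \<rho> u) = eval_trm M e u) us (rel_sorts L r)"
    by (auto simp: eval_ren_trm elim!: list_all2_mono)
  then have "map (eval_trm M e' \<circ> ren_trm \<rho>) us = map (eval_trm M e) us"
    by (auto simp: list_all2_conv_all_nth in_set_conv_nth)
  then show ?case by (simp only: ren_fm.simps sat.simps map_map)
next
  case (Neg \<phi>)
  then show ?case using Neg.IH[of \<Gamma> e' \<rho> e] by simp
next
  case (Conj \<phi> \<psi>)
  then show ?case using Conj.IH(1)[of \<Gamma> e' \<rho> e] Conj.IH(2)[of \<Gamma> e' \<rho> e] by simp
next
  case (Exists s \<phi>)
  have "sat M (a # e') (ren_fm (case_nat 0 (\<lambda>k. Suc (\<rho> k))) \<phi>) \<longleftrightarrow> sat M (a # e) \<phi>" for a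
    by (rule Exists.IH[of "s # \<Gamma>"]) (use Exists.prems in \<open>auto split: nat.split simp: less_Suc_eq_0_disj\<close>)
  then show ?case by simp
qed

text \<open>The head of the list is quantified innermost. The bound tuple then stands in front of
  the environment in its own order, as \<open>y @ e\<close>.\<close>

fun exs :: "'s list \<Rightarrow> ('f, 'r, 's) fm \<Rightarrow> ('f, 'r, 's) fm" where
  "exs [] \<phi> = \<phi>"
| "exs (s # ss) \<phi> = exs ss (Exists s \<phi>)"

lemma tuples_Nil [simp]: "x \<in> tuples M [] \<longleftrightarrow> x = []"
  by (simp add: tuples_def)

lemma tuples_Cons: "x \<in> tuples M (s # ss) \<longleftrightarrow> (\<exists>a y. x = a # y \<and> a \<in> carr M s \<and> y \<in> tuples M ss)"
  by (auto simp: tuples_def list_all2_Cons2)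

lemma tuples_length: "x \<in> tuples M ss \<Longrightarrow> length x = length ss"
  by (auto simp: tuples_def dest: list_all2_lengthD)

lemma tuples_append: "x \<in> tuples M (ss @ ts) \<longleftrightarrow> (\<exists>a b. x = a @ b \<and> a \<in> tuples M ss \<and> b \<in> tuples M ts)"
  by (auto simp: tuples_def list_all2_append2 intro: list_all2_appendI dest: list_all2_lengthD)

lemma tuples_appendI: "x \<in> tuples M ss \<Longrightarrow> y \<in> tuples M ts \<Longrightarrow> x @ y \<in> tuples M (ss @ ts)"
  by (auto simp: tuples_append)

lemma tuples_append_iff:
  "x \<in> tuples M ss \<or> y \<in> tuples M ts \<Longrightarrow> x @ y \<in> tuples M (ss @ ts) \<longleftrightarrow> x \<in> tuples M ss \<and> y \<in> tuples M ts"
  unfolding tuples_append using tuples_length by (metis append_eq_append_conv)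

lemma wf_exs: "wf_fm L (ss @ \<Gamma>) \<phi> \<Longrightarrow> wf_fm L \<Gamma> (exs ss \<phi>)"
  by (induction ss arbitrary: \<phi>) auto

lemma sat_exs: "sat M e (exs ss \<phi>) \<longleftrightarrow> (\<exists>y\<in>tuples M ss. sat M (y @ e) \<phi>)"
proof (induction ss arbitrary: \<phi>)
  case (Cons s ss)
  show ?case unfolding exs.simps Cons.IH by (simp add: Bex_def tuples_Cons) (metis append_Cons)
qed simp

text \<open>Coordinate projections, with reordering and repetition allowed. They serve as terms, as
  permutations of factors and as projections to main or auxiliary coordinates.\<close>

definition sel :: "nat list \<Rightarrow> 'a list \<Rightarrow> 'a list" where
  "sel is x = map ((!) x) is"

lemma sel_simps [simp]: "sel [] x = []" "sel (i # is) x = x ! i # sel is x" "length (sel is x) = length is"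
  by (auto simp: sel_def)

lemma sel_append: "sel (is @ js) x = sel is x @ sel js x"
  by (simp add: sel_def)

lemma sel_prefix: "set is \<subseteq> {..<length x} \<Longrightarrow> sel is (x @ y) = sel is x"
  by (auto simp: sel_def nth_append)

lemma sel_upt: "length x = n \<Longrightarrow> sel [0..<n] (x @ y) = x"
  by (auto simp: sel_def nth_append intro: nth_equalityI)

lemma sel_id: "length x = n \<Longrightarrow> sel [0..<n] x = x"
  using sel_upt[of x n "[]"] by simp

lemma sel_shift: "length x = n \<Longrightarrow> sel (map ((+) n) is) (x @ y) = sel is y"
  by (auto simp: sel_def)

lemma sel_sel: "set is \<subseteq> {..<length js} \<Longrightarrow> sel is (sel js x) = sel (sel is js) x"
  by (auto simp: sel_def)

lemma sel_tuples: "x \<in> tuples M ss \<Longrightarrow> set is \<subseteq> {..<length ss} \<Longrightarrow> sel is x \<in> tuples M (sel is ss)"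
  by (auto simp: tuples_def sel_def list_all2_conv_all_nth subset_iff)

text \<open>A valuation assigns to the \<open>i\<close>-th block of variables, of sorts \<open>\<Sigma> ! i\<close>, the tuple
  \<open>v i\<close>.\<close>

definition val :: "('s, 'f, 'r, 'u) struct \<Rightarrow> 's list list \<Rightarrow> (nat \<Rightarrow> 'u list) \<Rightarrow> bool" where
  "val M \<Sigma> v \<longleftrightarrow> (\<forall>i<length \<Sigma>. v i \<in> tuples M (\<Sigma> ! i))"

definition env :: "'b list \<Rightarrow> (nat \<Rightarrow> 'u list) \<Rightarrow> 'u list" where
  "env \<Sigma> v = concat (map v [0..<length \<Sigma>])"

lemma env_Nil [simp]: "env [] v = []" by (simp add: env_def)

lemma env_Cons [simp]: "env (ss # \<Sigma>) v = v 0 @ env \<Sigma> (\<lambda>n. v (Suc n))"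
  by (simp add: env_def map_upt_Suc del: upt_Suc)

lemma val_Nil [simp]: "val M [] v" by (simp add: val_def)

lemma val_Cons [simp]: "val M (ss # \<Sigma>) v \<longleftrightarrow> v 0 \<in> tuples M ss \<and> val M \<Sigma> (\<lambda>n. v (Suc n))"
  by (auto simp: val_def less_Suc_eq_0_disj)

lemma env_tuples: "val M \<Sigma> v \<Longrightarrow> env \<Sigma> v \<in> tuples M (concat \<Sigma>)"
  by (induction \<Sigma> arbitrary: v) (auto intro: tuples_appendI)

lemma env_length: "val M \<Sigma> v \<Longrightarrow> length (env \<Sigma> v) = length (concat \<Sigma>)"
  using env_tuples tuples_length by blast

lemma env_surj: "x \<in> tuples M (concat \<Sigma>) \<Longrightarrow> \<exists>v. val M \<Sigma> v \<and> x = env \<Sigma> v"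
proof (induction \<Sigma> arbitrary: x)
  case (Cons ss \<Sigma>)
  then obtain a b where ab: "x = a @ b" "a \<in> tuples M ss" "b \<in> tuples M (concat \<Sigma>)"
    by (auto simp: tuples_append)
  then obtain v where "val M \<Sigma> v" "b = env \<Sigma> v" using Cons.IH by blast
  with ab show ?case by (intro exI[of _ "case_nat a v"]) auto
qed auto

section \<open>Closure rules for definable predicates\<close>

locale def_ctx =
  fixes L :: "('s, 'f, 'r) lang" and M :: "('s, 'f, 'r, 'u) struct" and A :: "('s \<times> 'u) set"
  assumes params: "A \<subseteq> elems M"
begin

definition par :: "'s list \<Rightarrow> 'u list \<Rightarrow> bool" where
  "par cs c \<longleftrightarrow> list_all2 (\<lambda>s a. (s, a) \<in> A) cs c"

lemma par_length: "par cs c \<Longrightarrow> length c = length cs"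
  by (auto simp: par_def dest: list_all2_lengthD)

lemma par_append: "par cs c \<Longrightarrow> par cs' c' \<Longrightarrow> par (cs @ cs') (c @ c')"
  by (auto simp: par_def intro: list_all2_appendI)

lemma par_Nil [simp]: "par [] []" by (simp add: par_def)

lemma par_tuples: "par cs c \<Longrightarrow> c \<in> tuples M cs"
  using params by (auto simp: par_def tuples_def elems_def list_all2_conv_all_nth)

text \<open>Definability is a property of a HOL predicate on valuations, so that it can be proved by
  following the syntax of the predicate, without writing a formula. The parameters stand behind all
  blocks of the environment, and only well-sorted valuations count.\<close>

definition defb :: "'s list list \<Rightarrow> ((nat \<Rightarrow> 'u list) \<Rightarrow> bool) \<Rightarrow> bool" where
  "defb \<Sigma> P \<longleftrightarrow> (\<exists>cs c \<phi>. par cs c \<and> wf_fm L (concat \<Sigma> @ cs) \<phi> \<and>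
     (\<forall>v. val M \<Sigma> v \<longrightarrow> (P v \<longleftrightarrow> sat M (env \<Sigma> v @ c) \<phi>)))"

lemma defbE:
  assumes "defb \<Sigma> P"
  obtains cs c \<phi> where "par cs c" "wf_fm L (concat \<Sigma> @ cs) \<phi>"
    "\<And>v. val M \<Sigma> v \<Longrightarrow> P v \<longleftrightarrow> sat M (env \<Sigma> v @ c) \<phi>"
  using assms unfolding defb_def by blast

text \<open>Terms are lists of coordinates taken from the variables and the parameters. Function
  symbols occur only inside the formulas that define sets.\<close>

definition dterm :: "'s list list \<Rightarrow> ((nat \<Rightarrow> 'u list) \<Rightarrow> 'u list) \<Rightarrow> 's list \<Rightarrow> bool" where
  "dterm \<Sigma> \<tau> ss \<longleftrightarrow> (\<exists>cs c is. par cs c \<and> set is \<subseteq> {..<length (concat \<Sigma> @ cs)} \<and>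
     ss = sel is (concat \<Sigma> @ cs) \<and> (\<forall>v. val M \<Sigma> v \<longrightarrow> \<tau> v = sel is (env \<Sigma> v @ c)))"

lemma defb_cong: "(\<And>v. val M \<Sigma> v \<Longrightarrow> P v \<longleftrightarrow> Q v) \<Longrightarrow> defb \<Sigma> P \<longleftrightarrow> defb \<Sigma> Q"
  by (simp add: defb_def)

lemma dterm_tuples: "dterm \<Sigma> \<tau> ss \<Longrightarrow> val M \<Sigma> v \<Longrightarrow> \<tau> v \<in> tuples M ss"
  unfolding dterm_def by (metis env_tuples par_tuples sel_tuples tuples_appendI)

text \<open>Two formulas with different parameters can be joined only after both read one common
  parameter list; indices behind the blocks are shifted past the inserted
  \<open>cs1\<close>.\<close>

lemma wf_weaken:
  assumes "wf_fm L (\<Gamma> @ cs) \<phi>"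
  shows "\<exists>\<phi>'. wf_fm L (\<Gamma> @ cs1 @ cs @ cs2) \<phi>' \<and> (\<forall>e c c1 c2. length e = length \<Gamma> \<longrightarrow>
    length c = length cs \<longrightarrow> length c1 = length cs1 \<longrightarrow> (sat M (e @ c1 @ c @ c2) \<phi>' \<longleftrightarrow> sat M (e @ c) \<phi>))"
proof -
  define \<rho> where "\<rho> i = (if i < length \<Gamma> then i else i + length cs1)" for i
  have "wf_fm L (\<Gamma> @ cs1 @ cs @ cs2) (ren_fm \<rho> \<phi>)"
    by (rule wf_ren_fm[OF assms]) (auto simp: \<rho>_def nth_append)
  moreover have "sat M (e @ c1 @ c @ c2) (ren_fm \<rho> \<phi>) \<longleftrightarrow> sat M (e @ c) \<phi>"
    if "length e = length \<Gamma>" "length c = length cs" "length c1 = length cs1" for e c c1 c2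
    by (rule sat_ren_fm[OF assms]) (use that in \<open>auto simp: \<rho>_def nth_append\<close>)
  ultimately show ?thesis by blast
qed

lemma defb_not: "defb \<Sigma> P \<Longrightarrow> defb \<Sigma> (\<lambda>v. \<not> P v)"
  unfolding defb_def
  by (elim exE, rename_tac cs c \<phi>, rule_tac x = cs in exI, rule_tac x = c in exI, rule_tac x = "Neg \<phi>" in exI) simp

lemma defb_conj:
  assumes "defb \<Sigma> P" "defb \<Sigma> Q"
  shows "defb \<Sigma> (\<lambda>v. P v \<and> Q v)"
proof -
  obtain cs c \<phi> where 1: "par cs c" "wf_fm L (concat \<Sigma> @ cs) \<phi>"
    "\<And>v. val M \<Sigma> v \<Longrightarrow> P v \<longleftrightarrow> sat M (env \<Sigma> v @ c) \<phi>"
    using assms(1) by (rule defbE) blast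
  obtain ds d \<psi> where 2: "par ds d" "wf_fm L (concat \<Sigma> @ ds) \<psi>"
    "\<And>v. val M \<Sigma> v \<Longrightarrow> Q v \<longleftrightarrow> sat M (env \<Sigma> v @ d) \<psi>"
    using assms(2) by (rule defbE) blast
  note l = par_length[OF 1(1)] par_length[OF 2(1)] env_length[where M = M and \<Sigma> = \<Sigma>]
  obtain \<phi>' where \<phi>': "wf_fm L (concat \<Sigma> @ [] @ cs @ ds) \<phi>'"
    "\<And>v. val M \<Sigma> v \<Longrightarrow> P v \<longleftrightarrow> sat M (env \<Sigma> v @ [] @ c @ d) \<phi>'"
  proof -
    obtain \<phi>' where p: "wf_fm L (concat \<Sigma> @ [] @ cs @ ds) \<phi>'"
      "\<forall>e c c1 c2. length e = length (concat \<Sigma>) \<longrightarrow> length c = length cs \<longrightarrow> length c1 = length ([] :: 's list) \<longrightarrow>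
        sat M (e @ c1 @ c @ c2) \<phi>' = sat M (e @ c) \<phi>"
      using wf_weaken[OF 1(2), of "[]" ds] by blast
    show ?thesis by (rule that[OF p(1)]) (use 1(3) p(2) l in simp)
  qed
  obtain \<psi>' where \<psi>': "wf_fm L (concat \<Sigma> @ cs @ ds @ []) \<psi>'"
    "\<And>v. val M \<Sigma> v \<Longrightarrow> Q v \<longleftrightarrow> sat M (env \<Sigma> v @ c @ d @ []) \<psi>'"
  proof -
    obtain \<psi>' where p: "wf_fm L (concat \<Sigma> @ cs @ ds @ []) \<psi>'"
      "\<forall>e c c1 c2. length e = length (concat \<Sigma>) \<longrightarrow> length c = length ds \<longrightarrow> length c1 = length cs \<longrightarrow>
        sat M (e @ c1 @ c @ c2) \<psi>' = sat M (e @ c) \<psi>"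
      using wf_weaken[OF 2(2), of cs "[]"] by blast
    show ?thesis by (rule that[OF p(1)]) (use 2(3) p(2)[rule_format, of _ d c "[]"] l in simp)
  qed
  have "wf_fm L (concat \<Sigma> @ cs @ ds) (Conj \<phi>' \<psi>')" using \<phi>'(1) \<psi>'(1) by simp
  moreover have "P v \<and> Q v \<longleftrightarrow> sat M (env \<Sigma> v @ c @ d) (Conj \<phi>' \<psi>')" if "val M \<Sigma> v" for v
    using \<phi>'(2)[OF that] \<psi>'(2)[OF that] by simp
  ultimately show ?thesis unfolding defb_def using par_append[OF 1(1) 2(1)] by blast
qed

lemma defb_disj:
  assumes "defb \<Sigma> P" "defb \<Sigma> Q"
  shows "defb \<Sigma> (\<lambda>v. P v \<or> Q v)"
proof -
  have "defb \<Sigma> (\<lambda>v. \<not> (\<not> P v \<and> \<not> Q v))" by (intro defb_not defb_conj assms)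
  then show ?thesis by simp
qed

lemma defb_imp:
  assumes "defb \<Sigma> P" "defb \<Sigma> Q"
  shows "defb \<Sigma> (\<lambda>v. P v \<longrightarrow> Q v)"
proof -
  have "defb \<Sigma> (\<lambda>v. \<not> P v \<or> Q v)" by (intro defb_not defb_disj assms)
  then show ?thesis by (simp only: imp_conv_disj)
qed

lemma defb_iff:
  assumes "defb \<Sigma> P" "defb \<Sigma> Q"
  shows "defb \<Sigma> (\<lambda>v. P v \<longleftrightarrow> Q v)"
proof -
  have "defb \<Sigma> (\<lambda>v. (P v \<longrightarrow> Q v) \<and> (Q v \<longrightarrow> P v))" by (intro defb_conj defb_imp assms)
  then show ?thesis by (simp only: iff_conv_conj_imp)
qed

text \<open>The bound tuple becomes block 0 and all other blocks move up by one, which explains the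
  form \<open>\<lambda>n. v (Suc n)\<close> in every quantifier rule.\<close>

lemma defb_bex:
  assumes "defb (us # \<Sigma>) (\<lambda>v. P (\<lambda>n. v (Suc n)) (v 0))"
  shows "defb \<Sigma> (\<lambda>v. \<exists>y\<in>tuples M us. P v y)"
proof -
  obtain cs c \<phi> where 1: "par cs c" "wf_fm L (concat (us # \<Sigma>) @ cs) \<phi>"
    "\<And>v. val M (us # \<Sigma>) v \<Longrightarrow> P (\<lambda>n. v (Suc n)) (v 0) \<longleftrightarrow> sat M (env (us # \<Sigma>) v @ c) \<phi>"
    by (rule defbE[OF assms]) (rule that)
  have "P v y \<longleftrightarrow> sat M (y @ env \<Sigma> v @ c) \<phi>" if "val M \<Sigma> v" "y \<in> tuples M us" for v y
    using 1(3)[of "case_nat y v"] that by simp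
  then show ?thesis unfolding defb_def
    by (intro exI[of _ cs] exI[of _ c] exI[of _ "exs us \<phi>"]) (use 1 in \<open>auto simp: sat_exs intro!: wf_exs\<close>)
qed

lemma defb_ball:
  assumes "defb (us # \<Sigma>) (\<lambda>v. P (\<lambda>n. v (Suc n)) (v 0))"
  shows "defb \<Sigma> (\<lambda>v. \<forall>y\<in>tuples M us. P v y)"
proof -
  have "defb \<Sigma> (\<lambda>v. \<not> (\<exists>y\<in>tuples M us. \<not> P v y))"
    by (intro defb_not defb_bex[where P = "\<lambda>v y. \<not> P v y"] assms)
  then show ?thesis by simp
qed

lemma dterm_var: "i < length \<Sigma> \<Longrightarrow> dterm \<Sigma> (\<lambda>v. v i) (\<Sigma> ! i)"
proof -
  have *: "\<exists>is. set is \<subseteq> {..<length (concat \<Sigma>)} \<and> \<Sigma> ! i = sel is (concat \<Sigma>) \<and>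
    (\<forall>v. val M \<Sigma> v \<longrightarrow> v i = sel is (env \<Sigma> v))" if "i < length \<Sigma>"
    using that
  proof (induction \<Sigma> arbitrary: i)
    case (Cons ss \<Sigma>)
    show ?case
    proof (cases i)
      case 0
      then show ?thesis
        by (intro exI[of _ "[0..<length ss]"]) (auto simp: sel_upt tuples_length)
    next
      case (Suc j)
      then obtain "is" where i: "set is \<subseteq> {..<length (concat \<Sigma>)}" "\<Sigma> ! j = sel is (concat \<Sigma>)"
        "\<And>v. val M \<Sigma> v \<Longrightarrow> v j = sel is (env \<Sigma> v)" using Cons.IH[of j] Cons.prems by auto
      have "v i = sel (map ((+) (length ss)) is) (env (ss # \<Sigma>) v)" if "val M (ss # \<Sigma>) v" for v
        using that i(3)[of "\<lambda>n. v (Suc n)"] Suc sel_shift[of "v 0" "length ss" "is"] tuples_length[of "v 0" M ss]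
        by simp
      then show ?thesis using Suc i
        by (intro exI[of _ "map ((+) (length ss)) is"]) (auto simp: sel_shift)
    qed
  qed simp
  assume "i < length \<Sigma>"
  from *[OF this] show ?thesis unfolding dterm_def
    by (rule_tac exI[of _ "[]"], rule_tac exI[of _ "[]"]) auto
qed

lemma dterm_const: "par cs a \<Longrightarrow> dterm \<Sigma> (\<lambda>v. a) cs"
proof -
  assume a: "par cs a"
  show ?thesis unfolding dterm_def
    by (rule exI[of _ cs], rule exI[of _ a], rule exI[of _ "map ((+) (length (concat \<Sigma>))) [0..<length cs]"])
      (use a par_length[OF a] in \<open>auto simp: sel_shift sel_id env_length\<close>)
qed

lemma dterm_Nil: "dterm \<Sigma> (\<lambda>v. []) []"
  using dterm_const[of "[]" "[]"] by simp

lemma dterm_append: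
  assumes "dterm \<Sigma> \<tau> ss" "dterm \<Sigma> \<tau>' ss'"
  shows "dterm \<Sigma> (\<lambda>v. \<tau> v @ \<tau>' v) (ss @ ss')"
proof -
  obtain cs c "is" where 1: "par cs c" "set is \<subseteq> {..<length (concat \<Sigma> @ cs)}"
     "ss = sel is (concat \<Sigma> @ cs)" "\<And>v. val M \<Sigma> v \<Longrightarrow> \<tau> v = sel is (env \<Sigma> v @ c)"
    using assms(1) unfolding dterm_def by blast
  obtain ds d js where 2: "par ds d" "set js \<subseteq> {..<length (concat \<Sigma> @ ds)}"
     "ss' = sel js (concat \<Sigma> @ ds)" "\<And>v. val M \<Sigma> v \<Longrightarrow> \<tau>' v = sel js (env \<Sigma> v @ d)"
    using assms(2) unfolding dterm_def by blast
  define js' where "js' = map (\<lambda>i. if i < length (concat \<Sigma>) then i else i + length cs) js"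
  have a': "\<tau> v = sel is (env \<Sigma> v @ c @ d)" if "val M \<Sigma> v" for v
    using sel_prefix[of "is" "env \<Sigma> v @ c" d] 1(2,4) that par_length[OF 1(1)] env_length[OF that] by simp
  have b': "\<tau>' v = sel js' (env \<Sigma> v @ c @ d)" if "val M \<Sigma> v" for v
    using 2(4)[OF that] par_length[OF 1(1)] env_length[OF that]
    by (auto simp: sel_def nth_append js'_def)
  have "ss = sel is (concat \<Sigma> @ cs @ ds)" "ss' = sel js' (concat \<Sigma> @ cs @ ds)"
    using sel_prefix[of "is" "concat \<Sigma> @ cs" ds] 1(2,3) 2(3) by (auto simp: sel_def nth_append js'_def)
  moreover have "set (is @ js') \<subseteq> {..<length (concat \<Sigma> @ cs @ ds)}"
    using 1(2) 2(2) by (auto simp: js'_def)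
  ultimately show ?thesis unfolding dterm_def
    by (intro exI[of _ "cs @ ds"] exI[of _ "c @ d"] exI[of _ "is @ js'"] conjI par_append 1(1) 2(1))
      (auto simp: sel_append a' b')
qed

lemma dterm_sel:
  assumes "dterm \<Sigma> \<tau> ss" "set is \<subseteq> {..<length ss}"
  shows "dterm \<Sigma> (\<lambda>v. sel is (\<tau> v)) (sel is ss)"
proof -
  obtain cs c js where 1: "par cs c" "set js \<subseteq> {..<length (concat \<Sigma> @ cs)}"
     "ss = sel js (concat \<Sigma> @ cs)" "\<And>v. val M \<Sigma> v \<Longrightarrow> \<tau> v = sel js (env \<Sigma> v @ c)"
    using assms(1) unfolding dterm_def by blast
  have s: "set is \<subseteq> {..<length js}" using assms(2) 1(3) by simp
  then have "set (sel is js) \<subseteq> set js" by (auto simp: sel_def)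
  moreover have "sel is (\<tau> v) = sel (sel is js) (env \<Sigma> v @ c)" if "val M \<Sigma> v" for v
    using 1(4)[OF that] sel_sel[OF s] by simp
  moreover have "sel is ss = sel (sel is js) (concat \<Sigma> @ cs)"
    using 1(3) sel_sel[OF s] by simp
  ultimately show ?thesis unfolding dterm_def
    by (intro exI[of _ cs] exI[of _ c] exI[of _ "sel is js"]) (use 1(1,2) in auto)
qed

text \<open>Substitution into the formula that defines \<open>R\<close>: each of its variables is
  renamed to the coordinate selected by the term, and its parameters are put behind those of the
  term.\<close>

lemma defb_mem:
  assumes "definable L M A ss R" "dterm \<Sigma> \<tau> ss"
  shows "defb \<Sigma> (\<lambda>v. \<tau> v \<in> R)"
proof -
  obtain \<phi> ps where R: "set ps \<subseteq> A" "wf_fm L (ss @ map fst ps) \<phi>"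
    "R = {xs \<in> tuples M ss. sat M (xs @ map snd ps) \<phi>}"
    using assms(1) unfolding definable_def by blast
  obtain cs c "is" where 1: "par cs c" "set is \<subseteq> {..<length (concat \<Sigma> @ cs)}"
     "ss = sel is (concat \<Sigma> @ cs)" "\<And>v. val M \<Sigma> v \<Longrightarrow> \<tau> v = sel is (env \<Sigma> v @ c)"
    using assms(2) unfolding dterm_def by blast
  define \<rho> where "\<rho> i = (if i < length is then is ! i else i - length is + length (concat \<Sigma> @ cs))" for i
  have l: "length ss = length is" using 1(3) by simp
  have lt: "is ! i < length (concat \<Sigma> @ cs)" if "i < length is" for i
    using 1(2) nth_mem[OF that] by blast
  have "wf_fm L ((concat \<Sigma> @ cs) @ map fst ps) (ren_fm \<rho> \<phi>)"
  proof (rule wf_ren_fm[OF R(2)])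
    fix i assume i: "i < length (ss @ map fst ps)"
    show "\<rho> i < length ((concat \<Sigma> @ cs) @ map fst ps) \<and>
      ((concat \<Sigma> @ cs) @ map fst ps) ! \<rho> i = (ss @ map fst ps) ! i"
    proof (cases "i < length is")
      case True
      then have r: "\<rho> i < length (concat \<Sigma> @ cs)" using lt by (simp add: \<rho>_def)
      have "ss ! i = (concat \<Sigma> @ cs) ! \<rho> i" using 1(3) True by (simp add: \<rho>_def sel_def)
      with r show ?thesis using True l by (auto simp: nth_append_left simp del: append_assoc)
    next
      case False
      then have "\<rho> i = length (concat \<Sigma> @ cs) + (i - length is)" by (simp add: \<rho>_def)
      then show ?thesis using False l i
        by (simp only: nth_append_length_plus) (simp add: nth_append)
    qed
  qed
  moreover have "sat M ((env \<Sigma> v @ c) @ map snd ps) (ren_fm \<rho> \<phi>) \<longleftrightarrow> sat M (\<tau> v @ map snd ps) \<phi>"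
    if "val M \<Sigma> v" for v
  proof (rule sat_ren_fm[OF R(2)])
    have l': "length (env \<Sigma> v @ c) = length (concat \<Sigma> @ cs)"
      using env_length[OF that] par_length[OF 1(1)] by simp
    fix i assume i: "i < length (ss @ map fst ps)"
    show "((env \<Sigma> v @ c) @ map snd ps) ! \<rho> i = (\<tau> v @ map snd ps) ! i"
    proof (cases "i < length is")
      case True
      then have "\<rho> i < length (env \<Sigma> v @ c)" using lt l' by (simp add: \<rho>_def)
      then have "((env \<Sigma> v @ c) @ map snd ps) ! \<rho> i = (env \<Sigma> v @ c) ! \<rho> i" by (rule nth_append_left)
      then show ?thesis using True 1(4)[OF that] by (simp add: nth_append_left \<rho>_def sel_def)
    next
      case False
      then have "\<rho> i = length (env \<Sigma> v @ c) + (i - length is)" using l' by (simp add: \<rho>_def)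
      then show ?thesis using False 1(4)[OF that] by (simp only: nth_append_length_plus) (simp add: nth_append)
    qed
  qed
  moreover have "par (map fst ps) (map snd ps)"
    using R(1) by (auto simp: par_def list_all2_conv_all_nth dest: nth_mem)
  ultimately show ?thesis using 1(1) dterm_tuples[OF assms(2)]
    unfolding defb_def R(3)
    by (intro exI[of _ "cs @ map fst ps"] exI[of _ "c @ map snd ps"] exI[of _ "ren_fm \<rho> \<phi>"])
      (auto intro: par_append)
qed

text \<open>In the empty context there may be no well-formed term, so truth is expressed with a
  bound variable. The sentence holds even over an empty main sort.\<close>

definition tt :: "('f, 'r, 's) fm" where
  "tt = Neg (Exists (main L) (Neg (Eq (Var 0) (Var 0))))"

lemma tt [simp]: "wf_fm L \<Gamma> tt" "sat M e tt"
  by (auto simp: tt_def intro!: exI[of _ "main L"] wf_trm.Var[of 0 "main L # \<Gamma>" L, simplified])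

lemma defb_const: "defb \<Sigma> (\<lambda>v. b)"
proof -
  have t: "defb \<Sigma> (\<lambda>v. True)" unfolding defb_def
    by (rule exI[of _ "[]"], rule exI[of _ "[]"], rule exI[of _ tt]) simp
  show ?thesis using t defb_not[OF t] by (cases b) auto
qed

fun eqs :: "nat list \<Rightarrow> nat list \<Rightarrow> ('f, 'r, 's) fm" where
  "eqs (i # is) (j # js) = Conj (Eq (Var i) (Var j)) (eqs is js)"
| "eqs _ _ = tt"

lemma eqs:
  assumes "length is = length js"
  shows "sat M e (eqs is js) \<longleftrightarrow> sel is e = sel js e"
    and "set is \<subseteq> {..<length \<Gamma>} \<Longrightarrow> set js \<subseteq> {..<length \<Gamma>} \<Longrightarrow> sel is \<Gamma> = sel js \<Gamma> \<Longrightarrow> wf_fm L \<Gamma> (eqs is js)"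
  using assms
proof (induction "is" js rule: list_induct2)
  case (Cons i "is" j js)
  {
    case 1
    show ?case using Cons by simp
  next
    case 2
    then show ?case using Cons wf_trm.Var[of i \<Gamma> L] wf_trm.Var[of j \<Gamma> L] by auto
  }
qed auto

lemma defb_eq:
  assumes "dterm \<Sigma> \<tau> ss" "dterm \<Sigma> \<tau>' ss"
  shows "defb \<Sigma> (\<lambda>v. \<tau> v = \<tau>' v)"
proof -
  define n where "n = length ss"
  \<comment> \<open>Appending the two terms brings them over one common parameter list; cutting the
    index list at \<open>n\<close> separates them again.\<close>
  obtain cs c "is" where 1: "par cs c" "set is \<subseteq> {..<length (concat \<Sigma> @ cs)}"
     "ss @ ss = sel is (concat \<Sigma> @ cs)" "\<And>v. val M \<Sigma> v \<Longrightarrow> \<tau> v @ \<tau>' v = sel is (env \<Sigma> v @ c)"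
    using dterm_append[OF assms] unfolding dterm_def by blast
  define js ks where "js = take n is" and "ks = drop n is"
  have i: "is = js @ ks" by (simp add: js_def ks_def)
  have "length (ss @ ss) = length is" by (subst 1(3)) simp
  then have len: "length js = n" "length ks = n" by (auto simp: js_def ks_def n_def)
  have "ss = sel js (concat \<Sigma> @ cs)" "ss = sel ks (concat \<Sigma> @ cs)"
    using 1(3) len unfolding i sel_append by (auto simp: n_def)
  moreover have "\<tau> v = sel js (env \<Sigma> v @ c)" "\<tau>' v = sel ks (env \<Sigma> v @ c)" if "val M \<Sigma> v" for v
    using 1(4)[OF that] tuples_length[OF dterm_tuples[OF assms(1) that]] len unfolding i sel_append by (auto simp: n_def)
  ultimately show ?thesis unfolding defb_def
    by (intro exI[of _ cs] exI[of _ c] exI[of _ "eqs js ks"] conjI eqs(2) 1(1))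
      (use 1(2) len in \<open>auto simp: eqs(1) i\<close>)
qed

lemma definable_blocks:
  assumes "defb \<Sigma> P"
  shows "definable L M A (concat \<Sigma>) {env \<Sigma> v |v. val M \<Sigma> v \<and> P v}"
proof -
  obtain cs c \<phi> where 1: "par cs c" "wf_fm L (concat \<Sigma> @ cs) \<phi>"
    "\<And>v. val M \<Sigma> v \<Longrightarrow> P v \<longleftrightarrow> sat M (env \<Sigma> v @ c) \<phi>"
    using assms(1) by (rule defbE) blast
  have "map fst (zip cs c) = cs" "map snd (zip cs c) = c" "set (zip cs c) \<subseteq> A"
    using 1(1) by (auto simp: par_def list_all2_iff)
  moreover have "{env \<Sigma> v |v. val M \<Sigma> v \<and> P v} = {x \<in> tuples M (concat \<Sigma>). sat M (x @ c) \<phi>}"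
    using 1(3) env_tuples env_surj by fastforce
  ultimately show ?thesis using 1 unfolding definable_def
    by (intro exI[of _ \<phi>] exI[of _ "zip cs c"]) simp
qed

lemma definable_subset: "definable L M A ss X \<Longrightarrow> X \<subseteq> tuples M ss"
  by (auto simp: definable_def)

lemma definable1: "defb [ss] (\<lambda>v. P (v 0)) \<Longrightarrow> definable L M A ss {x \<in> tuples M ss. P x}"
  using definable_blocks[of "[ss]" "\<lambda>v. P (v 0)"]
  by (simp, elim back_subst[of "definable L M A ss"]) (auto intro: exI[of _ "\<lambda>n. x" for x])

text \<open>The separate premise \<open>ss' = ss\<close> lets resolution compute the sorts of the
  term first and leaves the comparison of sort lists to simplification.\<close>

lemma defb_mem_eq:
  "dterm \<Sigma> \<tau> ss' \<Longrightarrow> definable L M A ss R \<Longrightarrow> ss' = ss \<Longrightarrow> defb \<Sigma> (\<lambda>v. \<tau> v \<in> R)"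
  using defb_mem by blast

lemma defb_eq': "dterm \<Sigma> \<tau> ss \<Longrightarrow> dterm \<Sigma> \<tau>' ss' \<Longrightarrow> ss = ss' \<Longrightarrow> defb \<Sigma> (\<lambda>v. \<tau> v = \<tau>' v)"
  using defb_eq by blast

lemma definable_rel:
  assumes "r \<in> rels L" "is_structure L M"
  shows "definable L M A (rel_sorts L r) (rint M r)"
proof -
  let ?ss = "rel_sorts L r"
  have "map (eval_trm M x \<circ> Var) [0..<length ?ss] = x" if "x \<in> tuples M ?ss" for x
    using tuples_length[OF that] by (auto intro: nth_equalityI)
  moreover have "list_all2 (wf_trm L ?ss) (map Var [0..<length ?ss]) ?ss"
    by (auto simp: list_all2_conv_all_nth intro: wf_trm.Var)
  ultimately show ?thesis using assms
    unfolding definable_def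
    by (intro exI[of _ "Rel r (map Var [0..<length ?ss])"] exI[of _ "[]"])
      (auto simp: is_structure_def subset_iff)
qed

lemmas defb_rules = defb_not defb_conj defb_disj defb_imp defb_iff defb_bex defb_ball defb_mem_eq defb_eq' defb_const
  dterm_var dterm_append dterm_sel dterm_Nil

end

section \<open>Compactness\<close>

context ultrafilter
begin

lemma ev_or: "ev (\<lambda>i. P i \<or> Q i) \<longleftrightarrow> ev P \<or> ev Q"
  using ev_conj[of "\<lambda>i. \<not> P i" "\<lambda>i. \<not> Q i"] ev_not[of P] ev_not[of Q] ev_not[of "\<lambda>i. P i \<or> Q i"]
  by auto

text \<open>The counterpart of \<open>defb\<close> for transfer: a predicate over \<open>M\<close>
  is paired with one over the ultrapower. The rules have the same shape as those for definability,
  so transfer too follows the syntax of the statement.\<close>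

definition los :: "('s, 'f, 'r) lang \<Rightarrow> ('s, 'f, 'r, 'u) struct \<Rightarrow> 's list list \<Rightarrow>
    ((nat \<Rightarrow> 'u list) \<Rightarrow> bool) \<Rightarrow> ((nat \<Rightarrow> ('i \<Rightarrow> 'u) list) \<Rightarrow> bool) \<Rightarrow> bool" where
  "los L M \<Sigma> P Q \<longleftrightarrow> (\<forall>v. val (upow L M) \<Sigma> v \<longrightarrow> (Q v \<longleftrightarrow> ev (\<lambda>i. P (\<lambda>n. coord i (v n)))))"

definition lterm :: "('s, 'f, 'r) lang \<Rightarrow> ('s, 'f, 'r, 'u) struct \<Rightarrow> 's list list \<Rightarrow>
    ((nat \<Rightarrow> 'u list) \<Rightarrow> 'u list) \<Rightarrow> ((nat \<Rightarrow> ('i \<Rightarrow> 'u) list) \<Rightarrow> ('i \<Rightarrow> 'u) list) \<Rightarrow> 's list \<Rightarrow> bool" where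
  "lterm L M \<Sigma> \<tau> \<tau>' ss \<longleftrightarrow> (\<forall>v. val (upow L M) \<Sigma> v \<longrightarrow>
     \<tau>' v \<in> tuples (upow L M) ss \<and> ev (\<lambda>i. coord i (\<tau>' v) = \<tau> (\<lambda>n. coord i (v n))))"

definition trel :: "('s, 'f, 'r) lang \<Rightarrow> ('s, 'f, 'r, 'u) struct \<Rightarrow> 's list \<Rightarrow>
    'u list set \<Rightarrow> ('i \<Rightarrow> 'u) list set \<Rightarrow> bool" where
  "trel L M ss R R' \<longleftrightarrow> (\<forall>x\<in>tuples (upow L M) ss. x \<in> R' \<longleftrightarrow> ev (\<lambda>i. coord i x \<in> R))"

lemma los_not: "los L M \<Sigma> P Q \<Longrightarrow> los L M \<Sigma> (\<lambda>v. \<not> P v) (\<lambda>v. \<not> Q v)"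
  by (simp add: los_def ev_not)

lemma los_conj: "los L M \<Sigma> P Q \<Longrightarrow> los L M \<Sigma> P' Q' \<Longrightarrow> los L M \<Sigma> (\<lambda>v. P v \<and> P' v) (\<lambda>v. Q v \<and> Q' v)"
  by (simp add: los_def ev_conj)

lemma los_disj: "los L M \<Sigma> P Q \<Longrightarrow> los L M \<Sigma> P' Q' \<Longrightarrow> los L M \<Sigma> (\<lambda>v. P v \<or> P' v) (\<lambda>v. Q v \<or> Q' v)"
  by (simp add: los_def ev_or)

lemma los_imp:
  assumes "los L M \<Sigma> P Q" "los L M \<Sigma> P' Q'"
  shows "los L M \<Sigma> (\<lambda>v. P v \<longrightarrow> P' v) (\<lambda>v. Q v \<longrightarrow> Q' v)"
  unfolding imp_conv_disj by (intro los_not los_disj assms)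

lemma los_iff:
  assumes "los L M \<Sigma> P Q" "los L M \<Sigma> P' Q'"
  shows "los L M \<Sigma> (\<lambda>v. P v \<longleftrightarrow> P' v) (\<lambda>v. Q v \<longleftrightarrow> Q' v)"
  unfolding iff_conv_conj_imp by (intro los_conj los_imp assms)

lemma los_bex:
  assumes "los L M (us # \<Sigma>) (\<lambda>v. P (\<lambda>n. v (Suc n)) (v 0)) (\<lambda>v. Q (\<lambda>n. v (Suc n)) (v 0))"
  shows "los L M \<Sigma> (\<lambda>v. \<exists>y\<in>tuples M us. P v y) (\<lambda>v. \<exists>y\<in>tuples (upow L M) us. Q v y)"
  unfolding los_def
proof (intro allI impI)
  fix v assume v: "val (upow L M) \<Sigma> v"
  have *: "Q v y \<longleftrightarrow> ev (\<lambda>i. P (\<lambda>n. coord i (v n)) (coord i y))" if "y \<in> tuples (upow L M) us" for y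
    using assms[unfolded los_def, rule_format, of "case_nat y v"] that v by simp
  show "(\<exists>y\<in>tuples (upow L M) us. Q v y) \<longleftrightarrow> ev (\<lambda>i. \<exists>y\<in>tuples M us. P (\<lambda>n. coord i (v n)) y)"
  proof
    assume "\<exists>y\<in>tuples (upow L M) us. Q v y"
    then obtain y where y: "y \<in> tuples (upow L M) us" "Q v y" by blast
    then have "ev (\<lambda>i. coord i y \<in> tuples M us \<and> P (\<lambda>n. coord i (v n)) (coord i y))"
      using * upow_tuples by (simp add: ev_conj)
    then show "ev (\<lambda>i. \<exists>y\<in>tuples M us. P (\<lambda>n. coord i (v n)) y)" by (rule ev_mono) auto
  next
    assume e: "ev (\<lambda>i. \<exists>y\<in>tuples M us. P (\<lambda>n. coord i (v n)) y)"
    \<comment> \<open>As in Los's theorem, but with whole tuples; \<open>upow_lift\<close> replaces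
      the chosen family by one tuple.\<close>
    define x where "x i = (SOME y. y \<in> tuples M us \<and> P (\<lambda>n. coord i (v n)) y)" for i
    have x: "ev (\<lambda>i. x i \<in> tuples M us \<and> P (\<lambda>n. coord i (v n)) (x i))"
      using e by (rule ev_mono) (simp add: x_def, rule someI_ex, blast)
    then have "ev (\<lambda>i. x i \<in> tuples M us)" by (simp add: ev_conj)
    then obtain y where y: "y \<in> tuples (upow L M) us" "ev (\<lambda>i. coord i y = x i)"
      by (rule upow_lift)
    then have "ev (\<lambda>i. coord i y = x i \<and> x i \<in> tuples M us \<and> P (\<lambda>n. coord i (v n)) (x i))"
      using x by (simp add: ev_conj)
    then have "ev (\<lambda>i. P (\<lambda>n. coord i (v n)) (coord i y))" by (rule ev_mono) auto
    then show "\<exists>y\<in>tuples (upow L M) us. Q v y" using y(1) * by blast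
  qed
qed

lemma los_ball:
  assumes "los L M (us # \<Sigma>) (\<lambda>v. P (\<lambda>n. v (Suc n)) (v 0)) (\<lambda>v. Q (\<lambda>n. v (Suc n)) (v 0))"
  shows "los L M \<Sigma> (\<lambda>v. \<forall>y\<in>tuples M us. P v y) (\<lambda>v. \<forall>y\<in>tuples (upow L M) us. Q v y)"
proof -
  have "los L M \<Sigma> (\<lambda>v. \<not> (\<exists>y\<in>tuples M us. \<not> P v y)) (\<lambda>v. \<not> (\<exists>y\<in>tuples (upow L M) us. \<not> Q v y))"
    by (intro los_not los_bex[where P = "\<lambda>v y. \<not> P v y" and Q = "\<lambda>v y. \<not> Q v y"] assms)
  then show ?thesis by simp
qed

lemma lterm_var: "i < length \<Sigma> \<Longrightarrow> lterm L M \<Sigma> (\<lambda>v. v i) (\<lambda>v. v i) (\<Sigma> ! i)"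
  by (simp add: lterm_def val_def)

lemma lterm_append:
  assumes "lterm L M \<Sigma> \<tau> \<tau>' ss" "lterm L M \<Sigma> \<sigma> \<sigma>' ts"
  shows "lterm L M \<Sigma> (\<lambda>v. \<tau> v @ \<sigma> v) (\<lambda>v. \<tau>' v @ \<sigma>' v) (ss @ ts)"
  unfolding lterm_def
proof (intro allI impI conjI)
  fix v assume v: "val (upow L M) \<Sigma> v"
  then have "ev (\<lambda>i. coord i (\<tau>' v) = \<tau> (\<lambda>n. coord i (v n)) \<and> coord i (\<sigma>' v) = \<sigma> (\<lambda>n. coord i (v n)))"
    using assms by (simp add: lterm_def ev_conj)
  then show "ev (\<lambda>i. coord i (\<tau>' v @ \<sigma>' v) = \<tau> (\<lambda>n. coord i (v n)) @ \<sigma> (\<lambda>n. coord i (v n)))"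
    by (rule ev_mono) auto
qed (use assms in \<open>auto simp: lterm_def intro: tuples_appendI\<close>)

lemma los_mem:
  assumes "lterm L M \<Sigma> \<tau> \<tau>' ss'" "trel L M ss R R'" "ss' = ss"
  shows "los L M \<Sigma> (\<lambda>v. \<tau> v \<in> R) (\<lambda>v. \<tau>' v \<in> R')"
  unfolding los_def
proof (intro allI impI)
  fix v assume v: "val (upow L M) \<Sigma> v"
  have "\<tau>' v \<in> tuples (upow L M) ss" and e: "ev (\<lambda>i. coord i (\<tau>' v) = \<tau> (\<lambda>n. coord i (v n)))"
    using assms v by (auto simp: lterm_def)
  then have "\<tau>' v \<in> R' \<longleftrightarrow> ev (\<lambda>i. coord i (\<tau>' v) \<in> R)" using assms(2) by (simp add: trel_def)
  also have "\<dots> \<longleftrightarrow> ev (\<lambda>i. \<tau> (\<lambda>n. coord i (v n)) \<in> R)"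
    by (rule ev_cong, rule ev_mono[OF e]) auto
  finally show "\<tau>' v \<in> R' \<longleftrightarrow> \<dots>" .
qed

lemma los_eq:
  assumes "lterm L M \<Sigma> \<tau> \<tau>' ss" "lterm L M \<Sigma> \<sigma> \<sigma>' ss'" "ss' = ss"
  shows "los L M \<Sigma> (\<lambda>v. \<tau> v = \<sigma> v) (\<lambda>v. \<tau>' v = \<sigma>' v)"
  unfolding los_def
proof (intro allI impI)
  fix v assume v: "val (upow L M) \<Sigma> v"
  have "\<tau>' v \<in> tuples (upow L M) ss" "\<sigma>' v \<in> tuples (upow L M) ss"
    and e: "ev (\<lambda>i. coord i (\<tau>' v) = \<tau> (\<lambda>n. coord i (v n)) \<and> coord i (\<sigma>' v) = \<sigma> (\<lambda>n. coord i (v n)))"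
    using assms v by (auto simp: lterm_def ev_conj)
  then have "\<tau>' v = \<sigma>' v \<longleftrightarrow> ev (\<lambda>i. coord i (\<tau>' v) = coord i (\<sigma>' v))" by (simp add: upow_tuples_eq)
  also have "\<dots> \<longleftrightarrow> ev (\<lambda>i. \<tau> (\<lambda>n. coord i (v n)) = \<sigma> (\<lambda>n. coord i (v n)))"
    by (rule ev_cong, rule ev_mono[OF e]) auto
  finally show "\<tau>' v = \<sigma>' v \<longleftrightarrow> \<dots>" .
qed

lemmas los_rules = los_not los_conj los_disj los_imp los_iff los_bex los_ball los_mem los_eq lterm_var lterm_append

lemma trel_sat:
  assumes "is_structure L M" "wf_fm L (ss @ cs) \<phi>" "c \<in> tuples M cs"
  shows "trel L M ss {x \<in> tuples M ss. sat M (x @ c) \<phi>} {x \<in> tuples (upow L M) ss. sat (upow L M) (x @ diag c) \<phi>}"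
  unfolding trel_def
proof
  fix x assume x: "x \<in> tuples (upow L M) ss"
  have "sat (upow L M) (x @ diag c) \<phi> \<longleftrightarrow> ev (\<lambda>i. sat M (coord i (x @ diag c)) \<phi>)"
    by (rule Los[OF assms(1,2) tuples_appendI[OF x diag_in[OF assms(3)]]])
  also have "\<dots> \<longleftrightarrow> ev (\<lambda>i. coord i x \<in> tuples M ss \<and> sat M (coord i x @ c) \<phi>)"
  proof (rule ev_cong)
    have "ev (\<lambda>i. coord i (diag c) = c \<and> coord i x \<in> tuples M ss)"
      using upow_tuples[OF x] ev_diag by (simp add: ev_conj)
    then show "ev (\<lambda>i. sat M (coord i (x @ diag c)) \<phi> = (coord i x \<in> tuples M ss \<and> sat M (coord i x @ c) \<phi>))"
      by (rule ev_mono) auto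
  qed
  finally show "x \<in> {x \<in> tuples (upow L M) ss. sat (upow L M) (x @ diag c) \<phi>} \<longleftrightarrow>
    ev (\<lambda>i. coord i x \<in> {x \<in> tuples M ss. sat M (x @ c) \<phi>})" using x by simp
qed

definition diag_params :: "('s, 'f, 'r, 'u) struct \<Rightarrow> ('s \<times> ('i \<Rightarrow> 'u)) set" where
  "diag_params M = {(s, rep (\<lambda>i. a)) |s a. a \<in> carr M s}"

lemma diag_params_elems: "diag_params M \<subseteq> elems (upow L M)"
  by (auto simp: diag_params_def elems_def rep_const_in)

text \<open>The same formula, with every parameter replaced by its diagonal image, defines the
  required extension.\<close>

lemma definable_trel:
  assumes "is_structure L M" "definable L M (elems M) ss R"
  obtains R' where "definable L (upow L M) (diag_params M) ss R'" "trel L M ss R R'"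
proof -
  obtain \<phi> ps where R: "set ps \<subseteq> elems M" "wf_fm L (ss @ map fst ps) \<phi>"
    "R = {xs \<in> tuples M ss. sat M (xs @ map snd ps) \<phi>}"
    using assms(2) unfolding definable_def by blast
  have c: "map snd ps \<in> tuples M (map fst ps)"
    using R(1) by (auto simp: tuples_def elems_def list_all2_conv_all_nth dest!: nth_mem)
  let ?qs = "map (\<lambda>(s, a). (s, rep (\<lambda>i. a))) ps"
  have q: "map fst ?qs = map fst ps" "map snd ?qs = diag (map snd ps)" "set ?qs \<subseteq> diag_params M"
    using R(1) by (induction ps) (auto simp: diag_params_def elems_def)
  show ?thesis
  proof (rule that)
    show "trel L M ss R {x \<in> tuples (upow L M) ss. sat (upow L M) (x @ diag (map snd ps)) \<phi>}"
      unfolding R(3) by (rule trel_sat[OF assms(1) R(2) c])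
    show "definable L (upow L M) (diag_params M) ss {x \<in> tuples (upow L M) ss. sat (upow L M) (x @ diag (map snd ps)) \<phi>}"
      unfolding definable_def by (rule exI[of _ \<phi>], rule exI[of _ ?qs]) (use q R(2) in \<open>simp del: map_map\<close>)
  qed
qed

lemma trel_ball:
  "trel L M (rel_sorts L r) (rint M r) (rint (upow L M) r)"
  by (auto simp: trel_def upow_def tuples_def)

text \<open>A parameter that is an entry of \<open>p\<close> is read at its position in
  \<open>p\<close>; for a diagonal one, its preimage is appended to the list \<open>c\<close> of
  parameters from \<open>M\<close>. The map \<rho> records where each parameter went.\<close>

lemma params_split:
  assumes "set ps \<subseteq> set (zip \<Gamma> p) \<union> diag_params M" "length p = length \<Gamma>"
  shows "\<exists>cs c \<rho>. c \<in> tuples M cs \<and> (\<forall>k<length ps. \<rho> k < length (\<Gamma> @ cs) \<and>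
    (\<Gamma> @ cs) ! \<rho> k = fst (ps ! k) \<and> (p @ diag c) ! \<rho> k = snd (ps ! k))"
  using assms(1)
proof (induction ps rule: rev_induct)
  case Nil
  then show ?case by (intro exI[of _ "[]"]) simp
next
  case (snoc q ps)
  then obtain cs c \<rho> where IH: "c \<in> tuples M cs" "\<And>k. k < length ps \<Longrightarrow> \<rho> k < length (\<Gamma> @ cs) \<and>
    (\<Gamma> @ cs) ! \<rho> k = fst (ps ! k) \<and> (p @ diag c) ! \<rho> k = snd (ps ! k)" by auto
  have lc: "length c = length cs" using IH(1) by (rule tuples_length)
  from snoc.prems consider "q \<in> set (zip \<Gamma> p)" | "q \<in> diag_params M" by auto
  then show ?case
  proof cases
    case 1
    then obtain j where j: "j < length \<Gamma>" "q = (\<Gamma> ! j, p ! j)"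
      by (auto simp: in_set_zip)
    then have "(\<Gamma> @ cs) ! j = fst q" "(p @ diag c) ! j = snd q" using assms(2) by (auto simp: nth_append)
    then show ?thesis
      by (intro exI[of _ cs] exI[of _ c] exI[of _ "\<rho>(length ps := j)"] conjI allI impI)
        (use IH j(1) in \<open>auto simp: less_Suc_eq nth_append_left\<close>)
  next
    case 2
    then obtain s a where q: "q = (s, rep (\<lambda>i. a))" "a \<in> carr M s" by (auto simp: diag_params_def)
    have old: "(\<Gamma> @ (cs @ [s])) ! k = (\<Gamma> @ cs) ! k" "(p @ diag (c @ [a])) ! k = (p @ diag c) ! k"
      if "k < length (\<Gamma> @ cs)" for k
      using that assms(2) lc by (auto simp: nth_append)
    have new: "(\<Gamma> @ (cs @ [s])) ! (length \<Gamma> + length cs) = s"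
      "(p @ diag (c @ [a])) ! (length \<Gamma> + length cs) = rep (\<lambda>i. a)"
      using assms(2) lc by (auto simp: nth_append)
    show ?thesis
    proof (rule exI[of _ "cs @ [s]"], rule exI[of _ "c @ [a]"],
        rule exI[of _ "\<rho>(length ps := length \<Gamma> + length cs)"], intro conjI allI impI)
      show "c @ [a] \<in> tuples M (cs @ [s])" using IH(1) q(2) by (auto simp: tuples_append tuples_Cons)
      fix k assume k: "k < length (ps @ [q])"
      show "(\<rho>(length ps := length \<Gamma> + length cs)) k < length (\<Gamma> @ cs @ [s])"
        using IH(2)[of k] k by (auto simp: less_Suc_eq)
      show "(\<Gamma> @ cs @ [s]) ! (\<rho>(length ps := length \<Gamma> + length cs)) k = fst ((ps @ [q]) ! k)"
        using IH(2)[of k] k old(1) new(1) q by (cases "k = length ps") (auto simp: nth_append_left)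
      show "(p @ diag (c @ [a])) ! (\<rho>(length ps := length \<Gamma> + length cs)) k = snd ((ps @ [q]) ! k)"
        using IH(2)[of k] k old(2) new(2) q by (cases "k = length ps") (auto simp: nth_append_left)
    qed
  qed
qed

text \<open>A set definable over \<open>p\<close> and the diagonal becomes the fibre at
  \<open>p\<close> of a relation given by a formula with parameters from \<open>M\<close>. Such a
  formula can be read in \<open>M\<close> with other values in place of \<open>p\<close>.\<close>

lemma definable_params:
  assumes "definable L (upow L M) (set (zip \<Gamma> p) \<union> diag_params M) \<Delta> R" "p \<in> tuples (upow L M) \<Gamma>"
  shows "\<exists>cs c \<psi>. c \<in> tuples M cs \<and> wf_fm L (\<Delta> @ \<Gamma> @ cs) \<psi> \<and>
    R = {x \<in> tuples (upow L M) \<Delta>. sat (upow L M) (x @ p @ diag c) \<psi>}"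
proof -
  obtain \<phi> ps where R: "set ps \<subseteq> set (zip \<Gamma> p) \<union> diag_params M" "wf_fm L (\<Delta> @ map fst ps) \<phi>"
    "R = {xs \<in> tuples (upow L M) \<Delta>. sat (upow L M) (xs @ map snd ps) \<phi>}"
    using assms(1) unfolding definable_def by blast
  obtain cs c \<rho> where \<rho>: "c \<in> tuples M cs" "\<And>k. k < length ps \<Longrightarrow> \<rho> k < length (\<Gamma> @ cs) \<and>
    (\<Gamma> @ cs) ! \<rho> k = fst (ps ! k) \<and> (p @ diag c) ! \<rho> k = snd (ps ! k)"
    using params_split[OF R(1) tuples_length[OF assms(2)]] by auto
  define \<sigma> where "\<sigma> k = (if k < length \<Delta> then k else length \<Delta> + \<rho> (k - length \<Delta>))" for k
  have "wf_fm L (\<Delta> @ \<Gamma> @ cs) (ren_fm \<sigma> \<phi>)"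
  proof (rule wf_ren_fm[OF R(2)])
    fix k assume k: "k < length (\<Delta> @ map fst ps)"
    show "\<sigma> k < length (\<Delta> @ \<Gamma> @ cs) \<and> (\<Delta> @ \<Gamma> @ cs) ! \<sigma> k = (\<Delta> @ map fst ps) ! k"
    proof (cases "k < length \<Delta>")
      case False
      then show ?thesis using k \<rho>(2)[of "k - length \<Delta>"]
        by (simp add: \<sigma>_def nth_append_length_plus) (simp add: nth_append)
    qed (auto simp: \<sigma>_def nth_append)
  qed
  moreover have "sat (upow L M) (x @ p @ diag c) (ren_fm \<sigma> \<phi>) \<longleftrightarrow> sat (upow L M) (x @ map snd ps) \<phi>"
    if x: "x \<in> tuples (upow L M) \<Delta>" for x
  proof (rule sat_ren_fm[OF R(2)])
    fix k assume k: "k < length (\<Delta> @ map fst ps)"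
    have l: "length x = length \<Delta>" using x by (rule tuples_length)
    show "(x @ p @ diag c) ! \<sigma> k = (x @ map snd ps) ! k"
    proof (cases "k < length \<Delta>")
      case False
      then show ?thesis using k \<rho>(2)[of "k - length \<Delta>"] l nth_append_length_plus[of x "p @ diag c"]
        by (simp add: \<sigma>_def) (simp add: nth_append)
    qed (use l in \<open>auto simp: \<sigma>_def nth_append\<close>)
  qed
  ultimately show ?thesis using \<rho>(1) R(3)
    by (intro exI[of _ cs] exI[of _ c] exI[of _ "ren_fm \<sigma> \<phi>"]) auto
qed

end

section \<open>Definable relations on products, given by predicates\<close>

definition rel1 :: "('s, 'f, 'r, 'u) struct \<Rightarrow> 's list \<Rightarrow> ('u list \<Rightarrow> bool) \<Rightarrow> 'u list set" where
  "rel1 M ss P = {x \<in> tuples M ss. P x}"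

definition rel2 :: "('s, 'f, 'r, 'u) struct \<Rightarrow> 's list \<Rightarrow> 's list \<Rightarrow> ('u list \<Rightarrow> 'u list \<Rightarrow> bool) \<Rightarrow> 'u list set" where
  "rel2 M ss ts P = {x @ y |x y. x \<in> tuples M ss \<and> y \<in> tuples M ts \<and> P x y}"

definition rel3 :: "('s, 'f, 'r, 'u) struct \<Rightarrow> 's list \<Rightarrow> 's list \<Rightarrow> 's list \<Rightarrow>
    ('u list \<Rightarrow> 'u list \<Rightarrow> 'u list \<Rightarrow> bool) \<Rightarrow> 'u list set" where
  "rel3 M ss ts us P =
    {x @ y @ z |x y z. x \<in> tuples M ss \<and> y \<in> tuples M ts \<and> z \<in> tuples M us \<and> P x y z}"

lemma rel1_iff [simp]: "x \<in> rel1 M ss P \<longleftrightarrow> x \<in> tuples M ss \<and> P x"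
  by (simp add: rel1_def)

lemma tuples_append_inject:
  "x \<in> tuples M ss \<Longrightarrow> x' \<in> tuples M ss \<Longrightarrow> x @ y = x' @ y' \<longleftrightarrow> x = x' \<and> y = y'"
  by (simp add: tuples_length)

lemma rel2_iff [simp]:
  "x \<in> tuples M ss \<Longrightarrow> x @ y \<in> rel2 M ss ts P \<longleftrightarrow> y \<in> tuples M ts \<and> P x y"
  unfolding rel2_def by (auto simp: tuples_append_inject)

lemma rel3_iff [simp]:
  "x \<in> tuples M ss \<Longrightarrow> y \<in> tuples M ts \<Longrightarrow>
    x @ y @ z \<in> rel3 M ss ts us P \<longleftrightarrow> z \<in> tuples M us \<and> P x y z"
  unfolding rel3_def by (auto simp: tuples_append_inject)

lemma rel2_cases:
  assumes "z \<in> rel2 M ss ts P"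
  obtains x y where "z = x @ y" "x \<in> tuples M ss" "y \<in> tuples M ts" "P x y"
  using assms by (auto simp: rel2_def)

lemma definable_mono: "definable L M A ss X \<Longrightarrow> A \<subseteq> A' \<Longrightarrow> definable L M A' ss X"
  unfolding definable_def by blast

context def_ctx
begin

lemma definable_rel1: "defb [ss] (\<lambda>v. P (v 0)) \<Longrightarrow> definable L M A ss (rel1 M ss P)"
  unfolding rel1_def by (rule definable1)

lemma definable_rel2:
  "defb [ss, ts] (\<lambda>v. P (v 0) (v (Suc 0))) \<Longrightarrow> definable L M A (ss @ ts) (rel2 M ss ts P)"
  using definable_blocks[of "[ss, ts]" "\<lambda>v. P (v 0) (v (Suc 0))"] unfolding rel2_def
  by (simp, elim back_subst[of "definable L M A (ss @ ts)"])
    (auto intro: exI[of _ "case_nat x (\<lambda>n. y)" for x y])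

lemma definable_rel3:
  "defb [ss, ts, us] (\<lambda>v. P (v 0) (v (Suc 0)) (v (Suc (Suc 0)))) \<Longrightarrow>
    definable L M A (ss @ ts @ us) (rel3 M ss ts us P)"
  using definable_blocks[of "[ss, ts, us]" "\<lambda>v. P (v 0) (v (Suc 0)) (v (Suc (Suc 0)))"] unfolding rel3_def
  by (simp, elim back_subst[of "definable L M A (ss @ ts @ us)"])
    (auto intro: exI[of _ "case_nat x (case_nat y (\<lambda>n. z))" for x y z])

text \<open>The valuations satisfying \<open>P\<close> form a definable set of concatenated tuples,
  and membership of the concatenated terms in it is an instance of \<open>defb_mem\<close>. This
  permits substitution into predicates of which nothing but definability is known.\<close>

lemma defb_subst:
  assumes "defb \<Sigma> P" "\<And>i. i < length \<Sigma> \<Longrightarrow> dterm \<Sigma>' (\<tau> i) (\<Sigma> ! i)"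
  shows "defb \<Sigma>' (\<lambda>v. P (\<lambda>i. \<tau> i v))"
proof -
  have t: "dterm \<Sigma>' (\<lambda>v. env \<Sigma> (\<lambda>i. \<tau> i v)) (concat \<Sigma>)" using assms(2)
  proof (induction \<Sigma> arbitrary: \<tau>)
    case Nil
    then show ?case by (simp add: dterm_Nil)
  next
    case (Cons ss \<Sigma>)
    have "dterm \<Sigma>' (\<tau> 0) ss" using Cons.prems[of 0] by simp
    moreover have "dterm \<Sigma>' (\<lambda>v. env \<Sigma> (\<lambda>i. \<tau> (Suc i) v)) (concat \<Sigma>)"
      by (rule Cons.IH) (use Cons.prems[of "Suc _"] in auto)
    ultimately show ?case by (simp add: dterm_append)
  qed
  let ?R = "{env \<Sigma> v |v. val M \<Sigma> v \<and> P v}"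
  have D: "defb \<Sigma>' (\<lambda>v. env \<Sigma> (\<lambda>i. \<tau> i v) \<in> ?R)"
    by (rule defb_mem[OF definable_blocks[OF assms(1)] t])
  have eq: "P (\<lambda>i. \<tau> i v) \<longleftrightarrow> env \<Sigma> (\<lambda>i. \<tau> i v) \<in> ?R" if v: "val M \<Sigma>' v" for v
  proof -
    have v': "val M \<Sigma> (\<lambda>i. \<tau> i v)"
      using dterm_tuples[OF assms(2) v] by (simp add: val_def)
    obtain cs c \<phi> where \<phi>: "\<And>v. val M \<Sigma> v \<Longrightarrow> P v \<longleftrightarrow> sat M (env \<Sigma> v @ c) \<phi>"
      using assms(1) by (rule defbE) blast
    show ?thesis using v' \<phi> by auto
  qed
  show ?thesis by (rule iffD2[OF defb_cong D]) (rule eq)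
qed

end

text \<open>The three clauses of \<open>b_minimal\<close> share one premise about \<open>F\<close>;
  here the identity on \<open>X\<close> plays the part of \<open>F\<close>.\<close>

lemma b_minimal_b1:
  assumes "b_minimal L K" "A \<subseteq> elems K" "definable L K A [main L] X"
  obtains ss S h where "set ss \<subseteq> aux L" "definable_map L K A [main L] X ss S h"
    "\<And>s. s \<in> h ` X \<Longrightarrow> is_point (fiber h X s) \<or> is_ball L K (fiber h X s)"
proof -
  interpret def_ctx L K A by unfold_locales (rule assms(2))
  have X: "X \<subseteq> tuples K [main L]" using assms(3) by (rule definable_subset)
  have "definable L K A [main L] (tuples K [main L])"
    using definable_rel1[of "[main L]" "\<lambda>x. True", OF defb_const] by (simp add: rel1_def)
  moreover have "definable L K A ([main L] @ [main L]) (rel2 K [main L] [main L] (\<lambda>x y. x \<in> X \<and> x = y))"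
    by (rule definable_rel2) (rule defb_rules assms(3) | simp)+
  moreover have "rel2 K [main L] [main L] (\<lambda>x y. x \<in> X \<and> x = y) = {x @ x |x. x \<in> X}"
    using X by (auto simp: rel2_def)
  ultimately have F: "definable_map L K A [main L] X [main L] (tuples K [main L]) (\<lambda>x. x)"
    using assms(3) X by (simp add: definable_map_def)
  from assms(1)[unfolded b_minimal_def, THEN spec[of _ A], THEN spec[of _ X], THEN spec[of _ "\<lambda>x. x"],
      THEN mp, OF conjI[OF assms(2) conjI[OF assms(3) F]], THEN conjunct1]
  obtain ss S h where 1: "set ss \<subseteq> aux L \<and> definable_map L K A [main L] X ss S h \<and>
    (\<forall>s\<in>h ` X. is_point (fiber h X s) \<or> is_ball L K (fiber h X s))" by (elim exE)
  show ?thesis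
    by (rule that[OF 1[THEN conjunct1] 1[THEN conjunct2, THEN conjunct1]])
      (rule 1[THEN conjunct2, THEN conjunct2, THEN bspec])
qed

lemma b_minimal_b2:
  assumes "b_minimal L K" "set ss \<subseteq> aux L" "is_ball L K D"
    "definable_map L K (elems K) ss S [main L] D g"
  shows "g ` S \<noteq> D"
proof -
  interpret def_ctx L K "elems K" by unfold_locales simp
  have X: "definable L K (elems K) [main L] (tuples K [main L])"
    using definable_rel1[of "[main L]" "\<lambda>x. True", OF defb_const] by (simp add: rel1_def)
  moreover have "definable L K (elems K) ([main L] @ [main L]) (rel2 K [main L] [main L] (\<lambda>x y. x = y))"
    by (rule definable_rel2) (rule defb_rules | simp)+
  moreover have "rel2 K [main L] [main L] (\<lambda>x y. x = y) = {x @ x |x. x \<in> tuples K [main L]}"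
    by (auto simp: rel2_def)
  ultimately have F: "definable_map L K (elems K) [main L] (tuples K [main L]) [main L] (tuples K [main L]) (\<lambda>x. x)"
    by (simp add: definable_map_def)
  from assms(1)[unfolded b_minimal_def, THEN spec, THEN spec, THEN spec,
      THEN mp, OF conjI[OF subset_refl conjI[OF X F]], THEN conjunct2, THEN conjunct1]
  show ?thesis using assms(2-4) by metis
qed

lemma b_minimal_b3:
  assumes "b_minimal L K" "A \<subseteq> elems K"
    "definable_map L K A [main L] X [main L] (tuples K [main L]) F"
  obtains ss S h where "set ss \<subseteq> aux L" "definable_map L K A [main L] X ss S h"
    "\<And>s. s \<in> h ` X \<Longrightarrow> inj_on F (fiber h X s) \<or> (\<exists>c. \<forall>x\<in>fiber h X s. F x = c)"
proof -
  have X: "definable L K A [main L] X" using assms(3) by (simp add: definable_map_def)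
  from assms(1)[unfolded b_minimal_def, THEN spec[of _ A], THEN spec[of _ X], THEN spec[of _ F],
      THEN mp, OF conjI[OF assms(2) conjI[OF X assms(3)]], THEN conjunct2, THEN conjunct2]
  obtain ss S h where 1: "set ss \<subseteq> aux L \<and> definable_map L K A [main L] X ss S h \<and>
    (\<forall>s\<in>h ` X. inj_on F (fiber h X s) \<or> (\<exists>c. \<forall>x\<in>fiber h X s. F x = c))" by (elim exE)
  show ?thesis
    by (rule that[OF 1[THEN conjunct1] 1[THEN conjunct2, THEN conjunct1]])
      (rule 1[THEN conjunct2, THEN conjunct2, THEN bspec])
qed

text \<open>Families of pieces are indexed by auxiliary tuples but may overlap, and pieces may be empty;
  this is all that is needed, and it makes the families easy to combine.\<close>

definition covers :: "('s, 'f, 'r) lang \<Rightarrow> ('s, 'f, 'r, 'u) struct \<Rightarrow> ('u list \<Rightarrow> 'u list set \<Rightarrow> bool) \<Rightarrow>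
    'u list set \<Rightarrow> 's list \<Rightarrow> 'u list set \<Rightarrow> 'u list \<Rightarrow> bool" where
  "covers L M \<Phi> X ss H p \<longleftrightarrow>
     (\<forall>x\<in>tuples M [main L]. p @ x \<in> X \<longleftrightarrow> (\<exists>s\<in>tuples M ss. p @ x @ s \<in> H)) \<and>
     (\<forall>s\<in>tuples M ss. \<Phi> p {x \<in> tuples M [main L]. p @ x @ s \<in> H})"

text \<open>Both families are placed on the product of their index sets, and \<open>p\<close>
  decides which component of the index is read.\<close>

lemma covers_merge:
  assumes "definable L M (elems M) \<Gamma> G1" "G2 \<subseteq> tuples M \<Gamma>" "\<And>p. p \<in> tuples M \<Gamma> \<Longrightarrow> \<Phi> p {}"
    and 1: "set ss1 \<subseteq> aux L" "definable L M (elems M) (\<Gamma> @ [main L] @ ss1) H1"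
    "\<And>p. p \<in> G1 \<Longrightarrow> covers L M \<Phi> X ss1 H1 p"
    and 2: "set ss2 \<subseteq> aux L" "definable L M (elems M) (\<Gamma> @ [main L] @ ss2) H2"
    "\<And>p. p \<in> G2 \<Longrightarrow> covers L M \<Phi> X ss2 H2 p"
  shows "\<exists>ss H. set ss \<subseteq> aux L \<and> definable L M (elems M) (\<Gamma> @ [main L] @ ss) H \<and>
    (\<forall>p\<in>G1 \<union> G2. covers L M \<Phi> X ss H p)"
proof -
  interpret def_ctx L M "elems M" by unfold_locales simp
  have G1: "G1 \<subseteq> tuples M \<Gamma>" using assms(1) by (rule definable_subset)
  \<comment> \<open>An empty index set would make the product empty and lose the other cover. In
    that case the other index set is used alone; the set covered by the empty family is empty, and
    empty pieces satisfy \<Phi>.\<close>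
  consider "tuples M ss1 = {}" | "tuples M ss2 = {}" | s1 s2 where "s1 \<in> tuples M ss1" "s2 \<in> tuples M ss2"
    by blast
  then show ?thesis
  proof cases
    case 1
    define H where "H = rel3 M \<Gamma> [main L] ss2 (\<lambda>p x s. p \<notin> G1 \<and> p @ x @ s \<in> H2)"
    have "definable L M (elems M) (\<Gamma> @ [main L] @ ss2) H" unfolding H_def
      by (rule definable_rel3) (rule defb_rules assms(1) 2(2) | simp)+
    moreover have "covers L M \<Phi> X ss2 H p" if "p \<in> G1" for p
      using that assms(6)[OF that] G1 assms(3) 1 unfolding covers_def H_def by (auto simp: subset_iff cong: conj_cong)
    moreover have "covers L M \<Phi> X ss2 H p" if "p \<in> G2" "p \<notin> G1" for p
      using that 2(3)[OF that(1)] assms(2) unfolding covers_def H_def by (auto simp: subset_iff cong: conj_cong)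
    ultimately show ?thesis using 2(1) by blast
  next
    case 2
    define H where "H = rel3 M \<Gamma> [main L] ss1 (\<lambda>p x s. p \<in> G1 \<and> p @ x @ s \<in> H1)"
    have "definable L M (elems M) (\<Gamma> @ [main L] @ ss1) H" unfolding H_def
      by (rule definable_rel3) (rule defb_rules assms(1) 1(2) | simp)+
    moreover have "covers L M \<Phi> X ss1 H p" if "p \<in> G1" for p
      using that 1(3)[OF that] G1 unfolding covers_def H_def by (auto simp: subset_iff cong: conj_cong)
    moreover have "covers L M \<Phi> X ss1 H p" if "p \<in> G2" "p \<notin> G1" for p
      using that assms(9)[OF that(1)] assms(2,3) 2 unfolding covers_def H_def by (auto simp: subset_iff cong: conj_cong)
    ultimately show ?thesis using 1(1) by blast
  next
    case (3 u1 u2)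
    define P where "P p x s \<longleftrightarrow> (\<exists>s1\<in>tuples M ss1. \<exists>s2\<in>tuples M ss2. s = s1 @ s2 \<and>
      ((p \<in> G1 \<and> p @ x @ s1 \<in> H1) \<or> (p \<notin> G1 \<and> p @ x @ s2 \<in> H2)))" for p x s
    define H where "H = rel3 M \<Gamma> [main L] (ss1 @ ss2) P"
    have "definable L M (elems M) (\<Gamma> @ [main L] @ ss1 @ ss2) H" unfolding H_def
      by (rule definable_rel3, unfold P_def) (rule defb_rules assms(1) 1(2) 2(2) | simp)+
    moreover have H: "p @ x @ s1 @ s2 \<in> H \<longleftrightarrow> (if p \<in> G1 then p @ x @ s1 \<in> H1 else p @ x @ s2 \<in> H2)"
      if "p \<in> tuples M \<Gamma>" "x \<in> tuples M [main L]" "s1 \<in> tuples M ss1" "s2 \<in> tuples M ss2" for p x s1 s2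
      using that unfolding H_def by (auto simp: P_def tuples_append_inject intro: tuples_appendI)
    have ex: "(\<exists>s\<in>tuples M (ss1 @ ss2). Q s) \<longleftrightarrow> (\<exists>s1\<in>tuples M ss1. \<exists>s2\<in>tuples M ss2. Q (s1 @ s2))" 
      "(\<forall>s\<in>tuples M (ss1 @ ss2). Q s) \<longleftrightarrow> (\<forall>s1\<in>tuples M ss1. \<forall>s2\<in>tuples M ss2. Q (s1 @ s2))" for Q
      by (simp_all add: Bex_def Ball_def tuples_append) blast+
    have "covers L M \<Phi> X (ss1 @ ss2) H p" if "p \<in> G1" for p
      using that 1(3)[OF that] G1 3 unfolding covers_def ex
      by (auto simp: H subset_iff cong: conj_cong)
    moreover have "covers L M \<Phi> X (ss1 @ ss2) H p" if "p \<in> G2" "p \<notin> G1" for p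
      using that 2(3)[OF that(1)] assms(2) 3 unfolding covers_def ex
      by (auto simp: H subset_iff cong: conj_cong)
    ultimately show ?thesis using 1(1) 2(1)
      by (intro exI[of _ "ss1 @ ss2"] exI[of _ H]) auto
  qed
qed

text \<open>The indices of the ultrafilter contain pairs of a formula and a tuple, while a candidate
  cover also carries two lists of sorts. These are coded by formulas, as the sorts of a chain of
  quantifiers; the codes are never evaluated.\<close>

fun enc :: "'s list \<Rightarrow> ('f, 'r, 's) fm" where
  "enc [] = Eq (Var 0) (Var 0)"
| "enc (s # ss) = Exists s (enc ss)"

lemma enc_inj: "enc ss = enc ts \<longleftrightarrow> ss = ts"
proof (induction ss arbitrary: ts)
  case Nil
  then show ?case by (cases ts) auto
next
  case (Cons s ss)
  then show ?case by (cases ts) auto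
qed

definition key :: "'s list \<times> 's list \<times> ('f, 'r, 's) fm \<times> 'u list \<Rightarrow> ('f, 'r, 's) fm \<times> 'u list" where
  "key = (\<lambda>(ss, cs, \<psi>, c). (Conj (Conj (enc ss) (enc cs)) \<psi>, c))"

lemma key_inj: "inj key"
  by (auto simp: inj_on_def key_def enc_inj)

text \<open>\<open>cones\<close> says that almost every index is a finite set containing a
  prescribed pair. b-minimality is assumed of the ultrapower, and its consequences for
  \<open>M\<close> are obtained by transfer.\<close>

locale bmin = ultrafilter ev
  for ev :: "((('f, 'r, 's) fm \<times> 'u list) set \<Rightarrow> bool) \<Rightarrow> bool" +
  fixes L :: "('s, 'f, 'r) lang" and M :: "('s, 'f, 'r, 'u) struct"
  assumes cones: "ev (\<lambda>i. finite i \<and> k \<in> i)"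
    and str: "is_structure L M" and lang: "language L" and bmin: "b_minimal L (upow L M)"
    and card2: "card (carr M (main L)) \<noteq> 2"
begin

abbreviation N where "N \<equiv> upow L M"
abbreviation M1 where "M1 \<equiv> tuples M [main L]"
abbreviation N1 where "N1 \<equiv> tuples N [main L]"
abbreviation Df where "Df \<equiv> definable L M (elems M)"

sublocale def_ctx L M "elems M" by unfold_locales simp

lemma par_iff: "par cs c \<longleftrightarrow> c \<in> tuples M cs"
  unfolding par_def by (auto simp: tuples_def elems_def list_all2_conv_all_nth)

text \<open>A candidate consists of the sorts of the index, a formula, and parameters from
  \<open>M\<close>; it does not contain \<open>p\<close>, so one candidate can serve many
  \<open>p\<close>. Satisfaction is written as membership in a definable set, the form to which the
  rules for transfer and definability apply.\<close>

definition good :: "('u list \<Rightarrow> 'u list set \<Rightarrow> bool) \<Rightarrow> 's list \<Rightarrow> 'u list set \<Rightarrow>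
    's list \<times> 's list \<times> ('f, 'r, 's) fm \<times> 'u list \<Rightarrow> 'u list \<Rightarrow> bool" where
  "good \<Phi> \<Gamma> X = (\<lambda>(ss, cs, \<psi>, c) p. set ss \<subseteq> aux L \<and> c \<in> tuples M cs \<and>
     wf_fm L ([main L] @ ss @ \<Gamma> @ cs) \<psi> \<and>
     (\<forall>x\<in>M1. p @ x \<in> X \<longleftrightarrow> (\<exists>s\<in>tuples M ss. x @ s @ p @ c \<in> {z \<in> tuples M ([main L] @ ss @ \<Gamma> @ cs). sat M z \<psi>})) \<and>
     (\<forall>s\<in>tuples M ss. \<Phi> p {x \<in> M1. x @ s @ p @ c \<in> {z \<in> tuples M ([main L] @ ss @ \<Gamma> @ cs). sat M z \<psi>}}))"

lemma def_sat: "wf_fm L ss \<psi> \<Longrightarrow> Df ss {z \<in> tuples M ss. sat M z \<psi>}"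
  unfolding definable_def by (intro exI[of _ \<psi>] exI[of _ "[]"]) auto

lemma trel_sat0: "wf_fm L ss \<psi> \<Longrightarrow> trel L M ss {z \<in> tuples M ss. sat M z \<psi>} {z \<in> tuples N ss. sat N z \<psi>}"
  using trel_sat[OF str, of ss "[]" \<psi> "[]"] by simp

text \<open>Compactness. If no finite set of candidates serves all \<open>p\<close>, pick for each
  finite index \<open>i\<close> a tuple \<open>q i\<close> at which every candidate named in
  \<open>i\<close> fails. The class of \<open>q\<close> has a cover in the ultrapower by
  \<open>cov\<close>; its formula is a candidate that works at \<open>q i\<close> for almost all
  \<open>i\<close>, although almost all \<open>i\<close> name it. Finitely many candidates are then
  merged.\<close>

lemma cover:
  fixes \<Phi> :: "'u list \<Rightarrow> 'u list set \<Rightarrow> bool"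
  assumes X: "Df (\<Gamma> @ [main L]) X" "trel L M (\<Gamma> @ [main L]) X X'"
    and \<Phi>_los: "\<And>ss cs R R'. trel L M ([main L] @ ss @ \<Gamma> @ cs) R R' \<Longrightarrow>
      los L M [ss, \<Gamma>, cs] (\<lambda>v. \<Phi> (v 1) {x \<in> M1. x @ v 0 @ v 1 @ v 2 \<in> R})
        (\<lambda>v. \<Phi>' (v 1) {x \<in> N1. x @ v 0 @ v 1 @ v 2 \<in> R'})"
    and \<Phi>_def: "\<And>ss cs R. Df ([main L] @ ss @ \<Gamma> @ cs) R \<Longrightarrow>
      defb [ss, \<Gamma>, cs] (\<lambda>v. \<Phi> (v 1) {x \<in> M1. x @ v 0 @ v 1 @ v 2 \<in> R})"
    and \<Phi>_empty: "\<And>p. p \<in> tuples M \<Gamma> \<Longrightarrow> \<Phi> p {}"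
    and cov: "\<And>p. p \<in> tuples N \<Gamma> \<Longrightarrow> \<exists>ss R. set ss \<subseteq> aux L \<and>
      definable L N (set (zip \<Gamma> p) \<union> diag_params M) ([main L] @ ss) R \<and>
      (\<forall>x\<in>N1. p @ x \<in> X' \<longleftrightarrow> (\<exists>s\<in>tuples N ss. x @ s \<in> R)) \<and>
      (\<forall>s\<in>tuples N ss. \<Phi>' p {x \<in> N1. x @ s \<in> R})"
  obtains ss H where "set ss \<subseteq> aux L" "Df (\<Gamma> @ [main L] @ ss) H"
    "\<And>p. p \<in> tuples M \<Gamma> \<Longrightarrow> covers L M \<Phi> X ss H p"
proof -
  have "\<exists>K. finite K \<and> (\<forall>p\<in>tuples M \<Gamma>. \<exists>k\<in>K. good \<Phi> \<Gamma> X k p)"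
  proof (rule ccontr)
    assume none: "\<not> ?thesis"
    have "\<exists>p\<in>tuples M \<Gamma>. \<forall>k. key k \<in> i \<longrightarrow> \<not> good \<Phi> \<Gamma> X k p" if "finite i" for i
    proof -
      \<comment> \<open>\<open>key\<close> is injective, so a finite index names only finitely many
        candidates.\<close>
      have "finite (key -` i)" using that key_inj by (intro finite_vimageI)
      then show ?thesis using none by (metis vimageI2)
    qed
    then obtain q where q: "\<And>i. finite i \<Longrightarrow> q i \<in> tuples M \<Gamma>"
      "\<And>i k. finite i \<Longrightarrow> key k \<in> i \<Longrightarrow> \<not> good \<Phi> \<Gamma> X k (q i)" by metis
    have "ev (\<lambda>i. q i \<in> tuples M \<Gamma>)"
      by (rule ev_mono[OF cones[of undefined]]) (use q in auto)
    then obtain p where p: "p \<in> tuples N \<Gamma>" "ev (\<lambda>i. coord i p = q i)" by (rule upow_lift)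
    obtain ss R where R: "set ss \<subseteq> aux L" "definable L N (set (zip \<Gamma> p) \<union> diag_params M) ([main L] @ ss) R"
      "\<forall>x\<in>N1. p @ x \<in> X' \<longleftrightarrow> (\<exists>s\<in>tuples N ss. x @ s \<in> R)"
      "\<forall>s\<in>tuples N ss. \<Phi>' p {x \<in> N1. x @ s \<in> R}" using cov[OF p(1)] by blast
    obtain cs c \<psi> where \<psi>: "c \<in> tuples M cs" "wf_fm L (([main L] @ ss) @ \<Gamma> @ cs) \<psi>"
      "R = {x \<in> tuples N ([main L] @ ss). sat N (x @ p @ diag c) \<psi>}"
      using definable_params[OF R(2) p(1)] by blast
    let ?ss = "[main L] @ ss @ \<Gamma> @ cs"
    let ?R = "{z \<in> tuples M ?ss. sat M z \<psi>}" and ?R' = "{z \<in> tuples N ?ss. sat N z \<psi>}"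
    have w: "wf_fm L ?ss \<psi>" using \<psi>(2) by simp
    have tr: "trel L M ?ss ?R ?R'" by (rule trel_sat0[OF w])
    have R': "x @ s \<in> R \<longleftrightarrow> x @ s @ p @ diag c \<in> ?R'" if "x \<in> N1" "s \<in> tuples N ss" for x s
      using that p(1) diag_in[OF \<psi>(1)] unfolding \<psi>(3)
      by (auto intro!: tuples_appendI simp del: append_Cons append_Nil)
    let ?P = "\<lambda>v. (\<forall>x\<in>M1. v 0 @ x \<in> X \<longleftrightarrow> (\<exists>s\<in>tuples M ss. x @ s @ v 0 @ v 1 \<in> ?R)) \<and>
      (\<forall>s\<in>tuples M ss. \<Phi> (v 0) {x \<in> M1. x @ s @ v 0 @ v 1 \<in> ?R})"
    let ?P' = "\<lambda>v. (\<forall>x\<in>N1. v 0 @ x \<in> X' \<longleftrightarrow> (\<exists>s\<in>tuples N ss. x @ s @ v 0 @ v 1 \<in> ?R')) \<and>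
      (\<forall>s\<in>tuples N ss. \<Phi>' (v 0) {x \<in> N1. x @ s @ v 0 @ v 1 \<in> ?R'})"
    have los: "los L M [\<Gamma>, cs] ?P ?P'"
    proof (rule los_conj)
      show "los L M [\<Gamma>, cs] (\<lambda>v. \<forall>x\<in>M1. v 0 @ x \<in> X \<longleftrightarrow> (\<exists>s\<in>tuples M ss. x @ s @ v 0 @ v 1 \<in> ?R))
        (\<lambda>v. \<forall>x\<in>N1. v 0 @ x \<in> X' \<longleftrightarrow> (\<exists>s\<in>tuples N ss. x @ s @ v 0 @ v 1 \<in> ?R'))"
        by (rule los_rules X(2) tr | simp)+
      show "los L M [\<Gamma>, cs] (\<lambda>v. \<forall>s\<in>tuples M ss. \<Phi> (v 0) {x \<in> M1. x @ s @ v 0 @ v 1 \<in> ?R})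
        (\<lambda>v. \<forall>s\<in>tuples N ss. \<Phi>' (v 0) {x \<in> N1. x @ s @ v 0 @ v 1 \<in> ?R'})"
        by (rule los_ball) (use \<Phi>_los[OF tr] in \<open>simp add: numeral_2_eq_2\<close>)
    qed
    have "val N [\<Gamma>, cs] (case_nat p (\<lambda>n. diag c))" using p(1) diag_in[OF \<psi>(1)] by simp
    then have "?P' (case_nat p (\<lambda>n. diag c)) \<longleftrightarrow> ev (\<lambda>i. ?P (\<lambda>n. coord i (case_nat p (\<lambda>n. diag c) n)))"
      by (rule los[unfolded los_def, THEN spec, THEN mp])
    moreover have "?P' (case_nat p (\<lambda>n. diag c))"
      using R(3,4) R' by (simp cong: conj_cong)
    ultimately have "ev (\<lambda>i. ?P (\<lambda>n. coord i (case_nat p (\<lambda>n. diag c) n)))" by blast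
    then have "ev (\<lambda>i. (coord i p = q i \<and> coord i (diag c) = c) \<and>
        ?P (\<lambda>n. coord i (case_nat p (\<lambda>n. diag c) n)))"
      using p(2) ev_diag[of c] by (simp only: ev_conj simp_thms)
    \<comment> \<open>Almost every \<open>i\<close> contains the key of this candidate, which must
      then fail at \<open>q i\<close>; by transfer it works there for almost every
      \<open>i\<close>.\<close>
    then have "ev (\<lambda>i. (finite i \<and> key (ss, cs, \<psi>, c) \<in> i) \<and> (coord i p = q i \<and> coord i (diag c) = c) \<and>
        ?P (\<lambda>n. coord i (case_nat p (\<lambda>n. diag c) n)))"
      using cones[of "key (ss, cs, \<psi>, c)"] by (simp only: ev_conj simp_thms)
    then have "ev (\<lambda>i. False)"
    proof (rule ev_mono)
      fix i assume *: "(finite i \<and> key (ss, cs, \<psi>, c) \<in> i) \<and> (coord i p = q i \<and> coord i (diag c) = c) \<and>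
        ?P (\<lambda>n. coord i (case_nat p (\<lambda>n. diag c) n))"
      note e = *[THEN conjunct2, THEN conjunct1]
      have "good \<Phi> \<Gamma> X (ss, cs, \<psi>, c) (q i)"
        using *[THEN conjunct2, THEN conjunct2] e[THEN conjunct1] e[THEN conjunct2] R(1) \<psi>(1) w
        unfolding good_def prod.case by simp
      then show False using q(2) * by blast
    qed
    then show False by simp
  qed
  then obtain K where K: "finite K" "\<And>p. p \<in> tuples M \<Gamma> \<Longrightarrow> \<exists>k\<in>K. good \<Phi> \<Gamma> X k p" by blast
  have "\<exists>ss H. set ss \<subseteq> aux L \<and> Df (\<Gamma> @ [main L] @ ss) H \<and>
    (\<forall>p\<in>{p \<in> tuples M \<Gamma>. \<exists>k\<in>K. good \<Phi> \<Gamma> X k p}. covers L M \<Phi> X ss H p)"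
    using K(1)
  proof induction
    case empty
    have "Df (\<Gamma> @ [main L] @ []) (rel3 M \<Gamma> [main L] [] (\<lambda>p x s. False))"
      by (rule definable_rel3) (rule defb_const)
    then show ?case by (intro exI[of _ "[]"]) auto
  next
    case (insert k K)
    then obtain ss2 H2 where 2: "set ss2 \<subseteq> aux L" "Df (\<Gamma> @ [main L] @ ss2) H2"
      "\<And>p. p \<in> {p \<in> tuples M \<Gamma>. \<exists>k\<in>K. good \<Phi> \<Gamma> X k p} \<Longrightarrow> covers L M \<Phi> X ss2 H2 p" by blast
    obtain ss cs \<psi> c where k: "k = (ss, cs, \<psi>, c)" by (cases k)
    show ?case
    proof (cases "set ss \<subseteq> aux L \<and> c \<in> tuples M cs \<and> wf_fm L ([main L] @ ss @ \<Gamma> @ cs) \<psi>")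
      case False
      then have "\<not> good \<Phi> \<Gamma> X k p" for p unfolding k good_def by auto
      then show ?thesis using 2 by (intro exI[of _ ss2] exI[of _ H2]) auto
    next
      case True
      let ?R = "{z \<in> tuples M ([main L] @ ss @ \<Gamma> @ cs). sat M z \<psi>}"
      have R: "Df ([main L] @ ss @ \<Gamma> @ cs) ?R" by (rule def_sat) (use True in blast)
      have c: "par cs c" using True by (simp add: par_iff)
      let ?Q = "\<lambda>v. \<forall>s\<in>tuples M ss. \<Phi> (v 0) {x \<in> M1. x @ s @ v 0 @ v 1 \<in> ?R}"
      have "defb [\<Gamma>, cs] ?Q"
        by (rule defb_ball) (use \<Phi>_def[OF R] in \<open>simp add: numeral_2_eq_2\<close>)
      moreover have "dterm [\<Gamma>] (case_nat (\<lambda>v. v 0) (\<lambda>i v. c) i) ([\<Gamma>, cs] ! i)" if "i < length [\<Gamma>, cs]" for i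
        using that dterm_var[of 0 "[\<Gamma>]"] dterm_const[OF c] by (auto simp: less_Suc_eq_0_disj)
      ultimately have "defb [\<Gamma>] (\<lambda>v. ?Q (\<lambda>i. case_nat (\<lambda>v. v 0) (\<lambda>i v. c) i v))" by (rule defb_subst)
      then have d1: "defb [\<Gamma>] (\<lambda>v. \<forall>s\<in>tuples M ss. \<Phi> (v 0) {x \<in> M1. x @ s @ v 0 @ c \<in> ?R})"
        by simp
      have d2: "defb [\<Gamma>] (\<lambda>v. \<forall>x\<in>M1. v 0 @ x \<in> X \<longleftrightarrow> (\<exists>s\<in>tuples M ss. x @ s @ v 0 @ c \<in> ?R))"
        by (rule defb_rules X(1) R dterm_const[OF c] | simp)+
      \<comment> \<open>The set where \<open>k\<close> succeeds. It is definable because \<Phi> is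
        definable in families, and \<open>covers_merge\<close> needs this to decide between two
        covers.\<close>
      define G where "G = rel1 M \<Gamma> (good \<Phi> \<Gamma> X k)"
      have "good \<Phi> \<Gamma> X k = (\<lambda>p. (\<forall>x\<in>M1. p @ x \<in> X \<longleftrightarrow> (\<exists>s\<in>tuples M ss. x @ s @ p @ c \<in> ?R)) \<and>
        (\<forall>s\<in>tuples M ss. \<Phi> p {x \<in> M1. x @ s @ p @ c \<in> ?R}))"
        using True unfolding k good_def by (simp only: prod.case simp_thms)
      then have "Df \<Gamma> G" unfolding G_def by (intro definable_rel1) (simp only:, intro defb_conj d1 d2)
      define H1 where "H1 = rel3 M \<Gamma> [main L] ss (\<lambda>p x s. x @ s @ p @ c \<in> ?R)"
      have H1: "Df (\<Gamma> @ [main L] @ ss) H1" unfolding H1_def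
        by (rule definable_rel3) (rule defb_rules R dterm_const[OF c] | simp)+
      have "covers L M \<Phi> X ss H1 p" if "p \<in> G" for p
        using that unfolding G_def k good_def covers_def H1_def by (simp cong: conj_cong)
      then have *: "\<exists>ss' H'. set ss' \<subseteq> aux L \<and> Df (\<Gamma> @ [main L] @ ss') H' \<and>
        (\<forall>p\<in>G \<union> {p \<in> tuples M \<Gamma>. \<exists>k\<in>K. good \<Phi> \<Gamma> X k p}. covers L M \<Phi> X ss' H' p)"
        by (intro covers_merge[OF \<open>Df \<Gamma> G\<close> _ \<Phi>_empty _ H1 _ 2]) (use True in auto)
      have "{p \<in> tuples M \<Gamma>. \<exists>k\<in>insert k K. good \<Phi> \<Gamma> X k p} =
        G \<union> {p \<in> tuples M \<Gamma>. \<exists>k\<in>K. good \<Phi> \<Gamma> X k p}" by (auto simp: G_def)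
      then show ?thesis using * by simp
    qed
  qed
  then show ?thesis using K(2) that by (metis (mono_tags, lifting) mem_Collect_eq)
qed

end

section \<open>Uniform covers from (b1) and (b3), and the transfer of (b2)\<close>

definition ball_params :: "('s, 'f, 'r) lang \<Rightarrow> 's list" where
  "ball_params L = butlast (rel_sorts L (ball L))"

definition pt_or_ball :: "('s, 'f, 'r) lang \<Rightarrow> ('s, 'f, 'r, 'u) struct \<Rightarrow> 'u list set \<Rightarrow> bool" where
  "pt_or_ball L M Z \<longleftrightarrow>
     (\<forall>x\<in>tuples M [main L]. \<forall>y\<in>tuples M [main L]. x \<in> Z \<longrightarrow> y \<in> Z \<longrightarrow> x = y) \<or>
     (\<exists>a\<in>tuples M (ball_params L). \<forall>x\<in>tuples M [main L]. x \<in> Z \<longleftrightarrow> a @ x \<in> rint M (ball L))"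

text \<open>The function is the fibre at \<open>p\<close> of a graph \<open>F\<close>, and points
  outside its domain impose no condition.\<close>

definition inj_or_const :: "('s, 'f, 'r) lang \<Rightarrow> ('s, 'f, 'r, 'u) struct \<Rightarrow> 'u list set \<Rightarrow> 'u list \<Rightarrow> 'u list set \<Rightarrow> bool" where
  "inj_or_const L M F p Z \<longleftrightarrow>
     (\<forall>x\<in>tuples M [main L]. \<forall>x'\<in>tuples M [main L]. \<forall>y\<in>tuples M [main L].
        x \<in> Z \<longrightarrow> x' \<in> Z \<longrightarrow> p @ x @ y \<in> F \<longrightarrow> p @ x' @ y \<in> F \<longrightarrow> x = x') \<or>
     (\<forall>x\<in>tuples M [main L]. \<forall>x'\<in>tuples M [main L]. \<forall>y\<in>tuples M [main L]. \<forall>y'\<in>tuples M [main L].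
        x \<in> Z \<longrightarrow> x' \<in> Z \<longrightarrow> p @ x @ y \<in> F \<longrightarrow> p @ x' @ y' \<in> F \<longrightarrow> y = y')"

lemma tuples1: "x \<in> tuples M [s] \<longleftrightarrow> (\<exists>m\<in>carr M s. x = [m])"
  by (auto simp: tuples_Cons)

lemma definable_map_range:
  assumes "definable_map L M A ss X ts Y h" "x \<in> X"
  shows "h x \<in> tuples M ts"
proof -
  have "Y \<subseteq> tuples M ts" "h ` X \<subseteq> Y"
    using assms(1) by (auto simp: definable_map_def definable_def)
  then show ?thesis using assms(2) by blast
qed

lemma graph_iff:
  assumes "X \<subseteq> tuples M ss" "x \<in> tuples M ss"
  shows "x @ s \<in> {x @ h x |x. x \<in> X} \<longleftrightarrow> x \<in> X \<and> s = h x"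
proof
  assume "x @ s \<in> {x @ h x |x. x \<in> X}"
  then obtain x' where x': "x @ s = x' @ h x'" "x' \<in> X" by blast
  then show "x \<in> X \<and> s = h x" using tuples_append_inject[of x M ss x' s "h x'"] assms by auto
qed auto

context bmin
begin

lemma ball_rel: "ball L \<in> rels L" using lang by (simp add: language_def)

lemma ball_sorts: "rel_sorts L (ball L) = ball_params L @ [main L]"
  using lang by (auto simp: language_def ball_params_def)

lemma strN: "is_structure L N"
  by (rule upow_structure[OF str ball_rel])

lemma Df_ball: "Df (ball_params L @ [main L]) (rint M (ball L))"
  using definable_rel[OF ball_rel str] by (simp add: ball_sorts)

lemma trel_main_ball: "trel L M (ball_params L @ [main L]) (rint M (ball L)) (rint N (ball L))"
  using trel_ball[of L M "ball L"] by (simp add: ball_sorts)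

lemma is_ball_iff:
  assumes "is_structure L K"
  shows "is_ball L K D \<longleftrightarrow> D \<noteq> {} \<and> (\<exists>a\<in>tuples K (ball_params L). D = {x \<in> tuples K [main L]. a @ x \<in> rint K (ball L)})"
proof -
  have "{[m] |m. a @ [m] \<in> rint K (ball L)} = {x \<in> tuples K [main L]. a @ x \<in> rint K (ball L)}"
    if "a \<in> tuples K (ball_params L)" for a
  proof -
    have "[m] \<in> tuples K [main L]" if m: "a @ [m] \<in> rint K (ball L)" for m
    proof -
      have "a @ [m] \<in> tuples K (ball_params L @ [main L])"
        using assms m ball_rel ball_sorts unfolding is_structure_def by fastforce
      then show ?thesis using \<open>a \<in> tuples K (ball_params L)\<close> tuples_append_iff by blast
    qed
    then show ?thesis by (auto simp: tuples1)
  qed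
  then show ?thesis unfolding is_ball_def ball_params_def[symmetric] by (metis (no_types, lifting))
qed

lemma par_zip: "p \<in> tuples N \<Gamma> \<Longrightarrow> set (zip \<Gamma> p) \<union> diag_params M \<subseteq> elems N"
  using diag_params_elems by (auto simp: tuples_def elems_def list_all2_conv_all_nth in_set_zip)

text \<open>The pieces are the fibres of \<open>h\<close>, read off its graph. Indices outside the
  image of \<open>h\<close> give empty pieces, hence the requirement on \<open>{}\<close>.\<close>

lemma fiber_cover:
  assumes "set ss \<subseteq> aux L" "definable_map L N A [main L] Z ss S h"
    and \<Psi>: "\<And>s. s \<in> h ` Z \<Longrightarrow> \<Psi> (fiber h Z s)" "\<Psi> {}" and X: "\<And>x. x \<in> N1 \<Longrightarrow> X x \<longleftrightarrow> x \<in> Z"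
  shows "\<exists>ss R. set ss \<subseteq> aux L \<and> definable L N A ([main L] @ ss) R \<and>
    (\<forall>x\<in>N1. X x \<longleftrightarrow> (\<exists>s\<in>tuples N ss. x @ s \<in> R)) \<and> (\<forall>s\<in>tuples N ss. \<Psi> {x \<in> N1. x @ s \<in> R})"
proof (intro exI conjI ballI)
  define R where "R = {x @ h x |x. x \<in> Z}"
  have Z: "Z \<subseteq> N1" using assms(2) by (auto simp: definable_map_def definable_def)
  have R: "x @ s \<in> R \<longleftrightarrow> x \<in> Z \<and> s = h x" if "x \<in> N1" for x s
    unfolding R_def by (rule graph_iff[OF Z that])
  show "definable L N A ([main L] @ ss) R" using assms(2) by (simp add: definable_map_def R_def)
  show "X x \<longleftrightarrow> (\<exists>s\<in>tuples N ss. x @ s \<in> R)" if "x \<in> N1" for x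
    using definable_map_range[OF assms(2)] R[OF that] X[OF that] by blast
  show "\<Psi> {x \<in> N1. x @ s \<in> R}" for s
  proof -
    have "{x \<in> N1. x @ s \<in> R} = fiber h Z s"
    proof (rule set_eqI)
      show "x \<in> {x \<in> N1. x @ s \<in> R} \<longleftrightarrow> x \<in> fiber h Z s" for x
        using R[of x s] subsetD[OF Z, of x] by (auto simp: fiber_def)
    qed
    moreover have "s \<notin> h ` Z \<Longrightarrow> fiber h Z s = {}" unfolding fiber_def by blast
    ultimately show ?thesis using \<Psi> by (metis (lifting))
  qed
qed (rule assms(1))

text \<open>(b1) is applied in the ultrapower over the entries of \<open>p\<close> together with the
  diagonal, for every \<open>p\<close> there; \<open>cover\<close> turns this into one family over
  \<open>M\<close>.\<close>

lemma cover_points_balls: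
  assumes X: "Df (\<Gamma> @ [main L]) X"
  obtains ss H where "set ss \<subseteq> aux L" "Df (\<Gamma> @ [main L] @ ss) H"
    "\<And>p. p \<in> tuples M \<Gamma> \<Longrightarrow> covers L M (\<lambda>p. pt_or_ball L M) X ss H p"
proof -
  obtain X' where X': "definable L N (diag_params M) (\<Gamma> @ [main L]) X'" "trel L M (\<Gamma> @ [main L]) X X'"
    using definable_trel[OF str X] .
  show ?thesis
  proof (rule cover[OF X X'(2), where \<Phi> = "\<lambda>p. pt_or_ball L M" and \<Phi>' = "\<lambda>p. pt_or_ball L N"])
    show "los L M [ss, \<Gamma>, cs] (\<lambda>v. pt_or_ball L M {x \<in> M1. x @ v 0 @ v 1 @ v 2 \<in> R})
        (\<lambda>v. pt_or_ball L N {x \<in> N1. x @ v 0 @ v 1 @ v 2 \<in> R'})"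
      if tr: "trel L M ([main L] @ ss @ \<Gamma> @ cs) R R'" for ss cs R R'
      unfolding pt_or_ball_def
      by (simp cong: conj_cong) (rule los_rules tr trel_main_ball | simp)+
    show "defb [ss, \<Gamma>, cs] (\<lambda>v. pt_or_ball L M {x \<in> M1. x @ v 0 @ v 1 @ v 2 \<in> R})"
      if "Df ([main L] @ ss @ \<Gamma> @ cs) R" for ss cs R
      unfolding pt_or_ball_def
      by (simp cong: conj_cong) (rule defb_rules that Df_ball | simp)+
    show "pt_or_ball L M {}" for p :: "'u list" by (simp add: pt_or_ball_def)
    fix p assume p: "p \<in> tuples N \<Gamma>"
    let ?A = "set (zip \<Gamma> p) \<union> diag_params M"
    interpret D: def_ctx L N ?A by unfold_locales (rule par_zip[OF p])
    have dX: "definable L N ?A (\<Gamma> @ [main L]) X'" using X'(1) by (rule definable_mono) auto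
    have pp: "D.par \<Gamma> p"
      using tuples_length[OF p] unfolding D.par_def
      by (auto simp: list_all2_conv_all_nth in_set_zip)
    have "definable L N ?A [main L] (rel1 N [main L] (\<lambda>x. p @ x \<in> X'))"
      by (rule D.definable_rel1) (rule D.defb_rules dX D.dterm_const[OF pp] | simp)+
    note dZ = this
    obtain ss S h where h: "set ss \<subseteq> aux L"
      "definable_map L N ?A [main L] (rel1 N [main L] (\<lambda>x. p @ x \<in> X')) ss S h"
      "\<And>s. s \<in> h ` rel1 N [main L] (\<lambda>x. p @ x \<in> X') \<Longrightarrow>
        is_point (fiber h (rel1 N [main L] (\<lambda>x. p @ x \<in> X')) s) \<or>
        is_ball L N (fiber h (rel1 N [main L] (\<lambda>x. p @ x \<in> X')) s)"
      by (rule b_minimal_b1[OF bmin par_zip[OF p] dZ]) (rule that)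
    show "\<exists>ss R. set ss \<subseteq> aux L \<and> definable L N ?A ([main L] @ ss) R \<and>
        (\<forall>x\<in>N1. p @ x \<in> X' \<longleftrightarrow> (\<exists>s\<in>tuples N ss. x @ s \<in> R)) \<and>
        (\<forall>s\<in>tuples N ss. pt_or_ball L N {x \<in> N1. x @ s \<in> R})"
    proof (rule fiber_cover[OF h(1,2)])
      fix s assume "s \<in> h ` rel1 N [main L] (\<lambda>x. p @ x \<in> X')"
      from h(3)[OF this] show "pt_or_ball L N (fiber h (rel1 N [main L] (\<lambda>x. p @ x \<in> X')) s)"
        by (auto simp: is_point_def is_ball_iff[OF strN] pt_or_ball_def)
    qed (auto simp: pt_or_ball_def)
  qed (rule that)
qed

text \<open>The same with (b3), for the domain of the function that \<open>F\<close> defines at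
  \<open>p\<close>. That \<open>F'\<close> is still functional in the ultrapower is itself a
  transferred sentence.\<close>

lemma cover_inj_const:
  assumes F: "Df (\<Gamma> @ [main L] @ [main L]) F"
    and func: "\<And>p x y y'. p \<in> tuples M \<Gamma> \<Longrightarrow> x \<in> M1 \<Longrightarrow> y \<in> M1 \<Longrightarrow> y' \<in> M1 \<Longrightarrow>
      p @ x @ y \<in> F \<Longrightarrow> p @ x @ y' \<in> F \<Longrightarrow> y = y'"
  obtains ss H where "set ss \<subseteq> aux L" "Df (\<Gamma> @ [main L] @ ss) H"
    "\<And>p. p \<in> tuples M \<Gamma> \<Longrightarrow>
      covers L M (inj_or_const L M F) (rel2 M \<Gamma> [main L] (\<lambda>p x. \<exists>y\<in>M1. p @ x @ y \<in> F)) ss H p"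
proof -
  let ?X = "rel2 M \<Gamma> [main L] (\<lambda>p x. \<exists>y\<in>M1. p @ x @ y \<in> F)"
  obtain F' where F': "definable L N (diag_params M) (\<Gamma> @ [main L] @ [main L]) F'"
    "trel L M (\<Gamma> @ [main L] @ [main L]) F F'"
    using definable_trel[OF str F] .
  let ?X' = "rel2 N \<Gamma> [main L] (\<lambda>p x. \<exists>y\<in>N1. p @ x @ y \<in> F')"
  have X: "Df (\<Gamma> @ [main L]) ?X"
    by (rule definable_rel2) (rule defb_rules F | simp)+
  have trX: "trel L M (\<Gamma> @ [main L]) ?X ?X'"
    unfolding trel_def
  proof
    fix z assume "z \<in> tuples N (\<Gamma> @ [main L])"
    then obtain p x where z: "z = p @ x" "p \<in> tuples N \<Gamma>" "x \<in> N1" by (auto simp only: tuples_append)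
    have "los L M [\<Gamma>, [main L]] (\<lambda>v. \<exists>y\<in>M1. v 0 @ v 1 @ y \<in> F) (\<lambda>v. \<exists>y\<in>N1. v 0 @ v 1 @ y \<in> F')"
      by (rule los_rules F'(2) | simp)+
    from this[unfolded los_def, THEN spec, THEN mp, of "case_nat p (\<lambda>n. x)"] z
    have "(\<exists>y\<in>N1. p @ x @ y \<in> F') \<longleftrightarrow> ev (\<lambda>i. \<exists>y\<in>M1. coord i p @ coord i x @ y \<in> F)" by simp
    also have "\<dots> \<longleftrightarrow> ev (\<lambda>i. coord i z \<in> ?X)"
    proof (rule ev_cong)
      have "ev (\<lambda>i. coord i p \<in> tuples M \<Gamma> \<and> coord i x \<in> M1)"
        using upow_tuples[OF z(2)] upow_tuples[OF z(3)] by (simp add: ev_conj)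
      then show "ev (\<lambda>i. (\<exists>y\<in>M1. coord i p @ coord i x @ y \<in> F) = (coord i z \<in> ?X))"
        by (rule ev_mono) (simp add: z)
    qed
    finally show "z \<in> ?X' \<longleftrightarrow> ev (\<lambda>i. coord i z \<in> ?X)" using z by simp
  qed
  have "los L M [] (\<lambda>v. \<forall>p\<in>tuples M \<Gamma>. \<forall>x\<in>M1. \<forall>y\<in>M1. \<forall>y'\<in>M1. p @ x @ y \<in> F \<longrightarrow> p @ x @ y' \<in> F \<longrightarrow> y = y')
    (\<lambda>v. \<forall>p\<in>tuples N \<Gamma>. \<forall>x\<in>N1. \<forall>y\<in>N1. \<forall>y'\<in>N1. p @ x @ y \<in> F' \<longrightarrow> p @ x @ y' \<in> F' \<longrightarrow> y = y')"
    by (rule los_rules F'(2) | simp)+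
  moreover have "\<forall>p\<in>tuples M \<Gamma>. \<forall>x\<in>M1. \<forall>y\<in>M1. \<forall>y'\<in>M1. p @ x @ y \<in> F \<longrightarrow> p @ x @ y' \<in> F \<longrightarrow> y = y'"
    using func by blast
  ultimately have "\<forall>p\<in>tuples N \<Gamma>. \<forall>x\<in>N1. \<forall>y\<in>N1. \<forall>y'\<in>N1. p @ x @ y \<in> F' \<longrightarrow> p @ x @ y' \<in> F' \<longrightarrow> y = y'"
    unfolding los_def by (simp only: ev_const val_Nil simp_thms)
  then have func': "y = y'" if "p \<in> tuples N \<Gamma>" "x \<in> N1" "y \<in> N1" "y' \<in> N1" "p @ x @ y \<in> F'" "p @ x @ y' \<in> F'"
    for p x y y' using that by blast
  show ?thesis
  proof (rule cover[OF X trX, where \<Phi> = "inj_or_const L M F" and \<Phi>' = "inj_or_const L N F'"])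
    show "los L M [ss, \<Gamma>, cs] (\<lambda>v. inj_or_const L M F (v 1) {x \<in> M1. x @ v 0 @ v 1 @ v 2 \<in> R})
        (\<lambda>v. inj_or_const L N F' (v 1) {x \<in> N1. x @ v 0 @ v 1 @ v 2 \<in> R'})"
      if tr: "trel L M ([main L] @ ss @ \<Gamma> @ cs) R R'" for ss cs R R'
      unfolding inj_or_const_def
      by (simp cong: conj_cong) (rule los_rules tr F'(2) | simp)+
    show "defb [ss, \<Gamma>, cs] (\<lambda>v. inj_or_const L M F (v 1) {x \<in> M1. x @ v 0 @ v 1 @ v 2 \<in> R})"
      if "Df ([main L] @ ss @ \<Gamma> @ cs) R" for ss cs R
      unfolding inj_or_const_def
      by (simp cong: conj_cong) (rule defb_rules that F | simp)+
    show "inj_or_const L M F p {}" for p by (simp add: inj_or_const_def)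
    fix p assume p: "p \<in> tuples N \<Gamma>"
    let ?A = "set (zip \<Gamma> p) \<union> diag_params M"
    interpret D: def_ctx L N ?A by unfold_locales (rule par_zip[OF p])
    have dF: "definable L N ?A (\<Gamma> @ [main L] @ [main L]) F'" using F'(1) by (rule definable_mono) auto
    have pp: "D.par \<Gamma> p"
      using tuples_length[OF p] unfolding D.par_def
      by (auto simp: list_all2_conv_all_nth in_set_zip)
    let ?Z = "rel1 N [main L] (\<lambda>x. \<exists>y\<in>N1. p @ x @ y \<in> F')"
    define g where "g x = (THE y. y \<in> N1 \<and> p @ x @ y \<in> F')" for x
    have g: "g x = y" if "x \<in> N1" "y \<in> N1" "p @ x @ y \<in> F'" for x y
      unfolding g_def using func'[OF p] that by (intro the_equality) auto
    have gZ: "g x \<in> N1 \<and> p @ x @ g x \<in> F'" if "x \<in> ?Z" for x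
      using that g by auto
    have Z: "definable L N ?A [main L] ?Z"
      by (rule D.definable_rel1) (rule D.defb_rules dF D.dterm_const[OF pp] | simp)+
    moreover have "definable L N ?A [main L] N1"
      using D.definable_rel1[of "[main L]" "\<lambda>x. True", OF D.defb_const] by (simp add: rel1_def)
    moreover have "definable L N ?A ([main L] @ [main L]) (rel2 N [main L] [main L] (\<lambda>x y. p @ x @ y \<in> F'))"
      by (rule D.definable_rel2) (rule D.defb_rules dF D.dterm_const[OF pp] | simp)+
    moreover have "rel2 N [main L] [main L] (\<lambda>x y. p @ x @ y \<in> F') = {x @ g x |x. x \<in> ?Z}"
      using g gZ by (auto simp: rel2_def)
    ultimately have "definable_map L N ?A [main L] ?Z [main L] N1 g"
      using gZ by (auto simp: definable_map_def)
    note dZ = this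
    obtain ss S h where h: "set ss \<subseteq> aux L"
      "definable_map L N ?A [main L] ?Z ss S h"
      "\<And>s. s \<in> h ` ?Z \<Longrightarrow> inj_on g (fiber h ?Z s) \<or> (\<exists>c. \<forall>x\<in>fiber h ?Z s. g x = c)"
      by (rule b_minimal_b3[OF bmin par_zip[OF p] dZ]) (rule that)
    show "\<exists>ss R. set ss \<subseteq> aux L \<and> definable L N ?A ([main L] @ ss) R \<and>
        (\<forall>x\<in>N1. p @ x \<in> ?X' \<longleftrightarrow> (\<exists>s\<in>tuples N ss. x @ s \<in> R)) \<and>
        (\<forall>s\<in>tuples N ss. inj_or_const L N F' p {x \<in> N1. x @ s \<in> R})"
    proof (rule fiber_cover[OF h(1,2)])
      fix s assume "s \<in> h ` ?Z"
      from h(3)[OF this] show "inj_or_const L N F' p (fiber h ?Z s)"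
      proof
        assume inj: "inj_on g (fiber h ?Z s)"
        show "inj_or_const L N F' p (fiber h ?Z s)"
          unfolding inj_or_const_def
        proof (intro disjI1 ballI impI)
          fix x x' y assume *: "x \<in> N1" "x' \<in> N1" "y \<in> N1" "x \<in> fiber h ?Z s" "x' \<in> fiber h ?Z s"
            "p @ x @ y \<in> F'" "p @ x' @ y \<in> F'"
          have "g x = g x'" using g[OF *(1,3,6)] g[OF *(2,3,7)] by (rule trans[OF _ sym])
          then show "x = x'" using inj *(4,5) by (rule_tac inj_onD)
        qed
      next
        assume "\<exists>c. \<forall>x\<in>fiber h ?Z s. g x = c"
        then obtain c where c: "\<And>x. x \<in> fiber h ?Z s \<Longrightarrow> g x = c" by blast
        show "inj_or_const L N F' p (fiber h ?Z s)"
          unfolding inj_or_const_def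
        proof (intro disjI2 ballI impI)
          fix x x' y y' assume *: "x \<in> N1" "x' \<in> N1" "y \<in> N1" "y' \<in> N1"
            "x \<in> fiber h ?Z s" "x' \<in> fiber h ?Z s" "p @ x @ y \<in> F'" "p @ x' @ y' \<in> F'"
          show "y = y'" using g[OF *(1,3,7)] g[OF *(2,4,8)] c[OF *(5)] c[OF *(6)] by simp
        qed
      qed
    qed (use p in \<open>auto simp: inj_or_const_def\<close>)
  qed (rule that)
qed

text \<open>(b2) is known for the ultrapower. With the ball parameter quantified, the existence of a
  ball covered by the values of \<open>R\<close> is a statement about \<open>R\<close> alone; it
  transfers and yields a forbidden surjection.\<close>

lemma no_aux_onto_ball:
  assumes ss: "set ss \<subseteq> aux L" and R: "Df (ss @ [main L]) R"
    and func: "\<And>s x y. s \<in> tuples M ss \<Longrightarrow> x \<in> M1 \<Longrightarrow> y \<in> M1 \<Longrightarrow> s @ x \<in> R \<Longrightarrow> s @ y \<in> R \<Longrightarrow> x = y"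
    and a: "a \<in> tuples M (ball_params L)" "x0 \<in> M1" "a @ x0 \<in> rint M (ball L)"
    and onto: "\<And>x. x \<in> M1 \<Longrightarrow> a @ x \<in> rint M (ball L) \<Longrightarrow> \<exists>s\<in>tuples M ss. s @ x \<in> R"
  shows False
proof -
  obtain R' where R': "definable L N (diag_params M) (ss @ [main L]) R'" "trel L M (ss @ [main L]) R R'"
    using definable_trel[OF str R] .
  have "los L M [] (\<lambda>v. \<forall>s\<in>tuples M ss. \<forall>x\<in>M1. \<forall>y\<in>M1. s @ x \<in> R \<longrightarrow> s @ y \<in> R \<longrightarrow> x = y)
    (\<lambda>v. \<forall>s\<in>tuples N ss. \<forall>x\<in>N1. \<forall>y\<in>N1. s @ x \<in> R' \<longrightarrow> s @ y \<in> R' \<longrightarrow> x = y)"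
    by (rule los_rules R'(2) | simp)+
  moreover have "\<forall>s\<in>tuples M ss. \<forall>x\<in>M1. \<forall>y\<in>M1. s @ x \<in> R \<longrightarrow> s @ y \<in> R \<longrightarrow> x = y"
    using func by blast
  ultimately have "\<forall>s\<in>tuples N ss. \<forall>x\<in>N1. \<forall>y\<in>N1. s @ x \<in> R' \<longrightarrow> s @ y \<in> R' \<longrightarrow> x = y"
    unfolding los_def by (simp only: ev_const val_Nil simp_thms)
  then have func': "x = y" if "s \<in> tuples N ss" "x \<in> N1" "y \<in> N1" "s @ x \<in> R'" "s @ y \<in> R'" for s x y
    using that by blast
  have "los L M [] (\<lambda>v. \<exists>a\<in>tuples M (ball_params L). (\<exists>x\<in>M1. a @ x \<in> rint M (ball L)) \<and>
      (\<forall>x\<in>M1. a @ x \<in> rint M (ball L) \<longrightarrow> (\<exists>s\<in>tuples M ss. s @ x \<in> R)))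
    (\<lambda>v. \<exists>a\<in>tuples N (ball_params L). (\<exists>x\<in>N1. a @ x \<in> rint N (ball L)) \<and>
      (\<forall>x\<in>N1. a @ x \<in> rint N (ball L) \<longrightarrow> (\<exists>s\<in>tuples N ss. s @ x \<in> R')))"
    by (rule los_rules R'(2) trel_main_ball | simp)+
  moreover have "\<exists>a\<in>tuples M (ball_params L). (\<exists>x\<in>M1. a @ x \<in> rint M (ball L)) \<and>
      (\<forall>x\<in>M1. a @ x \<in> rint M (ball L) \<longrightarrow> (\<exists>s\<in>tuples M ss. s @ x \<in> R))" using a onto by blast
  ultimately have "\<exists>a\<in>tuples N (ball_params L). (\<exists>x\<in>N1. a @ x \<in> rint N (ball L)) \<and>
      (\<forall>x\<in>N1. a @ x \<in> rint N (ball L) \<longrightarrow> (\<exists>s\<in>tuples N ss. s @ x \<in> R'))"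
    unfolding los_def by (simp only: ev_const val_Nil simp_thms)
  then obtain b where b: "b \<in> tuples N (ball_params L)" "\<exists>x\<in>N1. b @ x \<in> rint N (ball L)"
    "\<And>x. x \<in> N1 \<Longrightarrow> b @ x \<in> rint N (ball L) \<Longrightarrow> \<exists>s\<in>tuples N ss. s @ x \<in> R'" by blast
  interpret D: def_ctx L N "elems N" by unfold_locales simp
  have dR: "definable L N (elems N) (ss @ [main L]) R'"
    using R'(1) diag_params_elems by (rule definable_mono)
  have dB: "definable L N (elems N) (ball_params L @ [main L]) (rint N (ball L))"
    using D.definable_rel[OF ball_rel strN] by (simp add: ball_sorts)
  have pb: "D.par (ball_params L) b"
    using b(1) unfolding D.par_def by (auto simp: tuples_def elems_def list_all2_conv_all_nth)
  let ?D = "rel1 N [main L] (\<lambda>x. b @ x \<in> rint N (ball L))"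
  \<comment> \<open>Only indices whose value lies in the ball are kept, so that the image of
    \<open>g\<close> is exactly the ball.\<close>
  let ?S = "rel1 N ss (\<lambda>s. \<exists>x\<in>N1. s @ x \<in> R' \<and> b @ x \<in> rint N (ball L))"
  define g where "g s = (THE x. x \<in> N1 \<and> s @ x \<in> R')" for s
  have g: "g s = x" if "s \<in> tuples N ss" "x \<in> N1" "s @ x \<in> R'" for s x
    unfolding g_def using func' that by (intro the_equality) auto
  have ball: "is_ball L N ?D"
    unfolding is_ball_iff[OF strN] using b(1,2) by (auto simp: rel1_def)
  have "definable L N (elems N) [main L] ?D"
    by (rule D.definable_rel1) (rule D.defb_rules dB D.dterm_const[OF pb] | simp)+
  moreover have "definable L N (elems N) ss ?S"
    by (rule D.definable_rel1) (rule D.defb_rules dR dB D.dterm_const[OF pb] | simp)+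
  moreover have "definable L N (elems N) (ss @ [main L]) (rel2 N ss [main L] (\<lambda>s x. s @ x \<in> R' \<and> b @ x \<in> rint N (ball L)))"
    by (rule D.definable_rel2) (rule D.defb_rules dR dB D.dterm_const[OF pb] | simp)+
  moreover have "rel2 N ss [main L] (\<lambda>s x. s @ x \<in> R' \<and> b @ x \<in> rint N (ball L)) = {s @ g s |s. s \<in> ?S}"
  proof (intro equalityI subsetI)
    fix z assume "z \<in> rel2 N ss [main L] (\<lambda>s x. s @ x \<in> R' \<and> b @ x \<in> rint N (ball L))"
    then obtain s x where "z = s @ x" "s \<in> tuples N ss" "x \<in> N1" "s @ x \<in> R'" "b @ x \<in> rint N (ball L)"
      by (rule rel2_cases) blast
    then show "z \<in> {s @ g s |s. s \<in> ?S}" using g by auto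
  qed (use g in \<open>auto simp: rel2_def\<close>)
  moreover have im: "g ` ?S = ?D"
  proof (intro equalityI subsetI)
    fix x assume "x \<in> ?D"
    then obtain s where "s \<in> tuples N ss" "s @ x \<in> R'" "x \<in> N1" "b @ x \<in> rint N (ball L)" using b(3) by auto
    then show "x \<in> g ` ?S" using g by (intro image_eqI[of _ _ s]) auto
  qed (use g in auto)
  ultimately have "definable_map L N (elems N) ss ?S [main L] ?D g"
    unfolding definable_map_def by simp
  from b_minimal_b2[OF bmin ss ball this] im show False by blast
qed

text \<open>A one-element main sort would be a ball and an image of the empty product, and two
  elements are excluded by \<open>card2\<close>. Given three elements, the function with value
  \<open>a\<close> at \<open>a\<close> and \<open>b\<close> elsewhere is neither injective nor
  constant, so its cover by (b3) cannot consist of a single piece.\<close>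

lemma two_aux:
  obtains ss u v where "set ss \<subseteq> aux L" "u \<in> tuples M ss" "v \<in> tuples M ss" "u \<noteq> v"
proof -
  note witness = that
  let ?C = "carr M (main L)"
  obtain w where w: "w \<in> rint M (ball L)" using str by (auto simp: is_structure_def)
  moreover have "rint M (ball L) \<subseteq> tuples M (ball_params L @ [main L])"
    using str ball_rel ball_sorts unfolding is_structure_def by metis
  ultimately have "w \<in> tuples M (ball_params L @ [main L])" by blast
  then obtain q x where qx: "q \<in> tuples M (ball_params L)" "x \<in> M1" "q @ x \<in> rint M (ball L)"
    using w by (auto simp only: tuples_append)
  then obtain a where a: "a \<in> ?C" "x = [a]" by (auto simp: tuples1)
  have "?C \<noteq> {a}"
  proof
    assume C: "?C = {a}"
    have D: "Df ([] @ [main L]) (rel2 M [] [main L] (\<lambda>s x. True))"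
      by (rule definable_rel2) (rule defb_const)
    have "[] @ y \<in> rel2 M [] [main L] (\<lambda>s x. True)" if "y \<in> M1" for y
      using that by (subst rel2_iff) auto
    then show False
      by (intro no_aux_onto_ball[OF _ D _ qx]) (use C in \<open>auto simp: tuples1\<close>)
  qed
  then obtain b where b: "b \<in> ?C" "b \<noteq> a" using a(1) by blast
  have "?C \<noteq> {a, b}" using card2 b(2) by (metis card_2_iff)
  then obtain c where c: "c \<in> ?C" "c \<noteq> a" "c \<noteq> b" using a(1) b(1) by blast
  have pa: "par [main L] [a]" "par [main L] [b]" using a b by (auto simp: par_iff tuples1)
  let ?F = "rel3 M [] [main L] [main L] (\<lambda>p x y. (x = [a] \<and> y = [a]) \<or> (x \<noteq> [a] \<and> y = [b]))"
  have DF: "Df ([] @ [main L] @ [main L]) ?F"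
    by (rule definable_rel3) (rule defb_rules dterm_const[OF pa(1)] dterm_const[OF pa(2)] | simp)+
  have F: "x @ y \<in> ?F \<longleftrightarrow> (x = [a] \<and> y = [a]) \<or> (x \<noteq> [a] \<and> y = [b])" if "x \<in> M1" "y \<in> M1" for x y
    using rel3_iff[of "[]" M "[]" x "[main L]" y] that by simp
  obtain ss H where H: "set ss \<subseteq> aux L"
    "\<And>p. p \<in> tuples M [] \<Longrightarrow>
      covers L M (inj_or_const L M ?F) (rel2 M [] [main L] (\<lambda>p x. \<exists>y\<in>M1. p @ x @ y \<in> ?F)) ss H p"
    using cover_inj_const[OF DF, of thesis] F by (auto simp del: append_Nil)
  have X: "x \<in> rel2 M [] [main L] (\<lambda>p x. \<exists>y\<in>M1. p @ x @ y \<in> ?F)" if "x \<in> M1" for x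
  proof -
    have ab: "[a] \<in> M1" "[b] \<in> M1" using a b by (auto simp: tuples1)
    have "\<exists>y\<in>M1. x @ y \<in> ?F"
      using F[OF that ab(1)] F[OF that ab(2)] ab by (cases "x = [a]") blast+
    then show ?thesis using rel2_iff[of "[]" M "[]" x] that by simp
  qed
  have cov: "\<And>x. x \<in> M1 \<Longrightarrow> \<exists>s\<in>tuples M ss. x @ s \<in> H"
    "\<And>s. s \<in> tuples M ss \<Longrightarrow> inj_or_const L M ?F [] {x \<in> M1. x @ s \<in> H}"
    using H(2)[of "[]"] X unfolding covers_def by auto
  have m: "[a] \<in> M1" "[b] \<in> M1" "[c] \<in> M1" using a b c by (auto simp: tuples1)
  show ?thesis
  proof (rule ccontr)
    assume "\<not> thesis"
    then have one: "u = v" if "u \<in> tuples M ss" "v \<in> tuples M ss" for u v using witness[OF H(1) that] \<open>\<not> thesis\<close> by blast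
    obtain s where s: "s \<in> tuples M ss" "[a] @ s \<in> H" using cov(1)[OF m(1)] by blast
    have all: "x @ s \<in> H" if "x \<in> M1" for x using cov(1)[OF that] one s(1) by blast
    from cov(2)[OF s(1)] show False unfolding inj_or_const_def
    proof
      assume "\<forall>x\<in>M1. \<forall>x'\<in>M1. \<forall>y\<in>M1. x \<in> {x \<in> M1. x @ s \<in> H} \<longrightarrow> x' \<in> {x \<in> M1. x @ s \<in> H} \<longrightarrow>
        [] @ x @ y \<in> ?F \<longrightarrow> [] @ x' @ y \<in> ?F \<longrightarrow> x = x'"
      from this[rule_format, of "[b]" "[c]" "[b]"] show False
        using F[OF m(2) m(2)] F[OF m(3) m(2)] all[OF m(2)] all[OF m(3)] m b c by simp
    next
      assume "\<forall>x\<in>M1. \<forall>x'\<in>M1. \<forall>y\<in>M1. \<forall>y'\<in>M1. x \<in> {x \<in> M1. x @ s \<in> H} \<longrightarrow> x' \<in> {x \<in> M1. x @ s \<in> H} \<longrightarrow>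
        [] @ x @ y \<in> ?F \<longrightarrow> [] @ x' @ y' \<in> ?F \<longrightarrow> y = y'"
      from this[rule_format, of "[a]" "[b]" "[a]" "[b]"] show False
        using F[OF m(1) m(1)] F[OF m(2) m(2)] all[OF m(1)] all[OF m(2)] m b by simp
    qed
  qed
qed

end

section \<open>Big sets\<close>

lemma replicate_Suc_right: "replicate (Suc n) x = replicate n x @ [x]"
  by (simp add: replicate_append_same)

context def_ctx
begin

text \<open>Curried forms for predicates in one to four blocks, used for predicates that are carried
  along with no formula in sight; \<open>dp1_rule\<close> to \<open>dp4_rule\<close> substitute
  arbitrary terms into them.\<close>

definition dp1 where "dp1 a P \<longleftrightarrow> defb [a] (\<lambda>v. P (v 0))"
definition dp2 where "dp2 a b P \<longleftrightarrow> defb [a, b] (\<lambda>v. P (v 0) (v (Suc 0)))"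
definition dp3 where "dp3 a b c P \<longleftrightarrow> defb [a, b, c] (\<lambda>v. P (v 0) (v (Suc 0)) (v (Suc (Suc 0))))"
definition dp4 where "dp4 a b c d P \<longleftrightarrow>
  defb [a, b, c, d] (\<lambda>v. P (v 0) (v (Suc 0)) (v (Suc (Suc 0))) (v (Suc (Suc (Suc 0)))))"

lemma dp1_rule:
  assumes "dp1 a P" "dterm \<Sigma> \<tau> a'" "a' = a"
  shows "defb \<Sigma> (\<lambda>v. P (\<tau> v))"
  using defb_subst[OF assms(1)[unfolded dp1_def], of \<Sigma> "\<lambda>i. \<tau>"] assms(2,3) by simp

lemma dp2_rule:
  assumes "dp2 a b P" "dterm \<Sigma> \<tau> a'" "dterm \<Sigma> \<sigma> b'" "a' = a" "b' = b"
  shows "defb \<Sigma> (\<lambda>v. P (\<tau> v) (\<sigma> v))"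
proof -
  have "dterm \<Sigma> (case_nat \<tau> (\<lambda>i. \<sigma>) i) ([a, b] ! i)" if "i < length [a, b]" for i
    using that assms(2-) by (auto simp: less_Suc_eq_0_disj)
  from defb_subst[OF assms(1)[unfolded dp2_def] this] show ?thesis by simp
qed

lemma dp3_rule:
  assumes "dp3 a b c P" "dterm \<Sigma> \<tau> a'" "dterm \<Sigma> \<sigma> b'" "dterm \<Sigma> \<rho> c'" "a' = a" "b' = b" "c' = c"
  shows "defb \<Sigma> (\<lambda>v. P (\<tau> v) (\<sigma> v) (\<rho> v))"
proof -
  have "dterm \<Sigma> (case_nat \<tau> (case_nat \<sigma> (\<lambda>i. \<rho>)) i) ([a, b, c] ! i)" if "i < length [a, b, c]" for i
    using that assms(2-) by (auto simp: less_Suc_eq_0_disj)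
  from defb_subst[OF assms(1)[unfolded dp3_def] this] show ?thesis by simp
qed

lemma dp4_rule:
  assumes "dp4 a b c d P" "dterm \<Sigma> \<tau> a'" "dterm \<Sigma> \<sigma> b'" "dterm \<Sigma> \<rho> c'" "dterm \<Sigma> \<theta> d'"
    "a' = a" "b' = b" "c' = c" "d' = d"
  shows "defb \<Sigma> (\<lambda>v. P (\<tau> v) (\<sigma> v) (\<rho> v) (\<theta> v))"
proof -
  have "dterm \<Sigma> (case_nat \<tau> (case_nat \<sigma> (case_nat \<rho> (\<lambda>i. \<theta>))) i) ([a, b, c, d] ! i)"
    if "i < length [a, b, c, d]" for i
    using that assms(2-) by (auto simp: less_Suc_eq_0_disj)
  from defb_subst[OF assms(1)[unfolded dp4_def] this] show ?thesis by simp
qed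

end

context bmin
begin

abbreviation ms where "ms n \<equiv> replicate n (main L)"
abbreviation Mn where "Mn n \<equiv> tuples M (replicate n (main L))"

lemma MnSuc: "x @ y \<in> Mn (Suc n) \<longleftrightarrow> y \<in> Mn n" if "x \<in> M1"
  using that by (auto simp: tuples_Cons)

lemma MnSuc_right: "y @ x \<in> Mn (Suc n) \<longleftrightarrow> x \<in> M1" if "y \<in> Mn n"
  unfolding replicate_Suc_right using that by (simp add: tuples_append_iff)

lemma MnSuc_cases:
  assumes "z \<in> Mn (Suc n)"
  obtains x y where "z = x @ y" "x \<in> M1" "y \<in> Mn n"
  using assms that by (metis replicate_Suc tuples_append append_Cons append_Nil)

lemma MnSuc_right_cases:
  assumes "z \<in> Mn (Suc n)"
  obtains y x where "z = y @ x" "y \<in> Mn n" "x \<in> M1"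
  using assms that unfolding replicate_Suc_right tuples_append by blast

lemma dconst: "c \<in> tuples M cs \<Longrightarrow> dterm \<Sigma> (\<lambda>v. c) cs"
  by (rule dterm_const) (simp add: par_iff)

lemma cover_points_balls_pred:
  assumes "dp2 \<Gamma> [main L] X"
  obtains ss H where "set ss \<subseteq> aux L" "dp3 \<Gamma> [main L] ss H"
    "\<And>p x. p \<in> tuples M \<Gamma> \<Longrightarrow> x \<in> M1 \<Longrightarrow> X p x \<longleftrightarrow> (\<exists>s\<in>tuples M ss. H p x s)"
    "\<And>p s. p \<in> tuples M \<Gamma> \<Longrightarrow> s \<in> tuples M ss \<Longrightarrow> pt_or_ball L M {x \<in> M1. H p x s}"
proof -
  have "Df (\<Gamma> @ [main L]) (rel2 M \<Gamma> [main L] X)"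
    by (rule definable_rel2) (use assms in \<open>simp add: dp2_def\<close>)
  then obtain ss H where H: "set ss \<subseteq> aux L" "Df (\<Gamma> @ [main L] @ ss) H"
    "\<And>p. p \<in> tuples M \<Gamma> \<Longrightarrow> covers L M (\<lambda>p. pt_or_ball L M) (rel2 M \<Gamma> [main L] X) ss H p"
    by (rule cover_points_balls) blast
  show ?thesis
  proof (rule that[of ss "\<lambda>p x s. p @ x @ s \<in> H"])
    show "dp3 \<Gamma> [main L] ss (\<lambda>p x s. p @ x @ s \<in> H)" unfolding dp3_def
      by (rule defb_rules H(2) | simp)+
  qed (use H(1,3) in \<open>auto simp: covers_def\<close>)
qed

lemma cover_inj_const_pred:
  assumes F: "dp3 \<Gamma> [main L] [main L] F"
    and func: "\<And>p x y y'. p \<in> tuples M \<Gamma> \<Longrightarrow> x \<in> M1 \<Longrightarrow> y \<in> M1 \<Longrightarrow> y' \<in> M1 \<Longrightarrow> F p x y \<Longrightarrow> F p x y' \<Longrightarrow> y = y'"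
  obtains ss H where "set ss \<subseteq> aux L" "dp3 \<Gamma> [main L] ss H"
    "\<And>p x. p \<in> tuples M \<Gamma> \<Longrightarrow> x \<in> M1 \<Longrightarrow> (\<exists>y\<in>M1. F p x y) \<longleftrightarrow> (\<exists>s\<in>tuples M ss. H p x s)"
    "\<And>p s. p \<in> tuples M \<Gamma> \<Longrightarrow> s \<in> tuples M ss \<Longrightarrow>
      (\<forall>x\<in>M1. \<forall>x'\<in>M1. \<forall>y\<in>M1. H p x s \<longrightarrow> H p x' s \<longrightarrow> F p x y \<longrightarrow> F p x' y \<longrightarrow> x = x') \<or>
      (\<forall>x\<in>M1. \<forall>x'\<in>M1. \<forall>y\<in>M1. \<forall>y'\<in>M1. H p x s \<longrightarrow> H p x' s \<longrightarrow> F p x y \<longrightarrow> F p x' y' \<longrightarrow> y = y')"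
proof -
  let ?F = "rel3 M \<Gamma> [main L] [main L] F"
  have DF: "Df (\<Gamma> @ [main L] @ [main L]) ?F"
    by (rule definable_rel3) (use F in \<open>simp add: dp3_def\<close>)
  obtain ss H where H: "set ss \<subseteq> aux L" "Df (\<Gamma> @ [main L] @ ss) H"
    "\<And>p. p \<in> tuples M \<Gamma> \<Longrightarrow>
      covers L M (inj_or_const L M ?F) (rel2 M \<Gamma> [main L] (\<lambda>p x. \<exists>y\<in>M1. p @ x @ y \<in> ?F)) ss H p"
    by (rule cover_inj_const[OF DF]) (use func in auto)
  show ?thesis
  proof (rule that[of ss "\<lambda>p x s. p @ x @ s \<in> H"])
    show "dp3 \<Gamma> [main L] ss (\<lambda>p x s. p @ x @ s \<in> H)" unfolding dp3_def
      by (rule defb_rules H(2) | simp)+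
    fix p s assume ps: "p \<in> tuples M \<Gamma>" "s \<in> tuples M ss"
    then have "inj_or_const L M ?F p {x \<in> M1. p @ x @ s \<in> H}" using H(3) by (auto simp: covers_def)
    then show "(\<forall>x\<in>M1. \<forall>x'\<in>M1. \<forall>y\<in>M1. p @ x @ s \<in> H \<longrightarrow> p @ x' @ s \<in> H \<longrightarrow> F p x y \<longrightarrow> F p x' y \<longrightarrow> x = x') \<or>
      (\<forall>x\<in>M1. \<forall>x'\<in>M1. \<forall>y\<in>M1. \<forall>y'\<in>M1. p @ x @ s \<in> H \<longrightarrow> p @ x' @ s \<in> H \<longrightarrow> F p x y \<longrightarrow> F p x' y' \<longrightarrow> y = y')"
      unfolding inj_or_const_def using ps(1) by simp
  next
    fix p x assume "p \<in> tuples M \<Gamma>" "x \<in> M1"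
    then show "(\<exists>y\<in>M1. F p x y) \<longleftrightarrow> (\<exists>s\<in>tuples M ss. p @ x @ s \<in> H)"
      using H(3)[of p] by (simp add: covers_def)
  qed (use H(1) in auto)
qed

definition big :: "'u list set \<Rightarrow> bool" where
  "big Z \<longleftrightarrow> (\<exists>a\<in>tuples M (ball_params L). (\<exists>x\<in>M1. a @ x \<in> rint M (ball L)) \<and>
    (\<forall>x\<in>M1. a @ x \<in> rint M (ball L) \<longrightarrow> x \<in> Z))"

lemma big_mono: "big Z \<Longrightarrow> (\<And>x. x \<in> M1 \<Longrightarrow> x \<in> Z \<Longrightarrow> x \<in> Z') \<Longrightarrow> big Z'"
  unfolding big_def by blast

lemma big_ne: "big Z \<Longrightarrow> \<exists>x\<in>M1. x \<in> Z"
  unfolding big_def by blast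

text \<open>Bigness is a first-order quantifier because all balls are fibres of one predicate. The
  substitution makes room for the ball parameter between the bound point and the blocks of
  \<Sigma>.\<close>

lemma defb_big:
  assumes "defb ([main L] # \<Sigma>) (\<lambda>v. P (\<lambda>n. v (Suc n)) (v 0))"
  shows "defb \<Sigma> (\<lambda>v. big {x \<in> M1. P v x})"
proof -
  have "dterm ([main L] # ball_params L # \<Sigma>) (case_nat (\<lambda>v. v 0) (\<lambda>k v. v (Suc (Suc k))) i) (([main L] # \<Sigma>) ! i)"
    if "i < length ([main L] # \<Sigma>)" for i
    using dterm_var[of 0 "[main L] # ball_params L # \<Sigma>"] dterm_var[of "Suc i" "[main L] # ball_params L # \<Sigma>"] that
    by (cases i) auto
  from defb_subst[OF assms this]
  have w: "defb ([main L] # ball_params L # \<Sigma>) (\<lambda>v. P (\<lambda>n. v (Suc (Suc n))) (v 0))" by simp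
  have "defb \<Sigma> (\<lambda>v. \<exists>a\<in>tuples M (ball_params L). (\<exists>x\<in>M1. a @ x \<in> rint M (ball L)) \<and>
      (\<forall>x\<in>M1. a @ x \<in> rint M (ball L) \<longrightarrow> P v x))"
    by (rule defb_rules Df_ball w | simp)+
  moreover have "big {x \<in> M1. P v x} \<longleftrightarrow> (\<exists>a\<in>tuples M (ball_params L). (\<exists>x\<in>M1. a @ x \<in> rint M (ball L)) \<and>
      (\<forall>x\<in>M1. a @ x \<in> rint M (ball L) \<longrightarrow> P v x))" for v
    unfolding big_def by auto
  ultimately show ?thesis by simp
qed

lemma small_image:
  assumes "set ss \<subseteq> aux L" "dp2 ss [main L] R"
    and "\<And>s x y. s \<in> tuples M ss \<Longrightarrow> x \<in> M1 \<Longrightarrow> y \<in> M1 \<Longrightarrow> R s x \<Longrightarrow> R s y \<Longrightarrow> x = y"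
  shows "\<not> big {x \<in> M1. \<exists>s\<in>tuples M ss. R s x}"
proof
  assume "big {x \<in> M1. \<exists>s\<in>tuples M ss. R s x}"
  then obtain a x where a: "a \<in> tuples M (ball_params L)" "x \<in> M1" "a @ x \<in> rint M (ball L)"
    "\<And>x. x \<in> M1 \<Longrightarrow> a @ x \<in> rint M (ball L) \<Longrightarrow> \<exists>s\<in>tuples M ss. R s x"
    unfolding big_def by blast
  have "Df (ss @ [main L]) (rel2 M ss [main L] R)"
    by (rule definable_rel2) (use assms(2) in \<open>simp add: dp2_def\<close>)
  then show False
    by (rule no_aux_onto_ball[OF assms(1) _ _ a(1-3)]) (use assms(3) a(4) in auto)
qed

text \<open>A point is an image of the empty product of sorts, which is auxiliary, so (b2) prevents
  it from containing a ball.\<close>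

lemma singleton_not_big:
  assumes "\<And>x y. x \<in> M1 \<Longrightarrow> y \<in> M1 \<Longrightarrow> x \<in> Z \<Longrightarrow> y \<in> Z \<Longrightarrow> x = y"
  shows "\<not> big Z"
proof
  assume Z: "big Z"
  then obtain c where c: "c \<in> M1" "c \<in> Z" using big_ne by blast
  have "dp2 [] [main L] (\<lambda>s x. x = c)" unfolding dp2_def
    by (rule defb_rules dconst[OF c(1)] | simp)+
  then have "\<not> big {x \<in> M1. \<exists>s\<in>tuples M []. x = c}" by (intro small_image) auto
  moreover have "big {x \<in> M1. \<exists>s\<in>tuples M []. x = c}"
    using Z by (rule big_mono) (use assms c in auto)
  ultimately show False by blast
qed

text \<open>Refine every set of the family into points and balls. If no set of the family is big,
  every piece has at most one element, so the union is an image of the auxiliary product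
  \<open>ss @ ts\<close> and cannot be big.\<close>

lemma big_Un:
  assumes ss: "set ss \<subseteq> aux L" and Z: "dp2 ss [main L] Z"
    and big: "big {x \<in> M1. \<exists>s\<in>tuples M ss. Z s x}"
  shows "\<exists>s\<in>tuples M ss. big {x \<in> M1. Z s x}"
proof (rule ccontr)
  assume no: "\<not> ?thesis"
  obtain ts H where H: "set ts \<subseteq> aux L" "dp3 ss [main L] ts H"
    "\<And>p x. p \<in> tuples M ss \<Longrightarrow> x \<in> M1 \<Longrightarrow> Z p x \<longleftrightarrow> (\<exists>s\<in>tuples M ts. H p x s)"
    "\<And>p s. p \<in> tuples M ss \<Longrightarrow> s \<in> tuples M ts \<Longrightarrow> pt_or_ball L M {x \<in> M1. H p x s}"
    using cover_points_balls_pred[OF Z] by blast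
  have one: "x = y" if s: "s \<in> tuples M ss" "t \<in> tuples M ts" "x \<in> M1" "y \<in> M1" "H s x t" "H s y t" for s t x y
    using H(4)[OF s(1,2)] unfolding pt_or_ball_def
  proof
    assume "\<exists>a\<in>tuples M (ball_params L). \<forall>x\<in>M1. x \<in> {x \<in> M1. H s x t} \<longleftrightarrow> a @ x \<in> rint M (ball L)"
    then have "big {x \<in> M1. Z s x}" using s H(3) unfolding big_def by blast
    then show "x = y" using no s(1) by blast
  qed (use s in blast)
  define R where "R u x \<longleftrightarrow> (\<exists>s\<in>tuples M ss. \<exists>t\<in>tuples M ts. u = s @ t \<and> H s x t)" for u x
  have "dp2 (ss @ ts) [main L] R" unfolding dp2_def R_def
    by (rule defb_rules dp3_rule[OF H(2)] | simp)+
  then have "\<not> big {x \<in> M1. \<exists>s\<in>tuples M (ss @ ts). R s x}"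
  proof (rule small_image[rotated])
    fix u x y assume "x \<in> M1" "y \<in> M1" "R u x" "R u y"
    then obtain s t s' t' where "u = s @ t" "u = s' @ t'" "s \<in> tuples M ss" "s' \<in> tuples M ss"
      "t \<in> tuples M ts" "t' \<in> tuples M ts" "H s x t" "H s' y t'"
      unfolding R_def by blast
    moreover from this have "s = s' \<and> t = t'" using tuples_append_inject[of s M ss s' t t'] by simp
    ultimately show "x = y" using one[of s t x y] \<open>x \<in> M1\<close> \<open>y \<in> M1\<close> by simp
  qed (use ss H(1) in auto)
  moreover have "big {x \<in> M1. \<exists>s\<in>tuples M (ss @ ts). R s x}"
    using big
  proof (rule big_mono)
    fix x assume "x \<in> M1" "x \<in> {x \<in> M1. \<exists>s\<in>tuples M ss. Z s x}"
    then obtain s t where "s \<in> tuples M ss" "t \<in> tuples M ts" "H s x t" using H(3) by blast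
    then have "s @ t \<in> tuples M (ss @ ts)" "R (s @ t) x"
      unfolding R_def by (auto intro: tuples_appendI)
    then show "x \<in> {x \<in> M1. \<exists>s\<in>tuples M (ss @ ts). R s x}" using \<open>x \<in> M1\<close> by blast
  qed
  ultimately show False by blast
qed

section \<open>Iterated quantifiers and additive properties\<close>

fun many :: "nat list \<Rightarrow> 'u list set \<Rightarrow> bool" where
  "many [] X \<longleftrightarrow> [] \<in> X"
| "many (j # js) X \<longleftrightarrow> (if j = 0 then \<exists>x\<in>M1. many js {y \<in> Mn (length js). x @ y \<in> X}
     else big {x \<in> M1. many js {y \<in> Mn (length js). x @ y \<in> X}})"

lemma many_mono: "many js X \<Longrightarrow> (\<And>x. x \<in> Mn (length js) \<Longrightarrow> x \<in> X \<Longrightarrow> x \<in> X') \<Longrightarrow> many js X'"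
proof (induction js arbitrary: X X')
  case (Cons j js)
  have *: "many js {y \<in> Mn (length js). x @ y \<in> X'}" if "x \<in> M1" "many js {y \<in> Mn (length js). x @ y \<in> X}" for x
    using that(2) by (rule Cons.IH) (use that(1) Cons.prems(2) MnSuc in auto)
  show ?case
  proof (cases "j = 0")
    case True
    then show ?thesis using Cons.prems(1) * by auto
  next
    case False
    then have "big {x \<in> M1. many js {y \<in> Mn (length js). x @ y \<in> X}}" using Cons.prems(1) by simp
    then have "big {x \<in> M1. many js {y \<in> Mn (length js). x @ y \<in> X'}}" by (rule big_mono) (use * in auto)
    then show ?thesis using False by simp
  qed
qed simp

lemma many_ne: "many js X \<Longrightarrow> \<exists>x\<in>Mn (length js). x \<in> X"
proof (induction js arbitrary: X)
  case (Cons j js)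
  then obtain x where "x \<in> M1" "many js {y \<in> Mn (length js). x @ y \<in> X}"
    by (auto split: if_splits dest: big_ne)
  then show ?case using Cons.IH[of "{y \<in> Mn (length js). x @ y \<in> X}"] MnSuc[of x] by auto
qed simp

text \<open>The outer quantifiers see only the base and the inner ones only the fibres. Additivity
  of dimension rests on this split into base and fibre coordinates.\<close>

lemma many_append:
  "many (js @ ks) X \<longleftrightarrow> many js {y \<in> Mn (length js). many ks {z \<in> Mn (length ks). y @ z \<in> X}}"
proof (induction js arbitrary: X)
  case Nil
  have "many ks X \<longleftrightarrow> many ks {z \<in> Mn (length ks). z \<in> X}"
    by (rule iffI; erule many_mono) auto
  then show ?case by simp
next
  case (Cons j js)
  have *: "many (js @ ks) {y \<in> Mn (length (js @ ks)). x @ y \<in> X} \<longleftrightarrow>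
    many js {y \<in> Mn (length js). x @ y \<in> {y \<in> Mn (Suc (length js)). many ks {z \<in> Mn (length ks). y @ z \<in> X}}}"
    if x: "x \<in> M1" for x
    unfolding Cons.IH
  proof (rule arg_cong[where f = "many js"], intro Collect_cong conj_cong refl)
    fix y assume y: "y \<in> Mn (length js)"
    have "{z \<in> Mn (length ks). y @ z \<in> {y \<in> Mn (length (js @ ks)). x @ y \<in> X}} =
      {z \<in> Mn (length ks). (x @ y) @ z \<in> X}"
      using y by (auto simp: replicate_add intro: tuples_appendI)
    then show "many ks {z \<in> Mn (length ks). y @ z \<in> {y \<in> Mn (length (js @ ks)). x @ y \<in> X}} \<longleftrightarrow>
      x @ y \<in> {y \<in> Mn (Suc (length js)). many ks {z \<in> Mn (length ks). y @ z \<in> X}}"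
      using x y MnSuc by simp
  qed
  show ?case using * by (auto cong: conj_cong)
qed

lemma defb_many:
  "defb (replicate (length js) (main L) # \<Sigma>) (\<lambda>v. P (\<lambda>n. v (Suc n)) (v 0)) \<Longrightarrow>
    defb \<Sigma> (\<lambda>v. many js {x \<in> Mn (length js). P v x})"
proof (induction js arbitrary: \<Sigma> P)
  case Nil
  then have "defb \<Sigma> (\<lambda>v. \<exists>x\<in>tuples M []. P v x)" by (intro defb_bex) simp
  then show ?case by (simp add: Bex_def)
next
  case (Cons j js)
  let ?n = "length js"
  let ?\<Sigma> = "replicate ?n (main L) # [main L] # \<Sigma>"
  have "dterm ?\<Sigma> (case_nat (\<lambda>v. v (Suc 0) @ v 0) (\<lambda>k v. v (Suc (Suc k))) i)
      ((replicate (length (j # js)) (main L) # \<Sigma>) ! i)"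
    if "i < length (replicate (length (j # js)) (main L) # \<Sigma>)" for i
    using dterm_append[OF dterm_var[of "Suc 0" ?\<Sigma>] dterm_var[of 0 ?\<Sigma>]] dterm_var[of "Suc i" ?\<Sigma>] that
    by (cases i) auto
  from defb_subst[OF Cons.prems this]
  have "defb ?\<Sigma> (\<lambda>v. P (\<lambda>n. v (Suc (Suc n))) (v (Suc 0) @ v 0))" by simp
  then have IH: "defb ([main L] # \<Sigma>) (\<lambda>v. many js {y \<in> Mn ?n. P (\<lambda>n. v (Suc n)) (v 0 @ y)})"
    by (rule Cons.IH)
  have eq: "{y \<in> Mn ?n. x @ y \<in> {x \<in> Mn (length (j # js)). P v x}} = {y \<in> Mn ?n. P v (x @ y)}"
    if "x \<in> M1" for x v
    using that MnSuc by auto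
  show ?case
  proof (cases "j = 0")
    case True
    have "defb \<Sigma> (\<lambda>v. \<exists>x\<in>M1. many js {y \<in> Mn ?n. P v (x @ y)})"
      by (rule defb_bex) (rule IH)
    then show ?thesis using True eq by (simp cong: bex_cong)
  next
    case False
    have "defb \<Sigma> (\<lambda>v. big {x \<in> M1. many js {y \<in> Mn ?n. P v (x @ y)}})"
      by (rule defb_big) (rule IH)
    then show ?thesis using False eq by (simp cong: conj_cong)
  qed
qed

text \<open>The conclusion of \<open>big_Un\<close> as a property of an arbitrary \<Lambda>. The
  generality is used to select a piece of a set according to the size of its image under a map,
  rather than its own size.\<close>

definition additive :: "'s list \<Rightarrow> ('u list set \<Rightarrow> bool) \<Rightarrow> bool" where
  "additive ts \<Lambda> \<longleftrightarrow> (\<forall>ss X. set ss \<subseteq> aux L \<longrightarrow> dp2 ss ts X \<longrightarrow>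
     \<Lambda> {y \<in> tuples M ts. \<exists>s\<in>tuples M ss. X s y} \<longrightarrow> (\<exists>s\<in>tuples M ss. \<Lambda> {y \<in> tuples M ts. X s y}))"

lemma additiveD:
  assumes "additive ts \<Lambda>" "set ss \<subseteq> aux L" "dp2 ss ts X" "\<Lambda> {y \<in> tuples M ts. \<exists>s\<in>tuples M ss. X s y}"
  shows "\<exists>s\<in>tuples M ss. \<Lambda> {y \<in> tuples M ts. X s y}"
  using assms unfolding additive_def by blast

text \<open>Two distinct tuples of an auxiliary product index the two sets; this is the use of
  \<open>two_aux\<close>.\<close>

lemma additive_or:
  assumes "additive ts \<Lambda>" "dp1 ts X" "dp1 ts X'" "\<Lambda> {y \<in> tuples M ts. X y \<or> X' y}"
  shows "\<Lambda> {y \<in> tuples M ts. X y} \<or> \<Lambda> {y \<in> tuples M ts. X' y}"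
proof -
  obtain ss u v where ss: "set ss \<subseteq> aux L" "u \<in> tuples M ss" "v \<in> tuples M ss" "u \<noteq> v"
    by (rule two_aux)
  define Z where "Z s y \<longleftrightarrow> (s = u \<and> X y) \<or> (s \<noteq> u \<and> X' y)" for s y
  have Z: "dp2 ss ts Z" unfolding dp2_def Z_def
    by (rule defb_rules dp1_rule[OF assms(2)] dp1_rule[OF assms(3)] dconst[OF ss(2)] | simp)+
  have "{y \<in> tuples M ts. \<exists>s\<in>tuples M ss. Z s y} = {y \<in> tuples M ts. X y \<or> X' y}"
    using ss by (auto simp: Z_def)
  then obtain s where "s \<in> tuples M ss" "\<Lambda> {y \<in> tuples M ts. Z s y}"
    using additiveD[OF assms(1) ss(1) Z] assms(4) by auto
  then show ?thesis by (cases "s = u") (auto simp: Z_def)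
qed

text \<open>The image of a union is the union of the images. Together with
  \<open>many_additive\<close> this makes having a large image an additive property of the
  source.\<close>

lemma additive_image:
  assumes "additive us \<Lambda>" "dp2 ts us R"
  shows "additive ts (\<lambda>Z. \<Lambda> {w \<in> tuples M us. \<exists>z\<in>tuples M ts. z \<in> Z \<and> R z w})"
  unfolding additive_def
proof (intro allI impI)
  fix ss X assume ss: "set ss \<subseteq> aux L" and X: "dp2 ss ts X"
    and *: "\<Lambda> {w \<in> tuples M us. \<exists>z\<in>tuples M ts. z \<in> {y \<in> tuples M ts. \<exists>s\<in>tuples M ss. X s y} \<and> R z w}"
  define X' where "X' s w \<longleftrightarrow> (\<exists>z\<in>tuples M ts. X s z \<and> R z w)" for s w
  have X': "dp2 ss us X'" unfolding dp2_def X'_def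
    by (rule defb_rules dp2_rule[OF X] dp2_rule[OF assms(2)] | simp)+
  have "{w \<in> tuples M us. \<exists>z\<in>tuples M ts. z \<in> {y \<in> tuples M ts. \<exists>s\<in>tuples M ss. X s y} \<and> R z w} =
    {w \<in> tuples M us. \<exists>s\<in>tuples M ss. X' s w}" by (auto simp: X'_def)
  then obtain s where "s \<in> tuples M ss" "\<Lambda> {w \<in> tuples M us. X' s w}"
    using additiveD[OF assms(1) ss X'] * by auto
  moreover have "{w \<in> tuples M us. X' s w} = {w \<in> tuples M us. \<exists>z\<in>tuples M ts. z \<in> {y \<in> tuples M ts. X s y} \<and> R z w}"
    by (auto simp: X'_def)
  ultimately show "\<exists>s\<in>tuples M ss. \<Lambda> {w \<in> tuples M us. \<exists>z\<in>tuples M ts. z \<in> {y \<in> tuples M ts. X s y} \<and> R z w}"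
    by auto
qed

text \<open>Induction along \<open>js\<close>: an existential quantifier commutes with unions, and
  \<open>big_Un\<close> handles bigness, applied to the sets of points whose fibres satisfy the
  remaining quantifiers.\<close>

lemma many_additive: "additive (replicate (length js) (main L)) (many js)"
proof (induction js)
  case Nil
  then show ?case by (auto simp: additive_def)
next
  case (Cons j js)
  let ?n = "length js"
  show ?case unfolding additive_def
  proof (intro allI impI)
    fix ss X assume ss: "set ss \<subseteq> aux L" and X: "dp2 ss (replicate (length (j # js)) (main L)) X"
      and q: "many (j # js) {y \<in> Mn (length (j # js)). \<exists>s\<in>tuples M ss. X s y}"
    define Z where "Z s x \<longleftrightarrow> many js {y \<in> Mn ?n. X s (x @ y)}" for s x
    have Z: "dp2 ss [main L] Z" unfolding dp2_def Z_def
      by (rule defb_many) (rule defb_rules dp2_rule[OF X] | simp)+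
    have step: "\<exists>s\<in>tuples M ss. Z s x"
      if x: "x \<in> M1" "many js {y \<in> Mn ?n. x @ y \<in> {y \<in> Mn (length (j # js)). \<exists>s\<in>tuples M ss. X s y}}" for x
    proof -
      have "dp2 ss (replicate ?n (main L)) (\<lambda>s y. X s (x @ y))" unfolding dp2_def
        by (rule defb_rules dp2_rule[OF X] dconst[OF x(1)] | simp)+
      moreover have "{y \<in> Mn ?n. x @ y \<in> {y \<in> Mn (length (j # js)). \<exists>s\<in>tuples M ss. X s y}} =
        {y \<in> Mn ?n. \<exists>s\<in>tuples M ss. X s (x @ y)}" using x(1) MnSuc by auto
      ultimately show ?thesis unfolding Z_def using additiveD[OF Cons ss] x(2) by simp
    qed
    have eq: "{y \<in> Mn ?n. x @ y \<in> {y \<in> Mn (length (j # js)). X s y}} = {y \<in> Mn ?n. X s (x @ y)}"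
      if "x \<in> M1" for x s using that MnSuc by auto
    show "\<exists>s\<in>tuples M ss. many (j # js) {y \<in> Mn (length (j # js)). X s y}"
    proof (cases "j = 0")
      case True
      then obtain x where "x \<in> M1" "many js {y \<in> Mn ?n. x @ y \<in> {y \<in> Mn (length (j # js)). \<exists>s\<in>tuples M ss. X s y}}"
        using q by auto
      with step obtain s where "s \<in> tuples M ss" "Z s x" by blast
      then have "many js {y \<in> Mn ?n. x @ y \<in> {y \<in> Mn (length (j # js)). X s y}}"
        using eq[OF \<open>x \<in> M1\<close>, of s] unfolding Z_def by (simp only:)
      then have "many (j # js) {y \<in> Mn (length (j # js)). X s y}" using True \<open>x \<in> M1\<close> unfolding many.simps by auto
      then show ?thesis using \<open>s \<in> tuples M ss\<close> by blast
    next
      case False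
      then have "big {x \<in> M1. \<exists>s\<in>tuples M ss. Z s x}"
        using q step by (auto elim!: big_mono)
      from big_Un[OF ss Z this] obtain s where "s \<in> tuples M ss" "big {x \<in> M1. Z s x}" by blast
      then show ?thesis using False eq unfolding Z_def by (auto cong: conj_cong)
    qed
  qed
qed

end

section \<open>Cells\<close>

text \<open>The positions of the coordinates in which a cell is big. For a type, their number is the
  sum that enters the dimension, by \<open>length_idx\<close>.\<close>

definition idx :: "nat list \<Rightarrow> nat list" where
  "idx js = filter (\<lambda>i. js ! i \<noteq> 0) [0..<length js]"

lemma idx_Nil [simp]: "idx [] = []" by (simp add: idx_def)

lemma idx_Cons: "idx (j # js) = (if j \<noteq> 0 then [0] else []) @ map Suc (idx js)"
proof -
  have "idx (j # js) = filter (\<lambda>i. (j # js) ! i \<noteq> 0) (0 # map Suc [0..<length js])"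
    by (simp add: idx_def map_Suc_upt upt_conv_Cons del: upt_Suc)
  then show ?thesis by (simp add: filter_map comp_def idx_def)
qed

lemma idx_lt: "set (idx js) \<subseteq> {..<length js}"
  by (auto simp: idx_def)

lemma length_idx: "set js \<subseteq> {0, 1} \<Longrightarrow> length (idx js) = sum_list js"
  by (induction js) (auto simp: idx_Cons)

lemma idx_snoc: "idx (js @ [j]) = idx js @ (if j \<noteq> 0 then [length js] else [])"
  by (auto simp: idx_def nth_append intro!: filter_cong)

lemma sel_Suc_Cons: "sel (map Suc is) (a # y) = sel is y"
  by (auto simp: sel_def)

lemma sel_Suc: "length x = Suc 0 \<Longrightarrow> sel (map Suc is) (x @ y) = sel is y"
  by (auto simp: sel_def nth_append)

context bmin
begin

text \<open>Cells all of whose presentations can be chosen constant.\<close>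

inductive unicell :: "nat list \<Rightarrow> 'u list set \<Rightarrow> bool" where
  Nil: "Df [] C \<Longrightarrow> unicell [] C"
| Snoc: "unicell js C' \<Longrightarrow> Df (ms (Suc (length js))) C \<Longrightarrow>
    (\<forall>y\<in>C'. \<exists>x\<in>M1. y @ x \<in> C) \<Longrightarrow> (\<forall>y\<in>Mn (length js). \<forall>x\<in>M1. y @ x \<in> C \<longrightarrow> y \<in> C') \<Longrightarrow>
    (j = 0 \<and> (\<forall>y\<in>C'. \<forall>x\<in>M1. \<forall>x'\<in>M1. y @ x \<in> C \<longrightarrow> y @ x' \<in> C \<longrightarrow> x = x')) \<or>
    (j = 1 \<and> (\<forall>y\<in>C'. \<exists>a\<in>tuples M (ball_params L). \<forall>x\<in>M1. y @ x \<in> C \<longleftrightarrow> a @ x \<in> rint M (ball L))) \<Longrightarrow>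
    unicell (js @ [j]) C"

lemma unicell_Df: "unicell js C \<Longrightarrow> Df (ms (length js)) C"
  by (induction rule: unicell.induct) auto

lemma unicell_sub: "unicell js C \<Longrightarrow> C \<subseteq> Mn (length js)"
  using unicell_Df definable_subset by blast

lemma Df_of_dp1: "dp1 ts X \<Longrightarrow> Df ts {z \<in> tuples M ts. X z}"
  unfolding dp1_def by (rule definable1)

text \<open>Induction on the number of coordinates, splitting off the last one. Cover the fibres
  over the first \<open>n\<close> coordinates by points and balls; additivity of \<Lambda> selects
  one index of the cover and one of the two kinds, and the induction hypothesis treats the
  base.\<close>

lemma ex_unicell:
  assumes "additive (ms n) \<Lambda>" "dp1 (ms n) X" "\<Lambda> {z \<in> Mn n. X z}"
  shows "\<exists>js C. length js = n \<and> unicell js C \<and> (\<forall>z\<in>C. X z) \<and> \<Lambda> C"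
  using assms
proof (induction n arbitrary: \<Lambda> X)
  case 0
  have "unicell [] {z \<in> Mn 0. X z}"
    by (rule unicell.Nil) (use Df_of_dp1[OF 0(2)] in simp)
  then show ?case using 0(3) by (intro exI[of _ "[]"] exI[of _ "{z \<in> Mn 0. X z}"]) auto
next
  case (Suc n)
  let ?n = "ms n" and ?m = "ms (Suc n)"
  have inj: "y @ x = y' @ x' \<longleftrightarrow> y = y' \<and> x = x'" if "y \<in> Mn n" "y' \<in> Mn n" for y y' x x'
    using that by (rule tuples_append_inject)
  have "dp2 ?n [main L] (\<lambda>y x. X (y @ x))" unfolding dp2_def
    by (rule defb_rules dp1_rule[OF Suc.prems(2)] | simp add: replicate_append_same)+
  then obtain ss H where H: "set ss \<subseteq> aux L" "dp3 ?n [main L] ss H"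
    "\<And>y x. y \<in> Mn n \<Longrightarrow> x \<in> M1 \<Longrightarrow> X (y @ x) \<longleftrightarrow> (\<exists>s\<in>tuples M ss. H y x s)"
    "\<And>y s. y \<in> Mn n \<Longrightarrow> s \<in> tuples M ss \<Longrightarrow> pt_or_ball L M {x \<in> M1. H y x s}"
    using cover_points_balls_pred by blast
  define X0 where "X0 s z \<longleftrightarrow> (\<exists>y\<in>Mn n. \<exists>x\<in>M1. z = y @ x \<and> H y x s)" for s z
  have X0: "dp2 ss ?m X0" unfolding dp2_def X0_def
    by (rule defb_rules dp3_rule[OF H(2)] | simp add: replicate_append_same)+
  have "X z \<longleftrightarrow> (\<exists>s\<in>tuples M ss. X0 s z)" if zn: "z \<in> Mn (Suc n)" for z
  proof -
    obtain y x where z: "z = y @ x" "y \<in> Mn n" "x \<in> M1" using zn by (rule MnSuc_right_cases)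
    then have "X0 s z \<longleftrightarrow> H y x s" for s unfolding X0_def using inj by blast
    then show ?thesis using H(3) z by simp
  qed
  then have "{z \<in> Mn (Suc n). X z} = {z \<in> Mn (Suc n). \<exists>s\<in>tuples M ss. X0 s z}" by blast
  \<comment> \<open>One index \<open>s\<close> is selected for all fibres at once, which is what
    makes a constant presentation possible.\<close>
  then obtain s where s: "s \<in> tuples M ss" "\<Lambda> {z \<in> Mn (Suc n). X0 s z}"
    using additiveD[OF Suc.prems(1) H(1) X0] Suc.prems(3) by auto
  \<comment> \<open>Over a base point whose piece is not cut out by a ball parameter, the piece has
    at most one element by the choice of the cover. So there are two kinds of base points, and
    additivity selects one kind.\<close>
  define isball where "isball y \<longleftrightarrow> (\<exists>a\<in>tuples M (ball_params L). \<forall>x\<in>M1. H y x s \<longleftrightarrow> a @ x \<in> rint M (ball L))" for y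
  have isball: "dp1 ?n isball" unfolding dp1_def isball_def
    by (rule defb_rules dp3_rule[OF H(2)] dconst[OF s(1)] Df_ball | simp)+
  define X1 where "X1 b z \<longleftrightarrow> (\<exists>y\<in>Mn n. \<exists>x\<in>M1. z = y @ x \<and> H y x s \<and> (isball y \<longleftrightarrow> b))" for b z
  have X1: "dp1 ?m (X1 b)" for b unfolding dp1_def X1_def
    by (rule defb_rules dp3_rule[OF H(2)] dp1_rule[OF isball] dconst[OF s(1)] | simp add: replicate_append_same)+
  have "{z \<in> Mn (Suc n). X0 s z} = {z \<in> Mn (Suc n). X1 True z \<or> X1 False z}"
    unfolding X0_def X1_def by blast
  with s(2) have "\<Lambda> {z \<in> Mn (Suc n). X1 True z \<or> X1 False z}" by (simp only:)
  from additive_or[OF Suc.prems(1) X1[of True] X1[of False] this]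
  obtain b where b: "\<Lambda> {z \<in> Mn (Suc n). X1 b z}" by (elim disjE) (rule that, assumption)+
  have X1_iff: "X1 b (y @ x) \<longleftrightarrow> H y x s \<and> (isball y \<longleftrightarrow> b)" if "y \<in> Mn n" "x \<in> M1" for y x
    using that inj unfolding X1_def by blast
  define R where "R y w \<longleftrightarrow> (\<exists>x\<in>M1. w = y @ x \<and> X1 b w)" for y w
  have R: "dp2 ?n ?m R" unfolding dp2_def R_def
    by (rule defb_rules dp1_rule[OF X1] | simp add: replicate_append_same)+
  \<comment> \<open>The property is moved to the base: a set of base points has it if the part of
    the piece above has \<Lambda>. The induction hypothesis may then shrink the base and \<Lambda>
    survives above it.\<close>
  define \<Lambda>' where "\<Lambda>' Z \<longleftrightarrow> \<Lambda> {w \<in> Mn (Suc n). \<exists>z\<in>Mn n. z \<in> Z \<and> R z w}" for Z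
  have \<Lambda>': "additive ?n \<Lambda>'" unfolding \<Lambda>'_def by (rule additive_image[OF Suc.prems(1) R])
  define X2 where "X2 y \<longleftrightarrow> (\<exists>x\<in>M1. X1 b (y @ x))" for y
  have X2: "dp1 ?n X2" unfolding dp1_def X2_def
    by (rule defb_rules dp1_rule[OF X1] | simp add: replicate_append_same)+
  have "(\<exists>z\<in>Mn n. z \<in> {y \<in> Mn n. X2 y} \<and> R z w) \<longleftrightarrow> X1 b w" if wn: "w \<in> Mn (Suc n)" for w
  proof -
    obtain y x where "w = y @ x" "y \<in> Mn n" "x \<in> M1" using wn by (rule MnSuc_right_cases)
    then show ?thesis unfolding X2_def R_def by blast
  qed
  then have "{w \<in> Mn (Suc n). \<exists>z\<in>Mn n. z \<in> {y \<in> Mn n. X2 y} \<and> R z w} = {w \<in> Mn (Suc n). X1 b w}" by blast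
  then have "\<Lambda>' {y \<in> Mn n. X2 y}" unfolding \<Lambda>'_def using b by simp
  from Suc.IH[OF \<Lambda>' X2 this] obtain js C' where C': "length js = n" "unicell js C'" "\<forall>z\<in>C'. X2 z" "\<Lambda>' C'"
    by blast
  define C where "C = {w \<in> Mn (Suc n). \<exists>z\<in>Mn n. z \<in> C' \<and> R z w}"
  have DC': "Df ?n C'" using unicell_Df[OF C'(2)] C'(1) by simp
  have DC: "Df ?m C" unfolding C_def
    by (rule definable1) (rule defb_rules dp2_rule[OF R] DC' | simp)+
  have C'_sub: "C' \<subseteq> Mn n" using DC' by (rule definable_subset)
  have C_iff: "y @ x \<in> C \<longleftrightarrow> y \<in> C' \<and> H y x s \<and> (isball y \<longleftrightarrow> b)" if "y \<in> Mn n" "x \<in> M1" for y x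
  proof -
    have "y @ x \<in> C \<longleftrightarrow> (\<exists>z\<in>Mn n. z \<in> C' \<and> R z (y @ x))"
      unfolding C_def using MnSuc_right[OF that(1)] that(2) by simp
    also have "\<dots> \<longleftrightarrow> y \<in> C' \<and> X1 b (y @ x)"
      unfolding R_def using that inj by blast
    finally show ?thesis using X1_iff[OF that] by simp
  qed
  let ?j = "if b then 1 else (0::nat)"
  have "unicell (js @ [?j]) C"
  proof (rule unicell.Snoc[OF C'(2)])
    show "Df (ms (Suc (length js))) C" using DC C'(1) by simp
    show "\<forall>y\<in>C'. \<exists>x\<in>M1. y @ x \<in> C"
      using C'(3) C'_sub C_iff X1_iff unfolding X2_def by blast
    show "\<forall>y\<in>Mn (length js). \<forall>x\<in>M1. y @ x \<in> C \<longrightarrow> y \<in> C'" using C_iff C'(1) by blast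
    show "(?j = 0 \<and> (\<forall>y\<in>C'. \<forall>x\<in>M1. \<forall>x'\<in>M1. y @ x \<in> C \<longrightarrow> y @ x' \<in> C \<longrightarrow> x = x')) \<or>
      (?j = 1 \<and> (\<forall>y\<in>C'. \<exists>a\<in>tuples M (ball_params L). \<forall>x\<in>M1. y @ x \<in> C \<longleftrightarrow> a @ x \<in> rint M (ball L)))"
    proof (cases b)
      case True
      have "\<exists>a\<in>tuples M (ball_params L). \<forall>x\<in>M1. y @ x \<in> C \<longleftrightarrow> a @ x \<in> rint M (ball L)" if y: "y \<in> C'" for y
      proof -
        have yn: "y \<in> Mn n" using y C'_sub by blast
        have "isball y" using y C'(3) X1_iff[OF yn] True unfolding X2_def by blast
        then obtain a where "a \<in> tuples M (ball_params L)" "\<forall>x\<in>M1. H y x s \<longleftrightarrow> a @ x \<in> rint M (ball L)"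
          unfolding isball_def by blast
        then show ?thesis using C_iff[OF yn] y True \<open>isball y\<close> by (intro bexI[of _ a]) auto
      qed
      then show ?thesis using True by simp
    next
      case False
      have "x = x'" if y: "y \<in> C'" "x \<in> M1" "x' \<in> M1" "y @ x \<in> C" "y @ x' \<in> C" for y x x'
      proof -
        have yn: "y \<in> Mn n" using y C'_sub by blast
        have "\<not> isball y" "H y x s" "H y x' s" using C_iff[OF yn] y False by auto
        then show ?thesis using H(4)[OF yn s(1)] y(2,3) unfolding pt_or_ball_def isball_def by blast
      qed
      then show ?thesis using False by simp
    qed
  qed
  moreover have "\<forall>z\<in>C. X z"
  proof
    fix z assume z: "z \<in> C"
    then have "z \<in> Mn (Suc n)" by (simp add: C_def)
    then obtain y x where "z = y @ x" "y \<in> Mn n" "x \<in> M1" by (rule MnSuc_right_cases)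
    then show "X z" using z C_iff[of y x] H(3)[of y x] s(1) by blast
  qed
  moreover have "\<Lambda> C" using C'(4) unfolding \<Lambda>'_def C_def .
  ultimately show ?case using C'(1) by (intro exI[of _ "js @ [?j]"] exI[of _ C]) auto
qed

lemma dmap_const: "Df ts C \<Longrightarrow> definable_map L M (elems M) ts C [] {[]} (\<lambda>_. [])"
proof -
  assume C: "Df ts C"
  have "Df [] (rel1 M [] (\<lambda>x. True))" by (rule definable_rel1) (rule defb_const)
  moreover have "rel1 M [] (\<lambda>x. True) = {[]}" by auto
  ultimately show ?thesis using C by (auto simp: definable_map_def)
qed

lemma cell1:
  assumes "Df [main L] D"
    and "(j = 0 \<and> (\<forall>x\<in>D. \<forall>x'\<in>D. x = x')) \<or>
      (j = 1 \<and> (\<exists>a\<in>tuples M (ball_params L). \<forall>x\<in>M1. x \<in> D \<longleftrightarrow> a @ x \<in> rint M (ball L)))"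
  shows "cell L M [j] D [] {[]} (\<lambda>_. [])"
  using assms(2)
proof
  assume j: "j = 0 \<and> (\<forall>x\<in>D. \<forall>x'\<in>D. x = x')"
  then have "\<forall>s\<in>(\<lambda>_. []) ` D. is_point (fiber (\<lambda>_. []) D s)"
    by (auto simp: is_point_def fiber_def)
  then show ?thesis using j cell.Zero[of "[]" L M D "{[]}" "\<lambda>_. []"] dmap_const[OF assms(1)] by simp
next
  assume j: "j = 1 \<and> (\<exists>a\<in>tuples M (ball_params L). \<forall>x\<in>M1. x \<in> D \<longleftrightarrow> a @ x \<in> rint M (ball L))"
  then obtain a where a: "a \<in> tuples M (ball_params L)" "\<forall>x\<in>M1. x \<in> D \<longleftrightarrow> a @ x \<in> rint M (ball L)" by blast
  have "D \<subseteq> M1" using assms(1) by (rule definable_subset)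
  then have "D = {x \<in> M1. a @ x \<in> rint M (ball L)}" using a(2) by blast
  then have "\<forall>s\<in>(\<lambda>_. []) ` D. is_ball L M (fiber (\<lambda>_. []) D s)"
    using a(1) by (auto simp: is_ball_iff[OF str] fiber_def)
  then show ?thesis using j cell.One[of "[]" L M D "{[]}" "\<lambda>_. []"] dmap_const[OF assms(1)] by simp
qed

lemma unicell_cell: "unicell js C \<Longrightarrow> cell L M js C [] {[]} (\<lambda>_. [])"
proof (induction rule: unicell.induct)
  case (Nil C)
  then show ?case by (intro cell.Nil dmap_const) auto
next
  case (Snoc js C' C j)
  let ?n = "length js"
  have C_sub: "C \<subseteq> Mn (Suc ?n)" using Snoc(2) by (rule definable_subset)
  have C'_sub: "C' \<subseteq> Mn ?n" using Snoc(1) by (rule unicell_sub)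
  have fib: "cell L M [j] {x \<in> M1. y @ x \<in> C} [] {[]} (\<lambda>_. [])" if y: "y \<in> C'" for y
  proof (rule cell1)
    have "y \<in> Mn ?n" using y C'_sub by blast
    then show "Df [main L] {x \<in> M1. y @ x \<in> C}"
      by (intro definable1) (rule defb_rules dconst Snoc(2) | simp add: replicate_append_same)+
    show "(j = 0 \<and> (\<forall>x\<in>{x \<in> M1. y @ x \<in> C}. \<forall>x'\<in>{x \<in> M1. y @ x \<in> C}. x = x')) \<or>
      (j = 1 \<and> (\<exists>a\<in>tuples M (ball_params L). \<forall>x\<in>M1. x \<in> {x \<in> M1. y @ x \<in> C} \<longleftrightarrow> a @ x \<in> rint M (ball L)))"
      using Snoc(5) y by auto
  qed
  have fib_eq: "{[m] |m. y @ [m] \<in> C} = {x \<in> M1. y @ x \<in> C}" if "y \<in> C'" for y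
  proof -
    have "[m] \<in> M1" if "y @ [m] \<in> C" for m
      using C_sub C'_sub that \<open>y \<in> C'\<close> MnSuc_right[of y ?n "[m]"] by blast
    then show ?thesis by (auto simp: tuples1)
  qed
  have bl: "butlast ` C = C'"
  proof (intro equalityI subsetI)
    fix y assume "y \<in> butlast ` C"
    then obtain z where z: "z \<in> C" "y = butlast z" by blast
    then have "z \<in> Mn (Suc ?n)" using C_sub by blast
    then obtain y' x where "z = y' @ x" "y' \<in> Mn ?n" "x \<in> M1" by (rule MnSuc_right_cases)
    then show "y \<in> C'" using z Snoc(4) by (auto simp: tuples1)
  next
    fix y assume "y \<in> C'"
    then obtain x where "x \<in> M1" "y @ x \<in> C" using Snoc(3) by blast
    then show "y \<in> butlast ` C" by (intro image_eqI[of _ _ "y @ x"]) (auto simp: tuples1)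
  qed
  show ?case
  proof (cases "js = []")
    \<comment> \<open>\<open>cell.Step\<close> begins with two coordinates. For one coordinate the
      base is a subset of the one-point power, possibly empty, and the cell is built
      directly.\<close>
    case True
    show ?thesis
    proof (cases "[] \<in> C'")
      case True
      have "{x \<in> M1. [] @ x \<in> C} = C" using C_sub \<open>js = []\<close> by auto
      then show ?thesis using fib[OF True] \<open>js = []\<close> by simp
    next
      case False
      then have "C = {}" using C'_sub Snoc(4) C_sub True by auto
      moreover have "definable_map L M (elems M) [main L] {} [] {[]} (\<lambda>_. [])"
        using dmap_const[OF Snoc(2)] True \<open>C = {}\<close> by simp
      then have "cell L M [j] {} [] {[]} (\<lambda>_. [])"
        using Snoc(5) cell.Zero[of "[]" L M "{}" "{[]}" "\<lambda>_. []"] cell.One[of "[]" L M "{}" "{[]}" "\<lambda>_. []"]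
        by auto
      ultimately show ?thesis using True by simp
    qed
  next
    case False
    show ?thesis
    proof (rule cell.Step[OF False, where ss' = "[]" and S' = "{[]}" and h' = "\<lambda>_. []" and q = "\<lambda>_. []"])
      show "definable_map L M (elems M) (ms (length js + 1)) C [] {[]} (\<lambda>_. [])"
        using dmap_const[OF Snoc(2)] by simp
      show "\<forall>y\<in>butlast ` C. cell L M [j] {[m] |m. y @ [m] \<in> C} [] {[]} (\<lambda>z. [])"
        unfolding bl using fib fib_eq by simp
      show "cell L M js (butlast ` C) [] {[]} (\<lambda>_. [])" unfolding bl by (rule Snoc.IH)
      have "Df [] {[]}" using dmap_const[OF Snoc(2)] by (simp add: definable_map_def)
      then show "definable_map L M (elems M) [] {[]} [] {[]} (\<lambda>_. [])" by (rule dmap_const)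
    qed auto
  qed
qed

text \<open>A nonempty set all of whose nonempty fibres are balls contains a ball, so it is big
  whatever the presentation. Cells iterate this along the coordinates, and
  \<open>many_append\<close> puts the last quantifier inside.\<close>

lemma cell_many:
  assumes "cell L M js X ss S h"
  shows "X \<subseteq> Mn (length js) \<and> (X \<noteq> {} \<longrightarrow> many js X \<and> set js \<subseteq> {0, 1})"
  using assms
proof (induction rule: cell.induct)
  case (Nil ss X S h)
  then have "X \<subseteq> tuples M []" using definable_subset unfolding definable_map_def by blast
  then show ?case by auto
next
  case (Zero ss X S h)
  then have "X \<subseteq> M1" using definable_subset unfolding definable_map_def by blast
  then show ?case by auto
next
  case (One ss X S h)
  then have X: "X \<subseteq> M1" using definable_subset unfolding definable_map_def by blast
  have "big X" if "x \<in> X" for x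
  proof -
    have "is_ball L M (fiber h X (h x))" using One(3) that by blast
    then have "big (fiber h X (h x))" unfolding is_ball_iff[OF str] big_def by blast
    then show ?thesis by (rule big_mono) (auto simp: fiber_def)
  qed
  moreover have "{x \<in> M1. x \<in> X} = X" using X by blast
  ultimately show ?case using X by auto
next
  case (Step js ss X S h j ss' S' h' q)
  let ?n = "length js"
  have X: "X \<subseteq> Mn (Suc ?n)" using Step(3) definable_subset unfolding definable_map_def by auto
  have fib: "{[m] |m. y @ [m] \<in> X} \<noteq> {}" if "y \<in> butlast ` X" for y
  proof -
    obtain z where z: "z \<in> X" "y = butlast z" using \<open>y \<in> butlast ` X\<close> by blast
    then have "z \<in> Mn (Suc ?n)" using X by blast
    then have "z \<noteq> []" by (auto simp: tuples_Cons)
    then have "y @ [last z] \<in> X" using z by simp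
    then show ?thesis by blast
  qed
  have Qf: "many [j] {[m] |m. y @ [m] \<in> X} \<and> set [j] \<subseteq> {0, 1}" if y: "y \<in> butlast ` X" for y
    using Step.IH Step.hyps fib[OF y] y by blast
  have IH: "butlast ` X \<subseteq> Mn ?n" "butlast ` X \<noteq> {} \<Longrightarrow> many js (butlast ` X) \<and> set js \<subseteq> {0, 1}"
    using Step.IH by blast+
  have "many (js @ [j]) X" if "X \<noteq> {}"
    unfolding many_append
  proof (rule many_mono)
    show "many js (butlast ` X)" using IH(2) that by blast
    fix y assume y: "y \<in> Mn ?n" "y \<in> butlast ` X"
    have "many [j] {z \<in> Mn (length [j]). y @ z \<in> X}"
      using Qf[OF y(2), THEN conjunct1] by (rule many_mono) auto
    then show "y \<in> {y \<in> Mn ?n. many [j] {z \<in> Mn (length [j]). y @ z \<in> X}}" using y(1) by blast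
  qed
  moreover have "set (js @ [j]) \<subseteq> {0, 1}" if "X \<noteq> {}"
    using that Qf IH(2) by auto
  ultimately show ?case using X by simp
qed

text \<open>A coordinate quantified by mere existence can be replaced by a witness depending on the
  earlier ones and then forgotten; the remaining quantifiers all express bigness.\<close>

lemma many_proj:
  "many js X \<Longrightarrow> many (replicate (length (idx js)) 1)
    {w \<in> Mn (length (idx js)). \<exists>z\<in>Mn (length js). z \<in> X \<and> w = sel (idx js) z}"
proof (induction js arbitrary: X)
  case (Cons j js)
  let ?n = "length js" and ?e = "length (idx js)"
  let ?W = "\<lambda>x. {w \<in> Mn ?e. \<exists>y\<in>Mn ?n. y \<in> {y \<in> Mn ?n. x @ y \<in> X} \<and> w = sel (idx js) y}"
  let ?V = "{w \<in> Mn (length (idx (j # js))). \<exists>z\<in>Mn (length (j # js)). z \<in> X \<and> w = sel (idx (j # js)) z}"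
  show ?case
  proof (cases "j = 0")
    case True
    then obtain x where x: "x \<in> M1" "many js {y \<in> Mn ?n. x @ y \<in> X}" using Cons.prems by auto
    have l: "length x = Suc 0" using x(1) by (auto simp: tuples1)
    have "many (replicate ?e 1) ?V"
    proof (rule many_mono[OF Cons.IH[OF x(2)]])
      fix w assume "w \<in> Mn (length (replicate ?e 1))" "w \<in> ?W x"
      then obtain y where y: "y \<in> Mn ?n" "x @ y \<in> X" "w = sel (idx js) y" "w \<in> Mn ?e" by blast
      then have "x @ y \<in> Mn (length (j # js))" "w = sel (idx (j # js)) (x @ y)"
        using MnSuc[OF x(1)] True l by (auto simp: idx_Cons sel_Suc)
      then show "w \<in> ?V" using y True by (auto simp: idx_Cons)
    qed
    then show ?thesis using True by (simp add: idx_Cons)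
  next
    case False
    then have "big {x \<in> M1. many js {y \<in> Mn ?n. x @ y \<in> X}}" using Cons.prems by simp
    then have "big {x \<in> M1. many (replicate ?e 1) {w \<in> Mn ?e. x @ w \<in> ?V}}"
    proof (rule big_mono)
      fix x assume x: "x \<in> M1" "x \<in> {x \<in> M1. many js {y \<in> Mn ?n. x @ y \<in> X}}"
      then have q: "many js {y \<in> Mn ?n. x @ y \<in> X}" by blast
      have l: "length x = Suc 0" using x(1) by (auto simp: tuples1)
      have "many (replicate ?e 1) {w \<in> Mn ?e. x @ w \<in> ?V}"
      proof (rule many_mono[OF Cons.IH[OF q]])
        fix w assume "w \<in> Mn (length (replicate ?e 1))" "w \<in> ?W x"
        then obtain y where y: "y \<in> Mn ?n" "x @ y \<in> X" "w = sel (idx js) y" "w \<in> Mn ?e" by blast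
        have "x @ y \<in> Mn (length (j # js))" using y(1) MnSuc[OF x(1)] by simp
        moreover have "x @ w = sel (idx (j # js)) (x @ y)"
          using False l y(3) by (cases x) (auto simp: idx_Cons sel_append sel_Suc_Cons)
        moreover have "x @ w \<in> Mn (length (idx (j # js)))"
          using False y(4) MnSuc[OF x(1)] by (simp add: idx_Cons)
        ultimately show "w \<in> {w \<in> Mn ?e. x @ w \<in> ?V}" using y by blast
      qed
      then show "x \<in> {x \<in> M1. many (replicate ?e 1) {w \<in> Mn ?e. x @ w \<in> ?V}}" using x(1) by blast
    qed
    then show ?thesis using False by (simp add: idx_Cons)
  qed
qed simp

section \<open>The exchange argument\<close>

lemma many1_additive: "additive (ms e) (many (replicate e 1))"
  using many_additive[of "replicate e 1"] by simp

text \<open>\<open>R\<close> is a partial map from pairs \<open>(y, z)\<close> to pairs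
  \<open>(c, w)\<close>, and \<open>c\<close> depends on \<open>y\<close> alone. Induction on the
  length \<open>k\<close> of \<open>y\<close>: by (b3) one may assume that \<open>c\<close>, as a
  function of the last coordinate \<open>x\<close> of \<open>y\<close>, is injective or constant on
  the selected pieces. If injective, \<open>x\<close> is exchanged for \<open>c\<close>; if
  constant, \<open>x\<close> joins \<open>z\<close>, which leaves \<open>k + r\<close> unchanged and
  reduces the number of coordinates on which \<open>c\<close> depends.\<close>

lemma onto_dim_le_step:
  assumes IH: "\<And>d R. dp2 (ms d) (ms e) R \<Longrightarrow>
      (\<And>z w w'. z \<in> Mn d \<Longrightarrow> w \<in> Mn e \<Longrightarrow> w' \<in> Mn e \<Longrightarrow> R z w \<Longrightarrow> R z w' \<Longrightarrow> w = w') \<Longrightarrow>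
      many (replicate e 1) {w \<in> Mn e. \<exists>z\<in>Mn d. R z w} \<Longrightarrow> e \<le> d"
  shows "dp4 (ms k) (ms r) [main L] (ms e) R \<Longrightarrow>
    (\<And>y z c c' w w'. y \<in> Mn k \<Longrightarrow> z \<in> Mn r \<Longrightarrow> c \<in> M1 \<Longrightarrow> c' \<in> M1 \<Longrightarrow> w \<in> Mn e \<Longrightarrow> w' \<in> Mn e \<Longrightarrow>
      R y z c w \<Longrightarrow> R y z c' w' \<Longrightarrow> c = c' \<and> w = w') \<Longrightarrow>
    (\<And>y z z' c c' w w'. y \<in> Mn k \<Longrightarrow> z \<in> Mn r \<Longrightarrow> z' \<in> Mn r \<Longrightarrow> c \<in> M1 \<Longrightarrow> c' \<in> M1 \<Longrightarrow> w \<in> Mn e \<Longrightarrow>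
      w' \<in> Mn e \<Longrightarrow> R y z c w \<Longrightarrow> R y z' c' w' \<Longrightarrow> c = c') \<Longrightarrow>
    many (replicate (Suc e) 1) {v \<in> Mn (Suc e). \<exists>y\<in>Mn k. \<exists>z\<in>Mn r. \<exists>c\<in>M1. \<exists>w\<in>Mn e. v = c @ w \<and> R y z c w} \<Longrightarrow>
    Suc e \<le> k + r"
proof (induction k arbitrary: r R)
  case 0
  let ?V = "{v \<in> Mn (Suc e). \<exists>y\<in>Mn 0. \<exists>z\<in>Mn r. \<exists>c\<in>M1. \<exists>w\<in>Mn e. v = c @ w \<and> R y z c w}"
  have V: "\<exists>z\<in>Mn r. \<exists>w\<in>Mn e. R [] z c w" if c: "c \<in> M1" "many (replicate e 1) {w \<in> Mn e. c @ w \<in> ?V}" for c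
  proof -
    obtain w where "w \<in> Mn e" "c @ w \<in> ?V" using many_ne[OF c(2)] by blast
    then obtain y z c' w' where *: "y \<in> Mn 0" "z \<in> Mn r" "c' \<in> M1" "w' \<in> Mn e" "c @ w = c' @ w'" "R y z c' w'"
      by blast
    then have "c' = c" using tuples_append_inject[OF c(1), of c' w w'] by simp
    then show ?thesis using * by auto
  qed
  \<comment> \<open>With no coordinate left to depend on, \<open>c\<close> has at most one
    value.\<close>
  have "\<not> big {c \<in> M1. many (replicate e 1) {w \<in> Mn e. c @ w \<in> ?V}}"
  proof (rule singleton_not_big)
    fix c c' assume "c \<in> M1" "c' \<in> M1" "c \<in> {c \<in> M1. many (replicate e 1) {w \<in> Mn e. c @ w \<in> ?V}}"
      "c' \<in> {c \<in> M1. many (replicate e 1) {w \<in> Mn e. c @ w \<in> ?V}}"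
    then show "c = c'" using V[of c] V[of c'] 0(3)[of "[]"] by auto
  qed
  moreover have "big {c \<in> M1. many (replicate e 1) {w \<in> Mn e. c @ w \<in> ?V}}"
    using 0(4) by simp
  ultimately show ?case by blast
next
  case (Suc k)
  let ?k = "ms k" and ?r = "ms r" and ?e = "ms e"
  define F where "F y x c \<longleftrightarrow> (\<exists>z\<in>Mn r. \<exists>w\<in>Mn e. R (y @ x) z c w)" for y x c
  have F: "dp3 ?k [main L] [main L] F" unfolding dp3_def F_def
    by (rule defb_rules dp4_rule[OF Suc.prems(1)] | simp add: replicate_append_same)+
  have yx: "y @ x \<in> Mn (Suc k)" if "y \<in> Mn k" "x \<in> M1" for y x
    using that MnSuc_right by simp
  have Ffun: "c = c'" if "y \<in> Mn k" "x \<in> M1" "c \<in> M1" "c' \<in> M1" "F y x c" "F y x c'" for y x c c'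
    using that(5,6) Suc.prems(3)[OF yx[OF that(1,2)]] that(3,4) unfolding F_def by blast
  obtain ss H where H: "set ss \<subseteq> aux L" "dp3 ?k [main L] ss H"
    "\<And>y x. y \<in> Mn k \<Longrightarrow> x \<in> M1 \<Longrightarrow> (\<exists>c\<in>M1. F y x c) \<longleftrightarrow> (\<exists>s\<in>tuples M ss. H y x s)"
    "\<And>y s. y \<in> Mn k \<Longrightarrow> s \<in> tuples M ss \<Longrightarrow>
      (\<forall>x\<in>M1. \<forall>x'\<in>M1. \<forall>c\<in>M1. H y x s \<longrightarrow> H y x' s \<longrightarrow> F y x c \<longrightarrow> F y x' c \<longrightarrow> x = x') \<or>
      (\<forall>x\<in>M1. \<forall>x'\<in>M1. \<forall>c\<in>M1. \<forall>c'\<in>M1. H y x s \<longrightarrow> H y x' s \<longrightarrow> F y x c \<longrightarrow> F y x' c' \<longrightarrow> c = c')"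
    by (rule cover_inj_const_pred[OF F], rule Ffun, assumption+, rule that)
  define X where "X s v \<longleftrightarrow> (\<exists>y\<in>Mn k. \<exists>x\<in>M1. \<exists>z\<in>Mn r. \<exists>c\<in>M1. \<exists>w\<in>Mn e. v = c @ w \<and> R (y @ x) z c w \<and> H y x s)" for s v
  have X: "dp2 ss (ms (Suc e)) X" unfolding dp2_def X_def
    by (rule defb_rules dp4_rule[OF Suc.prems(1)] dp3_rule[OF H(2)] | simp add: replicate_append_same)+
  let ?V = "{v \<in> Mn (Suc e). \<exists>y\<in>Mn (Suc k). \<exists>z\<in>Mn r. \<exists>c\<in>M1. \<exists>w\<in>Mn e. v = c @ w \<and> R y z c w}"
  have "many (replicate (Suc e) 1) {v \<in> Mn (Suc e). \<exists>s\<in>tuples M ss. X s v}"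
  proof (rule many_mono[OF Suc.prems(4)])
    fix v assume "v \<in> ?V"
    then obtain u z c w where v: "v \<in> Mn (Suc e)" "u \<in> Mn (Suc k)" "z \<in> Mn r" "c \<in> M1" "w \<in> Mn e" "v = c @ w" "R u z c w"
      by blast
    obtain y x where u: "u = y @ x" "y \<in> Mn k" "x \<in> M1" using v(2) by (rule MnSuc_right_cases)
    then have "\<exists>c\<in>M1. F y x c" unfolding F_def using v by blast
    then obtain s where "s \<in> tuples M ss" "H y x s" using H(3) u by blast
    then show "v \<in> {v \<in> Mn (Suc e). \<exists>s\<in>tuples M ss. X s v}" unfolding X_def using v u by blast
  qed
  then obtain s where s: "s \<in> tuples M ss" "many (replicate (Suc e) 1) {v \<in> Mn (Suc e). X s v}"
    using additiveD[OF many1_additive H(1) X] by blast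
  define inj where "inj y \<longleftrightarrow> (\<forall>x\<in>M1. \<forall>x'\<in>M1. \<forall>c\<in>M1. H y x s \<longrightarrow> H y x' s \<longrightarrow> F y x c \<longrightarrow> F y x' c \<longrightarrow> x = x')" for y
  have inj: "dp1 ?k inj" unfolding dp1_def inj_def
    by (rule defb_rules dp3_rule[OF F] dp3_rule[OF H(2)] dconst[OF s(1)] | simp)+
  define Z where "Z b v \<longleftrightarrow> (\<exists>y\<in>Mn k. \<exists>x\<in>M1. \<exists>z\<in>Mn r. \<exists>c\<in>M1. \<exists>w\<in>Mn e.
    v = c @ w \<and> R (y @ x) z c w \<and> H y x s \<and> (inj y \<longleftrightarrow> b))" for b v
  have Z: "dp1 (ms (Suc e)) (Z b)" for b unfolding dp1_def Z_def
    by (rule defb_rules dp4_rule[OF Suc.prems(1)] dp3_rule[OF H(2)] dp1_rule[OF inj] dconst[OF s(1)]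
        | simp add: replicate_append_same)+
  have "{v \<in> Mn (Suc e). X s v} = {v \<in> Mn (Suc e). Z True v \<or> Z False v}"
    unfolding X_def Z_def by blast
  with s(2) have "many (replicate (Suc e) 1) {v \<in> Mn (Suc e). Z True v \<or> Z False v}" by (simp only:)
  from additive_or[OF many1_additive Z[of True] Z[of False] this] show ?case
  proof
    assume "many (replicate (Suc e) 1) {v \<in> Mn (Suc e). Z True v}"
    \<comment> \<open>Injective case. Once the value \<open>c0\<close> is fixed, \<open>y\<close>
      determines \<open>x\<close>, so \<open>k + r\<close> coordinates map onto a set that is big in
      the remaining \<open>e\<close> coordinates; \<open>IH\<close> gives the bound for
      \<open>e\<close>, and \<open>x\<close> and \<open>c\<close> account for one more on either
      side.\<close>
    then obtain c0 where c0: "c0 \<in> M1" "many (replicate e 1) {w \<in> Mn e. c0 @ w \<in> {v \<in> Mn (Suc e). Z True v}}"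
      by (auto dest!: big_ne)
    define R' where "R' u w \<longleftrightarrow> (\<exists>y\<in>Mn k. \<exists>z\<in>Mn r. \<exists>x\<in>M1. u = y @ z \<and> R (y @ x) z c0 w \<and> H y x s \<and> inj y)" for u w
    have "dp2 (ms (k + r)) ?e R'" unfolding dp2_def R'_def
      by (rule defb_rules dp4_rule[OF Suc.prems(1)] dp3_rule[OF H(2)] dp1_rule[OF inj] dconst[OF s(1)] dconst[OF c0(1)]
          | simp add: replicate_append_same replicate_add)+
    then have "e \<le> k + r"
    proof (rule IH)
      fix u w w' assume w: "w \<in> Mn e" "w' \<in> Mn e" "R' u w" "R' u w'"
      then obtain y z x y' z' x' where *: "y \<in> Mn k" "z \<in> Mn r" "x \<in> M1" "u = y @ z" "R (y @ x) z c0 w" "H y x s" "inj y"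
        "y' \<in> Mn k" "z' \<in> Mn r" "x' \<in> M1" "u = y' @ z'" "R (y' @ x') z' c0 w'" "H y' x' s"
        unfolding R'_def by blast
      have yz: "y' = y" "z' = z" using tuples_append_inject[OF *(1,8), of z z'] * by auto
      have "F y x c0" "F y x' c0" unfolding F_def using * w yz by blast+
      then have "x = x'" using *(7) * yz c0(1) unfolding inj_def by blast
      then show "w = w'" using Suc.prems(2)[OF yx[OF *(1,3)] *(2) c0(1) c0(1) w(1,2)] * yz by simp
    next
      show "many (replicate e 1) {w \<in> Mn e. \<exists>z\<in>Mn (k + r). R' z w}"
      proof (rule many_mono[OF c0(2)])
        fix w assume w: "w \<in> Mn (length (replicate e 1))" "w \<in> {w \<in> Mn e. c0 @ w \<in> {v \<in> Mn (Suc e). Z True v}}"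
        then obtain y x z c w' where *: "y \<in> Mn k" "x \<in> M1" "z \<in> Mn r" "c \<in> M1" "w' \<in> Mn e" "c0 @ w = c @ w'"
          "R (y @ x) z c w'" "H y x s" "inj y" unfolding Z_def by blast
        then have "c = c0" "w' = w" using tuples_append_inject[OF c0(1) *(4), of w w'] by auto
        then have "R' (y @ z) w" unfolding R'_def using * by blast
        moreover have "y @ z \<in> Mn (k + r)" using * by (simp add: replicate_add tuples_appendI)
        ultimately show "w \<in> {w \<in> Mn e. \<exists>z\<in>Mn (k + r). R' z w}" using w by auto
      qed
    qed
    then show ?thesis by simp
  next
    assume q: "many (replicate (Suc e) 1) {v \<in> Mn (Suc e). Z False v}"
    \<comment> \<open>Constant case. Now \<open>c\<close> is determined by \<open>y\<close> without
      \<open>x\<close>, so \<open>x\<close> is moved to the front of \<open>z\<close>.\<close>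
    define R' where "R' y u c w \<longleftrightarrow> (\<exists>x\<in>M1. \<exists>z\<in>Mn r. u = x @ z \<and> R (y @ x) z c w \<and> H y x s \<and> \<not> inj y)" for y u c w
    have "dp4 ?k (ms (Suc r)) [main L] ?e R'" unfolding dp4_def R'_def
      by (rule defb_rules dp4_rule[OF Suc.prems(1)] dp3_rule[OF H(2)] dp1_rule[OF inj] dconst[OF s(1)]
          | simp add: replicate_append_same)+
    then have "Suc e \<le> k + Suc r"
    proof (rule Suc.IH)
      fix y u c c' w w' assume a: "y \<in> Mn k" "u \<in> Mn (Suc r)" "c \<in> M1" "c' \<in> M1" "w \<in> Mn e" "w' \<in> Mn e"
        "R' y u c w" "R' y u c' w'"
      then obtain x z x' z' where *: "x \<in> M1" "z \<in> Mn r" "u = x @ z" "R (y @ x) z c w"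
        "x' \<in> M1" "z' \<in> Mn r" "u = x' @ z'" "R (y @ x') z' c' w'" unfolding R'_def by blast
      have "x' = x" "z' = z" using tuples_append_inject[OF *(1,5), of z z'] * by auto
      then show "c = c' \<and> w = w'" using Suc.prems(2)[OF yx[OF a(1) *(1)] *(2) a(3-6)] * by simp
    next
      fix y u u' c c' w w' assume a: "y \<in> Mn k" "u \<in> Mn (Suc r)" "u' \<in> Mn (Suc r)" "c \<in> M1" "c' \<in> M1" "w \<in> Mn e" "w' \<in> Mn e"
        "R' y u c w" "R' y u' c' w'"
      then obtain x z x' z' where *: "x \<in> M1" "z \<in> Mn r" "u = x @ z" "R (y @ x) z c w" "H y x s" "\<not> inj y"
        "x' \<in> M1" "z' \<in> Mn r" "u' = x' @ z'" "R (y @ x') z' c' w'" "H y x' s" unfolding R'_def by blast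
      have "F y x c" "F y x' c'" unfolding F_def using * a by blast+
      then show "c = c'" using H(4)[OF a(1) s(1)] *(6) * a unfolding inj_def by blast
    next
      show "many (replicate (Suc e) 1) {v \<in> Mn (Suc e). \<exists>y\<in>Mn k. \<exists>u\<in>Mn (Suc r). \<exists>c\<in>M1. \<exists>w\<in>Mn e. v = c @ w \<and> R' y u c w}"
      proof (rule many_mono[OF q])
        fix v assume "v \<in> {v \<in> Mn (Suc e). Z False v}"
        then obtain y x z c w where *: "v \<in> Mn (Suc e)" "y \<in> Mn k" "x \<in> M1" "z \<in> Mn r" "c \<in> M1" "w \<in> Mn e" "v = c @ w"
          "R (y @ x) z c w" "H y x s" "\<not> inj y" unfolding Z_def by blast
        then have "R' y (x @ z) c w" "x @ z \<in> Mn (Suc r)" unfolding R'_def using MnSuc by blast+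
        then show "v \<in> {v \<in> Mn (Suc e). \<exists>y\<in>Mn k. \<exists>u\<in>Mn (Suc r). \<exists>c\<in>M1. \<exists>w\<in>Mn e. v = c @ w \<and> R' y u c w}"
          using * by blast
      qed
    qed
    then show ?thesis by simp
  qed
qed

text \<open>Peel off the first target coordinate \<open>c\<close>. At the start it may depend on all
  source coordinates, so the exchange step is entered with \<open>k\<close> equal to
  \<open>d\<close> and \<open>r\<close> equal to 0.\<close>

lemma onto_dim_le:
  "dp2 (ms d) (ms e) R \<Longrightarrow>
    (\<And>z w w'. z \<in> Mn d \<Longrightarrow> w \<in> Mn e \<Longrightarrow> w' \<in> Mn e \<Longrightarrow> R z w \<Longrightarrow> R z w' \<Longrightarrow> w = w') \<Longrightarrow>
    many (replicate e 1) {w \<in> Mn e. \<exists>z\<in>Mn d. R z w} \<Longrightarrow> e \<le> d"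
proof (induction e arbitrary: d R)
  case (Suc e)
  define R' where "R' y (z :: 'u list) c w \<longleftrightarrow> R y (c @ w)" for y z c w
  have "dp4 (ms d) (ms 0) [main L] (ms e) R'"
    unfolding dp4_def R'_def
    by (rule defb_rules dp2_rule[OF Suc.prems(1)] | simp)+
  note D4 = this
  have "Suc e \<le> d + 0"
  proof (rule onto_dim_le_step[OF _ D4])
    fix d' R''
    assume "dp2 (ms d') (ms e) R''"
      "\<And>z w w'. z \<in> Mn d' \<Longrightarrow> w \<in> Mn e \<Longrightarrow> w' \<in> Mn e \<Longrightarrow> R'' z w \<Longrightarrow> R'' z w' \<Longrightarrow> w = w'"
      "many (replicate e 1) {w \<in> Mn e. \<exists>z\<in>Mn d'. R'' z w}"
    then show "e \<le> d'" by (rule Suc.IH)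
  next
    show c: "c = c' \<and> w = w'" if "y \<in> Mn d" "c \<in> M1" "c' \<in> M1" "w \<in> Mn e" "w' \<in> Mn e" "R' y z c w" "R' y z' c' w'"
      for y z z' c c' w w'
      using Suc.prems(2)[of y "c @ w" "c' @ w'"] that MnSuc[of c] MnSuc[of c'] tuples_append_inject[OF that(2,3), of w w']
      unfolding R'_def by simp
    then show "c = c'" if "y \<in> Mn d" "c \<in> M1" "c' \<in> M1" "w \<in> Mn e" "w' \<in> Mn e" "R' y z c w" "R' y z' c' w'"
      for y z z' c c' w w' using that by blast
    show "many (replicate (Suc e) 1) {v \<in> Mn (Suc e). \<exists>y\<in>Mn d. \<exists>z\<in>Mn 0. \<exists>c\<in>M1. \<exists>w\<in>Mn e. v = c @ w \<and> R' y z c w}"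
    proof (rule many_mono[OF Suc.prems(3)])
      fix v assume v: "v \<in> {w \<in> Mn (Suc e). \<exists>z\<in>Mn d. R z w}"
      then have "v \<in> Mn (Suc e)" by blast
      then obtain c w where "v = c @ w" "c \<in> M1" "w \<in> Mn e" by (rule MnSuc_cases)
      then show "v \<in> {v \<in> Mn (Suc e). \<exists>y\<in>Mn d. \<exists>z\<in>Mn 0. \<exists>c\<in>M1. \<exists>w\<in>Mn e. v = c @ w \<and> R' y z c w}"
        using v unfolding R'_def by auto
    qed
  qed
  then show ?case by simp
qed simp

end

section \<open>Dimension\<close>

lemma sel_eqD: "sel is x = sel is y \<Longrightarrow> i \<in> set is \<Longrightarrow> x ! i = y ! i"
  by (auto simp: sel_def)

lemma sel_replicate: "set is \<subseteq> {..<n} \<Longrightarrow> sel is (replicate n x) = replicate (length is) x"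
  by (induction "is") auto

lemma permute_list_sel: "length x = n \<Longrightarrow> permute_list \<sigma> x = sel (map \<sigma> [0..<n]) x"
  by (simp add: permute_list_def sel_def)

definition main_idx :: "('s, 'f, 'r) lang \<Rightarrow> 's list \<Rightarrow> nat list" where
  "main_idx L ts = filter (\<lambda>i. ts ! i = main L) [0..<length ts]"

definition aux_idx :: "('s, 'f, 'r) lang \<Rightarrow> 's list \<Rightarrow> nat list" where
  "aux_idx L ts = filter (\<lambda>i. ts ! i \<noteq> main L) [0..<length ts]"

lemma main_idx_less: "set (main_idx L ts) \<subseteq> {..<length ts}" and aux_idx_less: "set (aux_idx L ts) \<subseteq> {..<length ts}"
  by (auto simp: main_idx_def aux_idx_def)

lemma main_part_sel:
  assumes "length x = length ts"
  shows "main_part L ts x = sel (main_idx L ts) x"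
proof -
  have "zip x ts = map (\<lambda>i. (x ! i, ts ! i)) [0..<length ts]"
    using assms by (auto intro: nth_equalityI)
  then show ?thesis by (simp add: main_part_def filter_map comp_def main_idx_def sel_def)
qed

lemma sel_main_idx: "sel (main_idx L ts) ts = replicate (count_list ts (main L)) (main L)"
proof -
  have "sel (main_idx L ts) ts = filter (\<lambda>s. s = main L) (map ((!) ts) [0..<length ts])"
    by (simp add: sel_def main_idx_def filter_map comp_def)
  also have "\<dots> = filter ((=) (main L)) ts" by (simp add: map_nth) (metis)
  also have "\<dots> = replicate (count_list ts (main L)) (main L)"
    by (induction ts) auto
  finally show ?thesis .
qed

lemma sel_aux_idx: "set ts \<subseteq> insert (main L) (aux L) \<Longrightarrow> set (sel (aux_idx L ts) ts) \<subseteq> aux L"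
  by (auto simp: sel_def aux_idx_def dest: subsetD[OF _ nth_mem])

lemma sel_main_aux_idx:
  assumes "length x = length ts" "length y = length ts"
    "sel (main_idx L ts) x = sel (main_idx L ts) y" "sel (aux_idx L ts) x = sel (aux_idx L ts) y"
  shows "x = y"
proof (rule nth_equalityI)
  fix i assume "i < length x"
  then have "i \<in> set (main_idx L ts) \<or> i \<in> set (aux_idx L ts)" using assms(1) by (auto simp: main_idx_def aux_idx_def)
  then show "x ! i = y ! i" using sel_eqD assms(3,4) by metis
qed (use assms in simp)

text \<open>The values a dimension can take. Such a value is determined by the natural numbers below
  it, so rank conditions suffice to prove inequalities and equations.\<close>

definition dimval :: "ereal \<Rightarrow> bool" where
  "dimval a \<longleftrightarrow> a = - \<infinity> \<or> (\<exists>k::nat. a = ereal (real k))"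

lemma dimval_leI:
  assumes "dimval a" "\<And>e::nat. ereal (real e) \<le> a \<Longrightarrow> ereal (real e) \<le> b"
  shows "a \<le> b"
  using assms unfolding dimval_def by auto

lemma dimval_add:
  assumes "dimval a" "dimval b"
    and 1: "\<And>e::nat. ereal (real e) \<le> b \<Longrightarrow> ereal (real (e + d)) \<le> a"
    and 2: "\<And>k::nat. ereal (real k) \<le> a \<Longrightarrow> \<exists>e::nat. ereal (real e) \<le> b \<and> k \<le> e + d"
  shows "a = b + ereal (real d)"
proof (cases "b = - \<infinity>")
  case True
  then have "\<not> ereal (real k) \<le> a" for k :: nat using 2[of k] by auto
  then have "a = - \<infinity>" using assms(1) unfolding dimval_def by blast
  then show ?thesis using True by simp
next
  case False
  then obtain e :: nat where e: "b = ereal (real e)" using assms(2) unfolding dimval_def by blast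
  then have "ereal (real (e + d)) \<le> a" using 1[of e] by simp
  then obtain k :: nat where k: "a = ereal (real k)" using assms(1) unfolding dimval_def by auto
  obtain e' :: nat where "ereal (real e') \<le> b" "k \<le> e' + d" using 2[of k] k by auto
  then show ?thesis using \<open>ereal (real (e + d)) \<le> a\<close> e k by simp
qed

section \<open>Cells with large image, and the rank that computes dimension\<close>

context bmin
begin

lemma defb_finite_bex:
  "finite J \<Longrightarrow> (\<And>j. j \<in> J \<Longrightarrow> defb \<Sigma> (P j)) \<Longrightarrow> defb \<Sigma> (\<lambda>v. \<exists>j\<in>J. P j v)"
proof (induction rule: finite_induct)
  case empty
  then show ?case using defb_const[of \<Sigma> False] by simp
next
  case (insert j J)
  have "defb \<Sigma> (\<lambda>v. P j v \<or> (\<exists>j\<in>J. P j v))" using insert by (intro defb_disj) auto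
  then show ?case by simp
qed

lemma additive_finite:
  assumes "additive ts \<Lambda>" "\<not> \<Lambda> {}" "finite J"
  shows "(\<And>j. j \<in> J \<Longrightarrow> dp1 ts (X j)) \<Longrightarrow> \<Lambda> {y \<in> tuples M ts. \<exists>j\<in>J. X j y} \<Longrightarrow>
    \<exists>j\<in>J. \<Lambda> {y \<in> tuples M ts. X j y}"
  using assms(3)
proof (induction rule: finite_induct)
  case empty
  then show ?case using assms(2) by simp
next
  case (insert j J)
  have "dp1 ts (\<lambda>y. \<exists>j\<in>J. X j y)" unfolding dp1_def
    by (rule defb_finite_bex[OF insert(1)]) (use insert(4) in \<open>auto simp: dp1_def\<close>)
  moreover have "dp1 ts (X j)" using insert(4) by blast
  moreover have "\<Lambda> {y \<in> tuples M ts. X j y \<or> (\<exists>j\<in>J. X j y)}" using insert(5) by simp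
  ultimately have "\<Lambda> {y \<in> tuples M ts. X j y} \<or> \<Lambda> {y \<in> tuples M ts. \<exists>j\<in>J. X j y}"
    using additive_or[OF assms(1)] by blast
  then show ?case using insert by auto
qed

text \<open>In a fibre of type 0 there is only one point, because the presentation is constant.
  Hence every coordinate of type 0 is a function of the earlier ones.\<close>

lemma unicell_inj:
  "unicell js C \<Longrightarrow> z \<in> C \<Longrightarrow> z' \<in> C \<Longrightarrow> sel (idx js) z = sel (idx js) z' \<Longrightarrow> z = z'"
proof (induction arbitrary: z z' rule: unicell.induct)
  case (Nil C)
  then have "z \<in> tuples M []" "z' \<in> tuples M []" using definable_subset by blast+
  then show ?case by simp
next
  case (Snoc js C' C j)
  have C_sub: "C \<subseteq> Mn (Suc (length js))" using Snoc(2) by (rule definable_subset)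
  have "z \<in> Mn (Suc (length js))" using C_sub Snoc.prems by blast
  then obtain y x where z: "z = y @ x" "y \<in> Mn (length js)" "x \<in> M1" by (rule MnSuc_right_cases)
  have "z' \<in> Mn (Suc (length js))" using C_sub Snoc.prems by blast
  then obtain y' x' where z': "z' = y' @ x'" "y' \<in> Mn (length js)" "x' \<in> M1" by (rule MnSuc_right_cases)
  have l: "length y = length js" "length y' = length js" using z(2) z'(2) by (auto dest: tuples_length)
  have s: "sel (idx js) (y @ x) = sel (idx js) y" "sel (idx js) (y' @ x') = sel (idx js) y'"
    using l idx_lt[of js] by (auto intro!: sel_prefix)
  have "y \<in> C'" "y' \<in> C'" using Snoc(4) z z' Snoc.prems by auto
  moreover have "sel (idx js) y = sel (idx js) y'"
    using Snoc.prems(3) s unfolding z z' idx_snoc sel_append by (auto split: if_splits)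
  ultimately have y: "y' = y" using Snoc.IH by metis
  have "x = x'"
  proof (cases "j = 0")
    case True
    then show ?thesis using Snoc(5) \<open>y \<in> C'\<close> z z' y Snoc.prems by auto
  next
    case False
    then show ?thesis using Snoc.prems(3) s l z(3) z'(3) y unfolding z z' idx_snoc sel_append
      by (auto simp: tuples1 nth_append)
  qed
  then show ?case using z z' y by simp
qed

text \<open>\<open>ex_unicell\<close> is applied to the property of having an image under
  \<open>R\<close> that is big in all \<open>e\<close> coordinates. The cell found keeps such an
  image, and this forces it to have at least \<open>e\<close> coordinates of type 1.\<close>

lemma image_unicell:
  assumes "dp2 (ms n) (ms e) R" "dp1 (ms n) X"
    and func: "\<And>z w w'. z \<in> Mn n \<Longrightarrow> X z \<Longrightarrow> w \<in> Mn e \<Longrightarrow> w' \<in> Mn e \<Longrightarrow> R z w \<Longrightarrow> R z w' \<Longrightarrow> w = w'"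
    and q: "many (replicate e 1) {w \<in> Mn e. \<exists>z\<in>Mn n. X z \<and> R z w}"
  shows "\<exists>js C. length js = n \<and> cell L M js C [] {[]} (\<lambda>_. []) \<and> C \<noteq> {} \<and> set js \<subseteq> {0, 1} \<and>
    (\<forall>z\<in>C. X z) \<and> many js C \<and> e \<le> sum_list js"
proof -
  define \<Lambda> where "\<Lambda> Z \<longleftrightarrow> many (replicate e 1) {w \<in> Mn e. \<exists>z\<in>Mn n. z \<in> Z \<and> R z w}" for Z
  have add: "additive (ms n) \<Lambda>"
    unfolding \<Lambda>_def by (rule additive_image[OF many1_additive assms(1)])
  have "\<Lambda> {z \<in> Mn n. X z}" using q unfolding \<Lambda>_def by (rule many_mono) auto
  from ex_unicell[OF add assms(2) this] obtain js C where C: "length js = n" "unicell js C" "\<forall>z\<in>C. X z" "\<Lambda> C"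
    by blast
  have cell: "cell L M js C [] {[]} (\<lambda>_. [])" using C(2) by (rule unicell_cell)
  have "C \<noteq> {}" using many_ne[OF C(4)[unfolded \<Lambda>_def]] by auto
  then have many: "many js C" "set js \<subseteq> {0, 1}" using cell_many[OF cell] by auto
  have DC: "Df (ms n) C" using unicell_Df[OF C(2)] C(1) by simp
  let ?d = "length (idx js)"
  \<comment> \<open>The coordinates of type 1 determine the points of \<open>C\<close>, so on
    \<open>C\<close> the map \<open>R\<close> is a function of these coordinates alone and the
    exchange bound applies.\<close>
  define R' where "R' u w \<longleftrightarrow> (\<exists>z\<in>Mn n. z \<in> C \<and> u = sel (idx js) z \<and> R z w)" for u w
  have selrep: "sel (idx js) (ms n) = ms ?d"
    using idx_lt[of js] C(1) by (intro sel_replicate) simp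
  have selMn: "sel (idx js) z \<in> Mn ?d" if "z \<in> Mn n" for z
    using sel_tuples[OF that, of "idx js"] idx_lt[of js] C(1) selrep by simp
  have "dp2 (ms ?d) (ms e) R'" unfolding dp2_def R'_def
    by (rule defb_rules dp2_rule[OF assms(1)] DC | simp add: selrep | use idx_lt[of js] C(1) in simp)+
  then have "e \<le> ?d"
  proof (rule onto_dim_le)
    fix u w w' assume "w \<in> Mn e" "w' \<in> Mn e" "R' u w" "R' u w'"
    then obtain z z' where "z \<in> Mn n" "z \<in> C" "z' \<in> C" "u = sel (idx js) z" "u = sel (idx js) z'" "R z w" "R z' w'"
      unfolding R'_def by blast
    moreover from this have "z' = z" using unicell_inj[OF C(2)] by metis
    ultimately show "w = w'" using func C(3) \<open>w \<in> Mn e\<close> \<open>w' \<in> Mn e\<close> by blast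
  next
    show "many (replicate e 1) {w \<in> Mn e. \<exists>z\<in>Mn ?d. R' z w}"
      using C(4)[unfolded \<Lambda>_def] by (rule many_mono) (use selMn in \<open>auto simp: R'_def\<close>)
  qed
  then show ?thesis using C cell \<open>C \<noteq> {}\<close> many length_idx[OF many(2)] by auto
qed

text \<open>\<open>R\<close> is functional on all tuples and \<open>X\<close> enters only through
  the image, so the same \<open>R\<close> can be kept when \<open>X\<close> is enlarged or cut into
  pieces.\<close>

definition rank_eq_map :: "nat \<Rightarrow> 's list \<Rightarrow> 'u list set \<Rightarrow> bool" where
  "rank_eq_map e ts X \<longleftrightarrow> (\<exists>R. dp2 ts (ms e) R \<and>
     (\<forall>x\<in>tuples M ts. \<forall>w\<in>Mn e. \<forall>w'\<in>Mn e. R x w \<longrightarrow> R x w' \<longrightarrow> w = w') \<and>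
     many (replicate e 1) {w \<in> Mn e. \<exists>x\<in>tuples M ts. x \<in> X \<and> R x w})"

text \<open>Downward closure in \<open>e\<close> is built in, so that comparing a dimension with
  smaller natural numbers requires no further construction.\<close>

definition rank_ge :: "nat \<Rightarrow> 's list \<Rightarrow> 'u list set \<Rightarrow> bool" where
  "rank_ge e ts X \<longleftrightarrow> (\<exists>e'\<ge>e. rank_eq_map e' ts X)"

lemma rank_geE:
  assumes "rank_ge e ts X"
  obtains e' R where "e \<le> e'" "dp2 ts (ms e') R"
    "\<And>x w w'. x \<in> tuples M ts \<Longrightarrow> w \<in> Mn e' \<Longrightarrow> w' \<in> Mn e' \<Longrightarrow> R x w \<Longrightarrow> R x w' \<Longrightarrow> w = w'"
    "many (replicate e' 1) {w \<in> Mn e'. \<exists>x\<in>tuples M ts. x \<in> X \<and> R x w}"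
  using assms unfolding rank_ge_def rank_eq_map_def by blast

lemma rank_geI:
  assumes "e \<le> e'" "dp2 ts (ms e') R"
    "\<And>x w w'. x \<in> tuples M ts \<Longrightarrow> w \<in> Mn e' \<Longrightarrow> w' \<in> Mn e' \<Longrightarrow> R x w \<Longrightarrow> R x w' \<Longrightarrow> w = w'"
    "many (replicate e' 1) {w \<in> Mn e'. \<exists>x\<in>tuples M ts. x \<in> X \<and> R x w}"
  shows "rank_ge e ts X"
  using assms unfolding rank_ge_def rank_eq_map_def by blast

lemma rank_ge_ne: "rank_ge e ts X \<Longrightarrow> \<exists>x\<in>tuples M ts. x \<in> X"
  by (elim rank_geE, drule many_ne) blast

text \<open>Compose the map on \<open>X'\<close> with the partial map \<open>G\<close>.
  Monotonicity, the inequality for images and the passage to main coordinates are all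
  instances.\<close>

lemma rank_ge_image:
  assumes "rank_ge e ts' X'" "dp2 ts ts' G"
    and "\<And>x x1 x2. x \<in> tuples M ts \<Longrightarrow> x1 \<in> tuples M ts' \<Longrightarrow> x2 \<in> tuples M ts' \<Longrightarrow> G x x1 \<Longrightarrow> G x x2 \<Longrightarrow> x1 = x2"
    and "\<And>x'. x' \<in> tuples M ts' \<Longrightarrow> x' \<in> X' \<Longrightarrow> \<exists>x\<in>tuples M ts. x \<in> X \<and> G x x'"
  shows "rank_ge e ts X"
proof -
  obtain e' R where R: "e \<le> e'" "dp2 ts' (ms e') R"
    "\<And>x w w'. x \<in> tuples M ts' \<Longrightarrow> w \<in> Mn e' \<Longrightarrow> w' \<in> Mn e' \<Longrightarrow> R x w \<Longrightarrow> R x w' \<Longrightarrow> w = w'"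
    "many (replicate e' 1) {w \<in> Mn e'. \<exists>x\<in>tuples M ts'. x \<in> X' \<and> R x w}"
    by (rule rank_geE[OF assms(1)]) (rule that)
  show ?thesis
  proof (rule rank_geI[OF R(1), where R = "\<lambda>x w. \<exists>x'\<in>tuples M ts'. G x x' \<and> R x' w"])
    show "dp2 ts (ms e') (\<lambda>x w. \<exists>x'\<in>tuples M ts'. G x x' \<and> R x' w)" unfolding dp2_def
      by (rule defb_rules dp2_rule[OF R(2)] dp2_rule[OF assms(2)] | simp)+
    show "w = w'" if "x \<in> tuples M ts" "w \<in> Mn e'" "w' \<in> Mn e'" "\<exists>x'\<in>tuples M ts'. G x x' \<and> R x' w"
      "\<exists>x'\<in>tuples M ts'. G x x' \<and> R x' w'" for x w w'
      using that assms(3)[OF that(1)] R(3) by blast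
    show "many (replicate e' 1) {w \<in> Mn e'. \<exists>x\<in>tuples M ts. x \<in> X \<and> (\<exists>x'\<in>tuples M ts'. G x x' \<and> R x' w)}"
      using R(4) by (rule many_mono) (use assms(4) in blast)
  qed
qed

lemma rank_ge_mono:
  assumes "rank_ge e ts X" "Df ts X" "X \<subseteq> X'"
  shows "rank_ge e ts X'"
proof (rule rank_ge_image[OF assms(1), where G = "\<lambda>x x'. x = x'"])
  show "dp2 ts ts (\<lambda>x x'. x = x')" unfolding dp2_def by (rule defb_rules | simp)+
qed (use assms(3) in auto)

text \<open>The images of the sets \<open>{x \<in> X. G x s}\<close> cover the image of
  \<open>X\<close>, and additivity finds one that is still large. Hence fixing auxiliary data costs
  no dimension.\<close>

lemma rank_ge_aux:
  assumes "rank_ge e ts X" "Df ts X" "set ss \<subseteq> aux L" "dp2 ts ss G"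
    and "\<And>x. x \<in> tuples M ts \<Longrightarrow> x \<in> X \<Longrightarrow> \<exists>s\<in>tuples M ss. G x s"
  shows "\<exists>s\<in>tuples M ss. rank_ge e ts {x \<in> X. G x s}"
proof -
  obtain e' R where R: "e \<le> e'" "dp2 ts (ms e') R"
    "\<And>x w w'. x \<in> tuples M ts \<Longrightarrow> w \<in> Mn e' \<Longrightarrow> w' \<in> Mn e' \<Longrightarrow> R x w \<Longrightarrow> R x w' \<Longrightarrow> w = w'"
    "many (replicate e' 1) {w \<in> Mn e'. \<exists>x\<in>tuples M ts. x \<in> X \<and> R x w}"
    by (rule rank_geE[OF assms(1)]) (rule that)
  define Z where "Z s w \<longleftrightarrow> (\<exists>x\<in>tuples M ts. x \<in> X \<and> G x s \<and> R x w)" for s w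
  have Z: "dp2 ss (ms e') Z" unfolding dp2_def Z_def
    by (rule defb_rules dp2_rule[OF R(2)] dp2_rule[OF assms(4)] assms(2) | simp)+
  have "{w \<in> Mn e'. \<exists>x\<in>tuples M ts. x \<in> X \<and> R x w} = {w \<in> Mn e'. \<exists>s\<in>tuples M ss. Z s w}"
    unfolding Z_def using assms(5) by blast
  with R(4) have "many (replicate e' 1) {w \<in> Mn e'. \<exists>s\<in>tuples M ss. Z s w}" by (simp only:)
  from additiveD[OF many1_additive assms(3) Z this] obtain s where s: "s \<in> tuples M ss" "many (replicate e' 1) {w \<in> Mn e'. Z s w}"
    by blast
  have "rank_ge e ts {x \<in> X. G x s}"
    by (rule rank_geI[OF R(1,2,3)]) (use s(2) in \<open>auto simp: Z_def elim!: many_mono\<close>)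
  then show ?thesis using s(1) by blast
qed

lemma sel_main_idx_Mn:
  assumes "x \<in> tuples M ts"
  shows "sel (main_idx L ts) x \<in> Mn (count_list ts (main L))"
  using sel_tuples[OF assms main_idx_less] by (simp add: sel_main_idx)

lemma Df_sel_main_idx:
  assumes "Df ts X"
  shows "Df (ms (count_list ts (main L))) (sel (main_idx L ts) ` X)"
proof -
  have "Df (ms (count_list ts (main L)))
    {m \<in> Mn (count_list ts (main L)). \<exists>x\<in>tuples M ts. x \<in> X \<and> m = sel (main_idx L ts) x}"
    by (rule definable1) (rule defb_rules assms | simp add: sel_main_idx main_idx_less)+
  moreover have "{m \<in> Mn (count_list ts (main L)). \<exists>x\<in>tuples M ts. x \<in> X \<and> m = sel (main_idx L ts) x} = sel (main_idx L ts) ` X"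
    using definable_subset[OF assms] sel_main_idx_Mn by auto
  ultimately show ?thesis by simp
qed

text \<open>Projection to the main coordinates is a definable map, which gives one direction. For
  the other, fix the auxiliary coordinates by \<open>rank_ge_aux\<close>; on such a slice the
  projection has a definable partial inverse.\<close>

lemma rank_ge_main:
  assumes "set ts \<subseteq> insert (main L) (aux L)" "Df ts X"
  shows "rank_ge e ts X \<longleftrightarrow> rank_ge e (ms (count_list ts (main L))) (sel (main_idx L ts) ` X)"
proof
  let ?n = "ms (count_list ts (main L))"
  assume "rank_ge e ?n (sel (main_idx L ts) ` X)"
  then show "rank_ge e ts X"
  proof (rule rank_ge_image[where G = "\<lambda>x m. m = sel (main_idx L ts) x"])
    show "dp2 ts ?n (\<lambda>x m. m = sel (main_idx L ts) x)" unfolding dp2_def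
      by (rule defb_rules | simp add: sel_main_idx main_idx_less)+
  qed (use definable_subset[OF assms(2)] in auto)
next
  let ?n = "ms (count_list ts (main L))"
  assume rank_ge: "rank_ge e ts X"
  have "dp2 ts (sel (aux_idx L ts) ts) (\<lambda>x s. s = sel (aux_idx L ts) x)" unfolding dp2_def
    by (rule defb_rules | simp add: aux_idx_less)+
  then have "\<exists>s\<in>tuples M (sel (aux_idx L ts) ts). rank_ge e ts {x \<in> X. s = sel (aux_idx L ts) x}"
    by (rule rank_ge_aux[OF rank_ge assms(2) sel_aux_idx[OF assms(1)]]) (use sel_tuples[OF _ aux_idx_less] in blast)
  then obtain s where s: "s \<in> tuples M (sel (aux_idx L ts) ts)" "rank_ge e ts {x \<in> X. s = sel (aux_idx L ts) x}" by blast
  show "rank_ge e ?n (sel (main_idx L ts) ` X)"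
  proof (rule rank_ge_image[OF s(2), where G = "\<lambda>m x. x \<in> X \<and> s = sel (aux_idx L ts) x \<and> m = sel (main_idx L ts) x"])
    show "dp2 ?n ts (\<lambda>m x. x \<in> X \<and> s = sel (aux_idx L ts) x \<and> m = sel (main_idx L ts) x)" unfolding dp2_def
      by (rule defb_rules assms(2) dconst[OF s(1)] | simp add: sel_main_idx aux_idx_less main_idx_less)+
    show "x1 = x2" if "x1 \<in> tuples M ts" "x2 \<in> tuples M ts"
      "x1 \<in> X \<and> s = sel (aux_idx L ts) x1 \<and> m = sel (main_idx L ts) x1"
      "x2 \<in> X \<and> s = sel (aux_idx L ts) x2 \<and> m = sel (main_idx L ts) x2" for m x1 x2
      using that sel_main_aux_idx[of x1 ts x2 L] by (auto dest: tuples_length)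
  qed (use sel_main_idx_Mn in auto)
qed

text \<open>There are finitely many such types, so the existence of one that fits is a finite
  disjunction and remains definable.\<close>

definition cell_types :: "nat \<Rightarrow> nat \<Rightarrow> nat list set" where
  "cell_types n e = {js. set js \<subseteq> {0, 1} \<and> length js = n \<and> e \<le> sum_list js}"

lemma finite_cell_types: "finite (cell_types n e)"
  by (rule finite_subset[OF _ finite_lists_length_eq[of "{0, 1}" n]]) (auto simp: cell_types_def)

text \<open>The witnessing map is the projection to the coordinates of type 1.\<close>

lemma many_rank_ge:
  assumes "Df (ms n) W" "length js = n" "set js \<subseteq> {0, 1}" "many js W" "e \<le> sum_list js"
  shows "rank_ge e (ms n) W"
proof (rule rank_geI[where e' = "length (idx js)" and R = "\<lambda>z w. w = sel (idx js) z"])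
  let ?d = "length (idx js)"
  have selrep: "sel (idx js) (ms n) = ms ?d"
    using idx_lt[of js] assms(2) by (intro sel_replicate) simp
  show "e \<le> ?d" using length_idx[OF assms(3)] assms(5) by simp
  show "dp2 (ms n) (ms ?d) (\<lambda>z w. w = sel (idx js) z)" unfolding dp2_def
    by (rule defb_rules | simp add: selrep | use idx_lt[of js] assms(2) in simp)+
  show "many (replicate ?d 1) {w \<in> Mn ?d. \<exists>z\<in>Mn n. z \<in> W \<and> w = sel (idx js) z}"
    using many_proj[OF assms(4)] assms(2) by simp
qed auto

lemma rank_ge_cell:
  assumes "Df (ms n) W" "rank_ge e (ms n) W"
  shows "\<exists>js C. length js = n \<and> cell L M js C [] {[]} (\<lambda>_. []) \<and> C \<noteq> {} \<and> set js \<subseteq> {0, 1} \<and>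
    C \<subseteq> W \<and> many js C \<and> e \<le> sum_list js"
proof -
  obtain e' R where R: "e \<le> e'" "dp2 (ms n) (ms e') R"
    "\<And>x w w'. x \<in> Mn n \<Longrightarrow> w \<in> Mn e' \<Longrightarrow> w' \<in> Mn e' \<Longrightarrow> R x w \<Longrightarrow> R x w' \<Longrightarrow> w = w'"
    "many (replicate e' 1) {w \<in> Mn e'. \<exists>x\<in>Mn n. x \<in> W \<and> R x w}"
    by (rule rank_geE[OF assms(2)]) (rule that)
  have "dp1 (ms n) (\<lambda>z. z \<in> W)" unfolding dp1_def by (rule defb_rules assms(1) | simp)+
  from image_unicell[OF R(2) this _ R(4)] R(3) obtain js C where C: "length js = n" "cell L M js C [] {[]} (\<lambda>_. [])"
    "C \<noteq> {}" "set js \<subseteq> {0, 1}" "\<forall>z\<in>C. z \<in> W" "many js C" "e' \<le> sum_list js" by blast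
  then show ?thesis using R(1) by (intro exI[of _ js] exI[of _ C]) auto
qed

text \<open>The rank quantifies over all definable maps; the right-hand side is a finite disjunction
  of first-order quantifiers. This is what makes dimension definable in families.\<close>

lemma rank_ge_iff_many:
  assumes "Df (ms n) W"
  shows "rank_ge e (ms n) W \<longleftrightarrow> (\<exists>js\<in>cell_types n e. many js W)"
proof
  assume "rank_ge e (ms n) W"
  from rank_ge_cell[OF assms this] obtain js C where "length js = n" "set js \<subseteq> {0, 1}" "C \<subseteq> W" "many js C" "e \<le> sum_list js"
    by blast
  then show "\<exists>js\<in>cell_types n e. many js W"
    by (intro bexI[of _ js]) (auto simp: cell_types_def elim: many_mono)
qed (use many_rank_ge[OF assms] in \<open>auto simp: cell_types_def\<close>)

text \<open>A cell for a permuted ordering bounds the rank from below, since permuting coordinates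
  and then projecting is again a definable map. Conversely, a set of rank at least \<open>e\<close>
  contains a cell for the identity ordering with constant presentation, so no other cells can
  increase the supremum.\<close>

lemma dim_main_iff:
  assumes W: "Df (ms n) W"
  shows "ereal (real e) \<le> dim_main L M n W \<longleftrightarrow> rank_ge e (ms n) W" "dimval (dim_main L M n W)"
proof -
  define J where "J = {js. length js = n \<and> (\<exists>C \<sigma> ss S h. C \<noteq> {} \<and> C \<subseteq> W \<and> \<sigma> permutes {..<n} \<and>
    cell L M js (permute_list \<sigma> ` C) ss S h)}"
  have dim: "dim_main L M n W = Sup ((\<lambda>js. ereal (real (sum_list js))) ` J)"
    unfolding dim_main_def J_def by (simp only: setcompr_eq_image)
  have W_sub: "W \<subseteq> Mn n" using W by (rule definable_subset)
  have J: "set js \<subseteq> {0, 1} \<and> rank_ge (sum_list js) (ms n) W" if js: "js \<in> J" for js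
  proof -
    obtain C \<sigma> ss S h where c: "length js = n" "C \<noteq> {}" "C \<subseteq> W" "\<sigma> permutes {..<n}"
      "cell L M js (permute_list \<sigma> ` C) ss S h" using js unfolding J_def by blast
    have "permute_list \<sigma> ` C \<noteq> {}" using c(2) by simp
    with cell_many[OF c(5)] have q: "many js (permute_list \<sigma> ` C)" "set js \<subseteq> {0, 1}" by blast+
    let ?d = "length (idx js)" and ?\<sigma> = "map \<sigma> [0..<n]"
    have pl: "permute_list \<sigma> x = sel ?\<sigma> x" if "x \<in> Mn n" for x
      by (rule permute_list_sel) (use tuples_length[OF that] in simp)
    have "\<sigma> i < n" if "i < n" for i using permutes_in_image[OF c(4), of i] that by simp
    then have \<sigma>_lt: "set ?\<sigma> \<subseteq> {..<n}" by auto
    have s1: "sel ?\<sigma> (ms n) = ms n"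
      using sel_replicate[OF \<sigma>_lt] by simp
    have s2: "sel (idx js) (ms n) = ms ?d"
      using idx_lt[of js] c(1) by (intro sel_replicate) simp
    have "rank_ge (sum_list js) (ms n) W"
    proof (rule rank_geI[where e' = ?d and R = "\<lambda>z w. w = sel (idx js) (sel ?\<sigma> z)"])
      show "sum_list js \<le> ?d" using length_idx[OF q(2)] by simp
      show "dp2 (ms n) (ms ?d) (\<lambda>z w. w = sel (idx js) (sel ?\<sigma> z))" unfolding dp2_def
        by (rule defb_rules | simp add: s1 s2 del: sel_simps | use idx_lt[of js] c(1) \<sigma>_lt in simp)+
      show "many (replicate ?d 1) {w \<in> Mn ?d. \<exists>z\<in>Mn n. z \<in> W \<and> w = sel (idx js) (sel ?\<sigma> z)}"
        using many_proj[OF q(1)]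
      proof (rule many_mono)
        fix w assume "w \<in> {w \<in> Mn ?d. \<exists>z\<in>Mn (length js). z \<in> permute_list \<sigma> ` C \<and> w = sel (idx js) z}"
        then obtain z where z: "w \<in> Mn ?d" "z \<in> C" "w = sel (idx js) (permute_list \<sigma> z)" by blast
        then have "z \<in> Mn n" "z \<in> W" using c(3) W_sub by auto
        then show "w \<in> {w \<in> Mn ?d. \<exists>z\<in>Mn n. z \<in> W \<and> w = sel (idx js) (sel ?\<sigma> z)}" using z pl by auto
      qed
    qed auto
    then show ?thesis using q(2) by blast
  qed
  have rkJ: "\<exists>js\<in>J. e \<le> sum_list js" if rank_ge: "rank_ge e (ms n) W" for e
  proof -
    obtain js C where c: "length js = n" "cell L M js C [] {[]} (\<lambda>_. [])" "C \<noteq> {}" "C \<subseteq> W" "e \<le> sum_list js"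
      using rank_ge_cell[OF W rank_ge] by blast
    have "permute_list id ` C = C" by (simp add: permute_list_id)
    then have "js \<in> J" unfolding J_def using c
      by (intro CollectI conjI exI[of _ C] exI[of _ id] exI[of _ "[]"] exI[of _ "{[]}"] exI[of _ "\<lambda>_. []"])
        (auto intro: permutes_id)
    then show ?thesis using c(5) by blast
  qed
  have "length js = n" if "js \<in> J" for js using that unfolding J_def by blast
  then have "J \<subseteq> {js. set js \<subseteq> {0, 1} \<and> length js = n}" using J by blast
  then have "finite J" by (rule finite_subset) (simp add: finite_lists_length_eq)
  \<comment> \<open>Only finitely many types occur, so for nonempty \<open>J\<close> the supremum is
    attained.\<close>
  have "\<exists>js\<in>J. dim_main L M n W = ereal (real (sum_list js))" if "J \<noteq> {}"
  proof -
    have "Max ((\<lambda>js. ereal (real (sum_list js))) ` J) \<in> (\<lambda>js. ereal (real (sum_list js))) ` J"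
      using \<open>finite J\<close> that by (intro Max_in) auto
    moreover have "Max ((\<lambda>js. ereal (real (sum_list js))) ` J) = dim_main L M n W"
      unfolding dim using \<open>finite J\<close> that by (intro Max_Sup) auto
    ultimately show ?thesis by auto
  qed
  moreover have "dim_main L M n W = - \<infinity>" if "J = {}"
    unfolding dim that by (simp add: bot_ereal_def)
  ultimately show "dimval (dim_main L M n W)" unfolding dimval_def by (cases "J = {}") auto
  show "ereal (real e) \<le> dim_main L M n W \<longleftrightarrow> rank_ge e (ms n) W"
  proof
    assume "rank_ge e (ms n) W"
    then obtain js where "js \<in> J" "e \<le> sum_list js" using rkJ by blast
    then have "ereal (real e) \<le> ereal (real (sum_list js))" by simp
    also have "\<dots> \<le> dim_main L M n W" unfolding dim using \<open>js \<in> J\<close> by (intro Sup_upper) auto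
    finally show "ereal (real e) \<le> dim_main L M n W" .
  next
    assume e: "ereal (real e) \<le> dim_main L M n W"
    then have "J \<noteq> {}" using \<open>J = {} \<Longrightarrow> dim_main L M n W = - \<infinity>\<close> by auto
    then obtain js where "js \<in> J" "dim_main L M n W = ereal (real (sum_list js))"
      using \<open>J \<noteq> {} \<Longrightarrow> \<exists>js\<in>J. _\<close> by blast
    then have "rank_ge (sum_list js) (ms n) W" "e \<le> sum_list js" using J e by auto
    then show "rank_ge e (ms n) W" unfolding rank_ge_def using le_trans by blast
  qed
qed

lemma dim_iff:
  assumes "set ts \<subseteq> insert (main L) (aux L)" "Df ts X"
  shows "ereal (real e) \<le> dim L M ts X \<longleftrightarrow> rank_ge e ts X" "dimval (dim L M ts X)"
proof -
  have "main_part L ts ` X = sel (main_idx L ts) ` X"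
    using definable_subset[OF assms(2)] by (intro image_cong main_part_sel) (auto dest!: subsetD tuples_length)
  then show "ereal (real e) \<le> dim L M ts X \<longleftrightarrow> rank_ge e ts X" "dimval (dim L M ts X)"
    using dim_main_iff[OF Df_sel_main_idx[OF assms(2)]] rank_ge_main[OF assms] by (auto simp: dim_def)
qed

end

section \<open>Images, fibres and additivity of dimension\<close>

context bmin
begin

lemma definable_mapD:
  assumes "definable_map L M A ss X ts Y h"
  shows "definable L M A ss X" "definable L M A ts Y" "definable L M A (ss @ ts) {x @ h x |x. x \<in> X}"
    and "x \<in> X \<Longrightarrow> h x \<in> Y"
  using assms unfolding definable_map_def by auto

lemma fiber_sub: "fiber h X s \<subseteq> X"
  by (auto simp: fiber_def)

lemma graph_rule:
  assumes "definable_map L M (elems M) ts X ts' X' f"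
  shows "dp2 ts ts' (\<lambda>x x'. x \<in> X \<and> f x = x')"
proof -
  note X = definable_subset[OF definable_mapD(1)[OF assms]] and G = definable_mapD(3)[OF assms]
  have "defb [ts, ts'] (\<lambda>v. v 0 @ v (Suc 0) \<in> {x @ f x |x. x \<in> X})"
    by (rule defb_rules G | simp)+
  moreover have "v 0 @ v (Suc 0) \<in> {x @ f x |x. x \<in> X} \<longleftrightarrow> v 0 \<in> X \<and> f (v 0) = v (Suc 0)"
    if "val M [ts, ts'] v" for v
    using graph_iff[OF X, of "v 0" "v (Suc 0)" f] that by auto
  ultimately show ?thesis unfolding dp2_def by (subst defb_cong) auto
qed

lemma dim_mono:
  assumes "set ts \<subseteq> insert (main L) (aux L)" "Df ts X" "Df ts X'" "X \<subseteq> X'"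
  shows "dim L M ts X \<le> dim L M ts X'"
  by (rule dimval_leI)
    (use dim_iff[OF assms(1,2)] dim_iff[OF assms(1,3)] rank_ge_mono[OF _ assms(2,4)] in auto)

lemma dim_image:
  assumes ts: "set ts \<subseteq> insert (main L) (aux L)" "set ts' \<subseteq> insert (main L) (aux L)"
    and f: "definable_map L M (elems M) ts X ts' X' f" and Z: "Df ts Z" "Z \<subseteq> X"
  shows "Df ts' (f ` Z)" "dim L M ts' (f ` Z) \<le> dim L M ts Z"
proof -
  note X = definable_subset[OF definable_mapD(1)[OF f]]
  note G = graph_rule[OF f]
  have "Df ts' {x' \<in> tuples M ts'. \<exists>x\<in>tuples M ts. x \<in> Z \<and> (x \<in> X \<and> f x = x')}"
    by (rule definable1) (rule dp2_rule[OF G] defb_rules Z(1) | simp)+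
  moreover have "{x' \<in> tuples M ts'. \<exists>x\<in>tuples M ts. x \<in> Z \<and> (x \<in> X \<and> f x = x')} = f ` Z"
    using Z(2) X definable_map_range[OF f] by blast
  ultimately show fZ: "Df ts' (f ` Z)" by simp
  have "rank_ge e ts Z" if "rank_ge e ts' (f ` Z)" for e
    by (rule rank_ge_image[OF that G]) (use Z(2) X in blast)+
  then show "dim L M ts' (f ` Z) \<le> dim L M ts Z"
    using dim_iff(1)[OF ts(1) Z(1)] dim_iff(1)[OF ts(2) fZ] by (rule_tac dimval_leI[OF dim_iff(2)[OF ts(2) fZ]]) blast
qed

lemma Df_fiber:
  assumes "definable_map L M (elems M) ts X us Y h" "Df ts Z" "Z \<subseteq> X" "y \<in> tuples M us"
  shows "Df ts (fiber h Z y)"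
proof -
  have "Df ts {x \<in> tuples M ts. x \<in> Z \<and> (x \<in> X \<and> h x = y)}"
    by (rule definable1) (rule dp2_rule[OF graph_rule[OF assms(1)]] defb_rules assms(2) dconst[OF assms(4)] | simp)+
  moreover have "{x \<in> tuples M ts. x \<in> Z \<and> (x \<in> X \<and> h x = y)} = fiber h Z y"
    using assms(3) definable_subset[OF assms(2)] by (auto simp: fiber_def)
  ultimately show ?thesis by simp
qed

lemma Df_empty: "Df ts {}"
proof -
  have "Df ts {x \<in> tuples M ts. False}" by (rule definable1) (rule defb_const)
  then show ?thesis by simp
qed

lemma dim_empty:
  assumes "set ts \<subseteq> insert (main L) (aux L)"
  shows "dim L M ts {} = - \<infinity>"
proof -
  have "\<not> ereal (real e) \<le> dim L M ts {}" for e :: nat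
    using dim_iff(1)[OF assms Df_empty] rank_ge_ne by blast
  then show ?thesis using dim_iff(2)[OF assms Df_empty] unfolding dimval_def by fastforce
qed

lemma rank_ge_iff_many_main:
  assumes "set ts \<subseteq> insert (main L) (aux L)" "Df ts X"
  shows "rank_ge e ts X \<longleftrightarrow> (\<exists>js\<in>cell_types (count_list ts (main L)) e. many js (sel (main_idx L ts) ` X))"
  using rank_ge_main[OF assms] rank_ge_iff_many[OF Df_sel_main_idx[OF assms(2)]] by blast

text \<open>For a fixed type this is an iterated quantifier applied to a definable family. Finite
  disjunctions over types then define the locus of a given fibre dimension.\<close>

lemma dp1_many_fiber:
  assumes f: "definable_map L M (elems M) ts X ts' X' f" and n: "length js = count_list ts (main L)"
  shows "dp1 ts' (\<lambda>w. many js (sel (main_idx L ts) ` fiber f X w))"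
  unfolding dp1_def
proof -
  note X = definable_subset[OF definable_mapD(1)[OF f]]
  have "defb [ts'] (\<lambda>v. many js {m \<in> Mn (length js). \<exists>x\<in>tuples M ts. m = sel (main_idx L ts) x \<and> (x \<in> X \<and> f x = v 0)})"
    by (rule defb_many, unfold n) (rule dp2_rule[OF graph_rule[OF f]] defb_rules | simp add: sel_main_idx main_idx_less)+
  moreover have "{m \<in> Mn (length js). \<exists>x\<in>tuples M ts. m = sel (main_idx L ts) x \<and> (x \<in> X \<and> f x = w)} =
    sel (main_idx L ts) ` fiber f X w" for w
    using X sel_main_idx_Mn unfolding n fiber_def by blast
  ultimately show "defb [ts'] (\<lambda>v. many js (sel (main_idx L ts) ` fiber f X (v 0)))" by simp
qed

lemma dim_eq_iff:
  assumes "set ts \<subseteq> insert (main L) (aux L)" "Df ts X"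
  shows "dim L M ts X = ereal (real d) \<longleftrightarrow> rank_ge d ts X \<and> \<not> rank_ge (Suc d) ts X"
  using dim_iff(1)[OF assms, of d] dim_iff(1)[OF assms, of "Suc d"] dim_iff(2)[OF assms]
  unfolding dimval_def by auto

text \<open>For the lower bound, a map on \<open>W\<close> is combined with coordinate projections
  of the fibres, which needs a single type for the fibres over a big set of values. For the upper
  bound, the graph of \<open>f\<close> is thinned out to a cell and the type of the cell is split
  into base and fibre.\<close>

lemma dim_add:
  assumes ts: "set ts \<subseteq> insert (main L) (aux L)" "set ts' \<subseteq> insert (main L) (aux L)"
    and f: "definable_map L M (elems M) ts X ts' X' f"
    and W: "Df ts' W" "\<And>w. w \<in> W \<Longrightarrow> dim L M ts (fiber f X w) = ereal (real d)"
  shows "Df ts {x \<in> X. f x \<in> W}" "dim L M ts {x \<in> X. f x \<in> W} = dim L M ts' W + ereal (real d)"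
proof -
  let ?Z = "{x \<in> X. f x \<in> W}"
  let ?n = "count_list ts (main L)" and ?m = "count_list ts' (main L)"
  note X = definable_mapD(1)[OF f] definable_subset[OF definable_mapD(1)[OF f]]
  have W_sub: "W \<subseteq> tuples M ts'" using W(1) by (rule definable_subset)
  note G = graph_rule[OF f]
  have "Df ts {x \<in> tuples M ts. \<exists>w\<in>tuples M ts'. w \<in> W \<and> (x \<in> X \<and> f x = w)}"
    by (rule definable1) (rule dp2_rule[OF G] defb_rules W(1) | simp)+
  moreover have "{x \<in> tuples M ts. \<exists>w\<in>tuples M ts'. w \<in> W \<and> (x \<in> X \<and> f x = w)} = ?Z"
    using X(2) W_sub by blast
  ultimately show Z: "Df ts ?Z" by simp
  have Dfib: "Df ts (fiber f X w)" if "w \<in> W" for w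
    by (rule Df_fiber[OF f X(1)]) (use W_sub that in auto)
  have fib: "rank_ge d ts (fiber f X w)" "\<not> rank_ge (Suc d) ts (fiber f X w)" if "w \<in> W" for w
    using W(2)[OF that] dim_eq_iff[OF ts(1) Dfib[OF that]] by auto
  have lower: "rank_ge (e + d) ts ?Z" if e: "rank_ge e ts' W" for e
  proof -
    obtain e' R where R: "e \<le> e'" "dp2 ts' (ms e') R"
      "\<And>x w w'. x \<in> tuples M ts' \<Longrightarrow> w \<in> Mn e' \<Longrightarrow> w' \<in> Mn e' \<Longrightarrow> R x w \<Longrightarrow> R x w' \<Longrightarrow> w = w'"
      "many (replicate e' 1) {w \<in> Mn e'. \<exists>x\<in>tuples M ts'. x \<in> W \<and> R x w}"
      by (rule rank_geE[OF e]) (rule that)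
    \<comment> \<open>Values \<open>v\<close> reached from a point whose fibre has type
      \<open>js\<close>. Types are finite in number, so one of them works for a set of values that
      is big in all coordinates.\<close>
    define V where "V js v \<longleftrightarrow> (\<exists>w\<in>tuples M ts'. w \<in> W \<and> R w v \<and> many js (sel (main_idx L ts) ` fiber f X w))" for js v
    have V: "dp1 (ms e') (V js)" if "js \<in> cell_types ?n d" for js
    proof -
      have q: "dp1 ts' (\<lambda>w. many js (sel (main_idx L ts) ` fiber f X w))"
        using that by (intro dp1_many_fiber[OF f]) (simp add: cell_types_def)
      show ?thesis unfolding dp1_def V_def
        by (rule defb_rules dp2_rule[OF R(2)] dp1_rule[OF q] W(1) | simp)+
    qed
    have "many (replicate e' 1) {v \<in> Mn e'. \<exists>js\<in>cell_types ?n d. V js v}"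
      using R(4)
    proof (rule many_mono)
      fix v assume "v \<in> {w \<in> Mn e'. \<exists>x\<in>tuples M ts'. x \<in> W \<and> R x w}"
      then obtain w where w: "v \<in> Mn e'" "w \<in> tuples M ts'" "w \<in> W" "R w v" by blast
      then obtain js where "js \<in> cell_types ?n d" "many js (sel (main_idx L ts) ` fiber f X w)"
        using fib(1) rank_ge_iff_many_main[OF ts(1) Dfib] by blast
      then show "v \<in> {v \<in> Mn e'. \<exists>js\<in>cell_types ?n d. V js v}" using w unfolding V_def by blast
    qed
    from additive_finite[OF many1_additive _ finite_cell_types V this]
    obtain js where js: "js \<in> cell_types ?n d" "many (replicate e' 1) {v \<in> Mn e'. V js v}"
      using many_ne by blast
    have n: "length js = ?n" "set js \<subseteq> {0, 1}" "d \<le> sum_list js" using js(1) by (auto simp: cell_types_def)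
    let ?k = "length (idx js)"
    have s: "sel (idx js) (ms ?n) = ms ?k"
      using idx_lt[of js] n(1) by (intro sel_replicate) simp
    \<comment> \<open>The value of \<open>f x\<close> under \<open>R\<close> is followed by those
      main coordinates of \<open>x\<close> at which \<open>js\<close> is nonzero;
      \<open>many_append\<close> reads this as base and fibre.\<close>
    define R2 where "R2 x u \<longleftrightarrow> (\<exists>v\<in>Mn e'. \<exists>t\<in>Mn ?k. \<exists>w\<in>tuples M ts'. u = v @ t \<and> (x \<in> X \<and> f x = w) \<and> w \<in> W \<and> R w v \<and>
      t = sel (idx js) (sel (main_idx L ts) x))" for x u
    have R2: "dp2 ts (ms (e' + ?k)) R2" unfolding dp2_def R2_def
      by (rule dp2_rule[OF G] defb_rules dp2_rule[OF R(2)] W(1)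
          | simp add: s sel_main_idx main_idx_less replicate_add del: sel_simps | use idx_lt[of js] n(1) in \<open>simp add: sel_main_idx\<close>)+
    show ?thesis
    proof (rule rank_geI[OF _ R2])
      show "e + d \<le> e' + ?k" using R(1) n length_idx[OF n(2)] by simp
      show "u = u'" if "x \<in> tuples M ts" "R2 x u" "R2 x u'" for x u u'
        using that R(3) unfolding R2_def by blast
      have eq: "replicate (e' + ?k) (1::nat) = replicate e' 1 @ replicate ?k 1" by (simp add: replicate_add)
      show "many (replicate (e' + ?k) 1) {u \<in> Mn (e' + ?k). \<exists>x\<in>tuples M ts. x \<in> ?Z \<and> R2 x u}"
        unfolding eq many_append
      proof (rule many_mono[OF js(2)])
        fix v assume v: "v \<in> {v \<in> Mn e'. V js v}"
        then obtain w where w: "v \<in> Mn e'" "w \<in> tuples M ts'" "w \<in> W" "R w v" "many js (sel (main_idx L ts) ` fiber f X w)"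
          unfolding V_def by blast
        have "many (replicate ?k 1) {t \<in> Mn (length (replicate ?k 1)). v @ t \<in> {u \<in> Mn (e' + ?k). \<exists>x\<in>tuples M ts. x \<in> ?Z \<and> R2 x u}}"
          using many_proj[OF w(5)]
        proof (rule many_mono)
          fix t assume "t \<in> {t \<in> Mn ?k. \<exists>z\<in>Mn (length js). z \<in> sel (main_idx L ts) ` fiber f X w \<and> t = sel (idx js) z}"
          then obtain x where x: "t \<in> Mn ?k" "x \<in> X" "f x = w" "t = sel (idx js) (sel (main_idx L ts) x)"
            unfolding fiber_def by blast
          then have "R2 x (v @ t)" unfolding R2_def using w by blast
          moreover have "v @ t \<in> Mn (e' + ?k)" using w(1) x(1) by (simp add: replicate_add tuples_appendI)
          moreover have "x \<in> tuples M ts" "x \<in> ?Z" using x w(3) X(2) by auto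
          ultimately show "t \<in> {t \<in> Mn (length (replicate ?k 1)). v @ t \<in> {u \<in> Mn (e' + ?k). \<exists>x\<in>tuples M ts. x \<in> ?Z \<and> R2 x u}}"
            using x(1) by auto
        qed
        then show "v \<in> {v \<in> Mn (length (replicate e' 1)). many (replicate ?k 1)
            {t \<in> Mn (length (replicate ?k 1)). v @ t \<in> {u \<in> Mn (e' + ?k). \<exists>x\<in>tuples M ts. x \<in> ?Z \<and> R2 x u}}}"
          using w(1) by simp
      qed
    qed
  qed
  have upper: "\<exists>e. rank_ge e ts' W \<and> k \<le> e + d" if k: "rank_ge k ts ?Z" for k
  proof -
    \<comment> \<open>The auxiliary coordinates of \<open>x\<close> and of \<open>f x\<close> are
      fixed together. On what remains, main coordinates determine both points, so the graph can be
      treated as a subset of a power of the main sort.\<close>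
    let ?ss = "sel (aux_idx L ts) ts @ sel (aux_idx L ts') ts'"
    define A where "A x s \<longleftrightarrow> (\<exists>w\<in>tuples M ts'. (x \<in> X \<and> f x = w) \<and> s = sel (aux_idx L ts) x @ sel (aux_idx L ts') w)" for x s
    have A: "dp2 ts ?ss A" unfolding dp2_def A_def
      by (rule dp2_rule[OF G] defb_rules | simp add: aux_idx_less)+
    have "set ?ss \<subseteq> aux L" using sel_aux_idx[OF ts(1)] sel_aux_idx[OF ts(2)] by simp
    from rank_ge_aux[OF k Z this A]
    obtain s where s: "s \<in> tuples M ?ss" "rank_ge k ts {x \<in> ?Z. A x s}"
    proof (rule bexE)
      fix x assume x: "x \<in> tuples M ts" "x \<in> ?Z"
      then have "f x \<in> tuples M ts'" using W_sub by auto
      moreover from this have "sel (aux_idx L ts) x @ sel (aux_idx L ts') (f x) \<in> tuples M ?ss"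
        using sel_tuples[OF x(1) aux_idx_less] sel_tuples[OF _ aux_idx_less] by (intro tuples_appendI) auto
      ultimately show "\<exists>s\<in>tuples M ?ss. A x s" unfolding A_def using x by blast
    qed (rule that)
    obtain k' R where R: "k \<le> k'" "dp2 ts (ms k') R"
      "\<And>x w w'. x \<in> tuples M ts \<Longrightarrow> w \<in> Mn k' \<Longrightarrow> w' \<in> Mn k' \<Longrightarrow> R x w \<Longrightarrow> R x w' \<Longrightarrow> w = w'"
      "many (replicate k' 1) {w \<in> Mn k'. \<exists>x\<in>tuples M ts. x \<in> {x \<in> ?Z. A x s} \<and> R x w}"
      by (rule rank_geE[OF s(2)]) (rule that)
    let ?r = "ms (?m + ?n)"
    \<comment> \<open>The main coordinates of \<open>f x\<close> precede those of \<open>x\<close>,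
      so that an initial segment of the type belongs to the base and the rest to the fibre.\<close>
    define U where "U u x w \<longleftrightarrow> (x \<in> X \<and> f x = w) \<and> w \<in> W \<and> s = sel (aux_idx L ts) x @ sel (aux_idx L ts') w \<and>
      u = sel (main_idx L ts') w @ sel (main_idx L ts) x" for u x w
    have U: "dp3 ?r ts ts' U" unfolding dp3_def U_def
      by (rule dp2_rule[OF G] defb_rules W(1) dconst[OF s(1)] | simp add: aux_idx_less main_idx_less sel_main_idx replicate_add)+
    have U_inj: "x = x' \<and> w = w'" if "x \<in> tuples M ts" "w \<in> tuples M ts'" "x' \<in> tuples M ts" "w' \<in> tuples M ts'"
        "U (y @ z) x w" "U (y @ z') x' w'" "y \<in> Mn ?m" "z = z' \<or> x = x'" for x w x' w' y z z'
    proof -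
      have "sel (aux_idx L ts) x = sel (aux_idx L ts) x'" "sel (aux_idx L ts') w = sel (aux_idx L ts') w'"
        using that(5,6) unfolding U_def by auto
      moreover have "y = sel (main_idx L ts') w" "z = sel (main_idx L ts) x"
        using that(5,7) sel_main_idx_Mn[OF that(2)] tuples_append_inject unfolding U_def by metis+
      moreover have "y = sel (main_idx L ts') w'" "z' = sel (main_idx L ts) x'"
        using that(6,7) sel_main_idx_Mn[OF that(4)] tuples_append_inject unfolding U_def by metis+
      ultimately show ?thesis
        using that(1-4,8) sel_main_aux_idx[of x ts x' L] sel_main_aux_idx[of w ts' w' L] tuples_length by metis
    qed
    have U_w: "w = w'" if "w \<in> tuples M ts'" "w' \<in> tuples M ts'" "U (y @ z) x w" "U (y @ z') x' w'" "y \<in> Mn ?m"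
      for x w x' w' y z z'
    proof -
      have "sel (aux_idx L ts') w = sel (aux_idx L ts') w'"
        using that(3,4) unfolding U_def by auto
      moreover have "y = sel (main_idx L ts') w"
        using that(3,5) sel_main_idx_Mn[OF that(1)] tuples_append_inject unfolding U_def by metis
      moreover have "y = sel (main_idx L ts') w'"
        using that(4,5) sel_main_idx_Mn[OF that(2)] tuples_append_inject unfolding U_def by metis
      ultimately show ?thesis
        using that(1,2) sel_main_aux_idx[of w ts' w' L] tuples_length by metis
    qed
    define G2 where "G2 u \<longleftrightarrow> (\<exists>x\<in>tuples M ts. \<exists>w\<in>tuples M ts'. U u x w)" for u
    have G2: "dp1 ?r G2" unfolding dp1_def G2_def by (rule defb_rules dp3_rule[OF U] | simp)+
    define R' where "R' u v \<longleftrightarrow> (\<exists>x\<in>tuples M ts. \<exists>w\<in>tuples M ts'. U u x w \<and> R x v)" for u v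
    have R': "dp2 ?r (ms k') R'" unfolding dp2_def R'_def
      by (rule defb_rules dp3_rule[OF U] dp2_rule[OF R(2)] | simp)+
    have split: "\<exists>y\<in>Mn ?m. \<exists>z\<in>Mn ?n. u = y @ z" if "u \<in> Mn (?m + ?n)" for u
      using that unfolding replicate_add tuples_append by blast
    have func: "v = v'" if u: "u \<in> Mn (?m + ?n)" "v \<in> Mn k'" "v' \<in> Mn k'" "R' u v" "R' u v'" for u v v'
    proof -
      obtain y z where "y \<in> Mn ?m" "u = y @ z" using split[OF u(1)] by blast
      moreover obtain x w x' w' where "x \<in> tuples M ts" "w \<in> tuples M ts'" "x' \<in> tuples M ts" "w' \<in> tuples M ts'"
        "U u x w" "U u x' w'" "R x v" "R x' v'" using u(4,5) unfolding R'_def by blast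
      ultimately show ?thesis using U_inj[of x w x' w' y z z] R(3) u(2,3) by blast
    qed
    have "many (replicate k' 1) {v \<in> Mn k'. \<exists>u\<in>Mn (?m + ?n). G2 u \<and> R' u v}"
      using R(4)
    proof (rule many_mono)
      fix v assume "v \<in> {w \<in> Mn k'. \<exists>x\<in>tuples M ts. x \<in> {x \<in> ?Z. A x s} \<and> R x w}"
      then obtain x where x: "v \<in> Mn k'" "x \<in> tuples M ts" "x \<in> X" "f x \<in> W" "A x s" "R x v" by blast
      let ?u = "sel (main_idx L ts') (f x) @ sel (main_idx L ts) x"
      have fx: "f x \<in> tuples M ts'" using x W_sub by auto
      have "U ?u x (f x)" using x unfolding U_def A_def by blast
      moreover have "?u \<in> Mn (?m + ?n)"
        using sel_main_idx_Mn[OF x(2)] sel_main_idx_Mn[OF fx] by (simp add: replicate_add tuples_appendI)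
      ultimately show "v \<in> {v \<in> Mn k'. \<exists>u\<in>Mn (?m + ?n). G2 u \<and> R' u v}"
        using x fx unfolding G2_def R'_def by blast
    qed
    from image_unicell[OF R' G2 _ this] func
    obtain js C where C: "length js = ?m + ?n" "set js \<subseteq> {0, 1}" "\<forall>z\<in>C. G2 z" "many js C" "k' \<le> sum_list js"
      by blast
    define j1 j2 where "j1 = take ?m js" and "j2 = drop ?m js"
    have j: "js = j1 @ j2" "length j1 = ?m" "length j2 = ?n" using C(1) by (auto simp: j1_def j2_def)
    have j01: "set j1 \<subseteq> {0, 1}" "set j2 \<subseteq> {0, 1}" using C(2) unfolding j(1) by auto
    \<comment> \<open>Base points above which the cell still satisfies \<open>many j2\<close>. Since
      the auxiliary coordinates are fixed, each comes from one point of \<open>W\<close>, and the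
      fibre of \<open>f\<close> over that point inherits \<open>many j2\<close>.\<close>
    define W0 where "W0 = {y \<in> Mn ?m. many j2 {z \<in> Mn ?n. y @ z \<in> C}}"
    have q0: "many j1 W0" using C(4) unfolding j(1) many_append W0_def j(2,3) .
    have W0: "\<exists>w\<in>W. y = sel (main_idx L ts') w \<and> many j2 (sel (main_idx L ts) ` fiber f X w)" if y: "y \<in> W0" for y
    proof -
      have ym: "y \<in> Mn ?m" and q: "many j2 {z \<in> Mn ?n. y @ z \<in> C}" using y unfolding W0_def by blast+
      obtain z0 where z0: "y @ z0 \<in> C" using many_ne[OF q] by blast
      then obtain x0 w where w: "x0 \<in> tuples M ts" "w \<in> tuples M ts'" "U (y @ z0) x0 w"
        using C(3) unfolding G2_def by blast
      have "many j2 (sel (main_idx L ts) ` fiber f X w)"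
        using q
      proof (rule many_mono)
        fix z assume z: "z \<in> {z \<in> Mn ?n. y @ z \<in> C}"
        then obtain x w' where x: "x \<in> tuples M ts" "w' \<in> tuples M ts'" "U (y @ z) x w'"
          using C(3) unfolding G2_def by blast
        have "w' = w" using U_w[OF x(2) w(2) x(3) w(3) ym] .
        moreover have "z = sel (main_idx L ts) x"
          using x(3) ym sel_main_idx_Mn[OF x(2)] tuples_append_inject unfolding U_def by metis
        ultimately show "z \<in> sel (main_idx L ts) ` fiber f X w"
          using x(3) unfolding U_def fiber_def by blast
      qed
      moreover have "y = sel (main_idx L ts') w"
        using w(3) ym sel_main_idx_Mn[OF w(2)] tuples_append_inject unfolding U_def by metis
      moreover have "w \<in> W" using w(3) unfolding U_def by blast
      ultimately show ?thesis by blast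
    qed
    have "many j1 (sel (main_idx L ts') ` W)" using q0 by (rule many_mono) (use W0 in blast)
    then have "rank_ge (sum_list j1) ts' W"
      using rank_ge_iff_many_main[OF ts(2) W(1)] j(2) j01(1) by (auto simp: cell_types_def)
    \<comment> \<open>A larger sum would give some fibre over \<open>W\<close> dimension at least
      \<open>Suc d\<close>.\<close>
    moreover have "sum_list j2 \<le> d"
    proof (rule ccontr)
      assume "\<not> sum_list j2 \<le> d"
      then have "j2 \<in> cell_types ?n (Suc d)" using j(3) j01(2) by (simp add: cell_types_def)
      moreover obtain w where "w \<in> W" "many j2 (sel (main_idx L ts) ` fiber f X w)" using many_ne[OF q0] W0 by blast
      ultimately have "rank_ge (Suc d) ts (fiber f X w)" using rank_ge_iff_many_main[OF ts(1) Dfib] by blast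
      then show False using fib(2) \<open>w \<in> W\<close> by blast
    qed
    moreover have "k \<le> sum_list j1 + sum_list j2" using R(1) C(5) unfolding j(1) by simp
    ultimately show ?thesis by (intro exI[of _ "sum_list j1"]) auto
  qed
  show "dim L M ts ?Z = dim L M ts' W + ereal (real d)"
    by (rule dimval_add) (use dim_iff[OF ts(1) Z] dim_iff[OF ts(2) W(1)] lower upper in blast)+
qed

theorem dimension:
  assumes ts: "set ts \<subseteq> insert (main L) (aux L)" "set ts' \<subseteq> insert (main L) (aux L)"
    and pi: "definable_map L M (elems M) ts X us Y \<pi>"
    and pi': "definable_map L M (elems M) ts' X' us Y \<pi>'"
    and f: "definable_map L M (elems M) ts X ts' X' f"
    and over: "\<forall>x\<in>X. \<pi>' (f x) = \<pi> x"
  shows "dim L M ts X \<ge> dim L M ts' (f ` X)"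
    and "dim_over L M ts Y \<pi> X \<ge> dim_over L M ts' Y \<pi>' (f ` X)"
    and "definable L M (elems M) ts' (dim_locus L M ts Y \<pi> X X' f d)"
    and "dim_over L M ts Y \<pi> {x \<in> X. f x \<in> dim_locus L M ts Y \<pi> X X' f d} =
          dim_over L M ts' Y \<pi>' (dim_locus L M ts Y \<pi> X X' f d) + ereal (real d)"
    and "set us \<subseteq> aux L \<Longrightarrow> dim_over L M ts Y \<pi> X = dim L M ts X"
proof -
  note X = definable_mapD(1)[OF pi] and X' = definable_mapD(1)[OF pi']
  note Y = definable_subset[OF definable_mapD(2)[OF pi]]
  note piY = definable_mapD(4)[OF pi] and piY' = definable_mapD(4)[OF pi']
  show "dim L M ts X \<ge> dim L M ts' (f ` X)" by (rule dim_image(2)[OF ts f X]) simp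
  show "dim_over L M ts Y \<pi> X \<ge> dim_over L M ts' Y \<pi>' (f ` X)"
    unfolding dim_over_def
  proof (rule SUP_mono)
    fix y assume y: "y \<in> Y"
    have "fiber \<pi>' (f ` X) y = f ` fiber \<pi> X y" using over by (auto simp: fiber_def)
    moreover have "Df ts (fiber \<pi> X y)" by (rule Df_fiber[OF pi X]) (use y Y in auto)
    ultimately have "dim L M ts' (fiber \<pi>' (f ` X) y) \<le> dim L M ts (fiber \<pi> X y)"
      using dim_image(2)[OF ts f _ fiber_sub] by simp
    then show "\<exists>y'\<in>Y. dim L M ts' (fiber \<pi>' (f ` X) y) \<le> dim L M ts (fiber \<pi> X y')" using y by blast
  qed
  let ?S = "dim_locus L M ts Y \<pi> X X' f d"
  \<comment> \<open>A fibre of \<open>f\<close> lies over the single point \<open>\<pi>' x'\<close>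
    of \<open>Y\<close>; all other points of \<open>Y\<close> contribute minus infinity to the
    supremum.\<close>
  have fib_over: "dim_over L M ts Y \<pi> (fiber f X x') = dim L M ts (fiber f X x')" if x': "x' \<in> X'" for x'
  proof -
    have "fiber \<pi> (fiber f X x') y = (if y = \<pi>' x' then fiber f X x' else {})" for y
      using over by (auto simp: fiber_def)
    then have "dim_over L M ts Y \<pi> (fiber f X x') =
        (SUP y\<in>Y. if y = \<pi>' x' then dim L M ts (fiber f X x') else - \<infinity>)"
      unfolding dim_over_def by (intro SUP_cong) (auto simp: dim_empty[OF ts(1)])
    also have "\<dots> = dim L M ts (fiber f X x')"
      by (rule antisym[OF SUP_least SUP_upper2[of "\<pi>' x'"]]) (use piY'[OF x'] in auto)
    finally show ?thesis .
  qed
  have S: "?S = {x' \<in> X'. dim L M ts (fiber f X x') = ereal (real d)}"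
    unfolding dim_locus_def using fib_over by auto
  have X'_sub: "X' \<subseteq> tuples M ts'" using X' by (rule definable_subset)
  \<comment> \<open>Dimension equal to \<open>d\<close> means rank at least \<open>d\<close> but not
    at least \<open>Suc d\<close>, and each of the two conditions is a finite disjunction over
    types.\<close>
  let ?q = "\<lambda>e w. \<exists>js\<in>cell_types (count_list ts (main L)) e. many js (sel (main_idx L ts) ` fiber f X w)"
  have "dim L M ts (fiber f X x') = ereal (real d) \<longleftrightarrow> ?q d x' \<and> \<not> ?q (Suc d) x'" if "x' \<in> X'" for x'
  proof -
    have D: "Df ts (fiber f X x')" by (rule Df_fiber[OF f X]) (use that X'_sub in auto)
    show ?thesis using dim_eq_iff[OF ts(1) D] rank_ge_iff_many_main[OF ts(1) D] by simp
  qed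
  then have "?S = {x' \<in> tuples M ts'. x' \<in> X' \<and> ?q d x' \<and> \<not> ?q (Suc d) x'}"
    unfolding S using X'_sub by blast
  moreover have "Df ts' {x' \<in> tuples M ts'. x' \<in> X' \<and> ?q d x' \<and> \<not> ?q (Suc d) x'}"
  proof (rule definable1)
    have "defb [ts'] (\<lambda>v. ?q e (v 0))" for e
      by (rule defb_finite_bex[OF finite_cell_types]) (use dp1_many_fiber[OF f] in \<open>auto simp: dp1_def cell_types_def\<close>)
    then show "defb [ts'] (\<lambda>v. v 0 \<in> X' \<and> ?q d (v 0) \<and> \<not> ?q (Suc d) (v 0))"
      by (intro defb_conj defb_not defb_mem[OF X'] dterm_var[of 0 "[ts']", simplified])
  qed
  ultimately show DS: "Df ts' ?S" by simp
  show "dim_over L M ts Y \<pi> {x \<in> X. f x \<in> ?S} = dim_over L M ts' Y \<pi>' ?S + ereal (real d)"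
  proof -
    \<comment> \<open>Additivity is applied separately over each \<open>y\<close>, with the part of
      the locus above \<open>y\<close> as base.\<close>
    have "dim L M ts (fiber \<pi> {x \<in> X. f x \<in> ?S} y) = dim L M ts' (fiber \<pi>' ?S y) + ereal (real d)"
      if y: "y \<in> Y" for y
    proof -
      have "?S \<subseteq> X'" unfolding S by blast
      then have "Df ts' (fiber \<pi>' ?S y)" by (intro Df_fiber[OF pi' DS]) (use y Y in auto)
      moreover have "fiber \<pi> {x \<in> X. f x \<in> ?S} y = {x \<in> X. f x \<in> fiber \<pi>' ?S y}"
        using over by (auto simp: fiber_def)
      moreover have "dim L M ts (fiber f X w) = ereal (real d)" if "w \<in> fiber \<pi>' ?S y" for w
        using that unfolding S fiber_def by blast
      ultimately show ?thesis using dim_add(2)[OF ts f] by simp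
    qed
    then have "dim_over L M ts Y \<pi> {x \<in> X. f x \<in> ?S} = (SUP y\<in>Y. dim L M ts' (fiber \<pi>' ?S y) + ereal (real d))"
      unfolding dim_over_def by (intro SUP_cong) auto
    also have "\<dots> = dim_over L M ts' Y \<pi>' ?S + ereal (real d)"
    proof (cases "Y = {}")
      \<comment> \<open>For empty \<open>Y\<close> both suprema are minus infinity; moving the
        summand out of a supremum requires a nonempty index set.\<close>
      case True
      then show ?thesis by (simp add: dim_over_def bot_ereal_def)
    next
      case False
      then show ?thesis unfolding dim_over_def by (intro SUP_ereal_add_left) auto
    qed
    finally show ?thesis .
  qed
  show "dim_over L M ts Y \<pi> X = dim L M ts X" if us: "set us \<subseteq> aux L"
  proof (rule antisym)
    have D: "Df ts (fiber \<pi> X y)" if "y \<in> tuples M us" for y by (rule Df_fiber[OF pi X _ that]) simp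
    show "dim_over L M ts Y \<pi> X \<le> dim L M ts X"
      unfolding dim_over_def
    proof (rule SUP_least)
      fix y assume "y \<in> Y"
      then show "dim L M ts (fiber \<pi> X y) \<le> dim L M ts X" using dim_mono[OF ts(1) D X fiber_sub] Y by blast
    qed
    show "dim L M ts X \<le> dim_over L M ts Y \<pi> X"
    proof (rule dimval_leI)
      show "dimval (dim L M ts X)" by (rule dim_iff(2)[OF ts(1) X])
      fix e :: nat assume "ereal (real e) \<le> dim L M ts X"
      then have rank_ge: "rank_ge e ts X" using dim_iff(1)[OF ts(1) X] by blast
      \<comment> \<open>With auxiliary \<open>Y\<close>, the value of \<open>\<pi>\<close> is
        auxiliary data that can be fixed without lowering the rank, so some fibre already has the
        rank of \<open>X\<close>.\<close>
      have "\<exists>y\<in>tuples M us. rank_ge e ts {x \<in> X. x \<in> X \<and> \<pi> x = y}"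
        by (rule rank_ge_aux[OF rank_ge X us graph_rule[OF pi]]) (use piY Y in blast)
      then obtain y where y: "y \<in> tuples M us" "rank_ge e ts {x \<in> X. x \<in> X \<and> \<pi> x = y}" by blast
      have eq: "{x \<in> X. x \<in> X \<and> \<pi> x = y} = fiber \<pi> X y" by (auto simp: fiber_def)
      have "y \<in> Y" using rank_ge_ne[OF y(2)] piY by blast
      have "ereal (real e) \<le> dim L M ts (fiber \<pi> X y)" using dim_iff(1)[OF ts(1) D[OF y(1)]] y(2) unfolding eq by blast
      also have "\<dots> \<le> dim_over L M ts Y \<pi> X" unfolding dim_over_def using \<open>y \<in> Y\<close> by (rule SUP_upper)
      finally show "ereal (real e) \<le> dim_over L M ts Y \<pi> X" .
    qed
  qed
qed

end

theorem proposition4p3: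
  fixes L :: "('s, 'f, 'r) lang"
    and T :: "('f, 'r, 's) fm set"
    and M :: "('s, 'f, 'r, 'u) struct"
    and ts ts' us :: "'s list"
    and X X' Y :: "'u list set"
    and \<pi> \<pi>' f :: "'u list \<Rightarrow> 'u list"
  assumes "language L"
    and "is_theory L T"
    and "b_minimal_theory TYPE(('f, 'r, 's, 'u) big) L T"
    and "is_model L T M"
    and "card (carr M (main L)) \<noteq> 2"
    and "definable L M (elems M) us Y"
    and "set ts \<subseteq> insert (main L) (aux L)"
    and "set ts' \<subseteq> insert (main L) (aux L)"
    and "definable_map L M (elems M) ts X us Y \<pi>"
    and "definable_map L M (elems M) ts' X' us Y \<pi>'"
    and "definable_map L M (elems M) ts X ts' X' f"
    and "\<forall>x\<in>X. \<pi>' (f x) = \<pi> x"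
  shows
    "(dim L M ts X \<ge> dim L M ts' (f ` X) \<and>
      dim_over L M ts Y \<pi> X \<ge> dim_over L M ts' Y \<pi>' (f ` X)) \<and>
     (\<forall>d :: nat.
        definable L M (elems M) ts' (dim_locus L M ts Y \<pi> X X' f d) \<and>
        dim_over L M ts Y \<pi> {x \<in> X. f x \<in> dim_locus L M ts Y \<pi> X X' f d} =
          dim_over L M ts' Y \<pi>' (dim_locus L M ts Y \<pi> X X' f d) + ereal (real d)) \<and>
     (set us \<subseteq> aux L \<longrightarrow> dim_over L M ts Y \<pi> X = dim L M ts X)"
proof -
  \<comment> \<open>The indices are arbitrary sets of pairs, so that the universe of the ultrapower
    is the type \<open>big\<close>; the cones confine the ultrafilter to finite sets.\<close>
  define cone where "cone k = {i. finite i \<and> k \<in> i}" for k :: "('f, 'r, 's) fm \<times> 'u list"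
  have fip: "\<Inter>K \<noteq> {}" if K: "finite K" "K \<subseteq> range cone" for K
  proof -
    \<comment> \<open>A finite set \<open>F\<close> of pairs is itself an index, and it lies in the
      cone of each of its elements.\<close>
    obtain F where "finite F" "K = cone ` F" using finite_subset_image[OF K] by blast
    then have "F \<in> \<Inter>K" by (auto simp: cone_def)
    then show ?thesis by blast
  qed
  obtain ev where ev: "ultrafilter ev" "\<And>b. b \<in> range cone \<Longrightarrow> ev (\<lambda>i. i \<in> b)"
    by (rule ultrafilter_ex[of "range cone"], rule fip, assumption+, rule that)
  interpret ultrafilter ev by (rule ev(1))
  have ball: "ball L \<in> rels L" using assms(1) by (simp add: language_def)
  \<comment> \<open>The ultrapower is a model of \<open>T\<close> with its universes in
    \<open>big\<close>, so the hypothesis on the theory makes it b-minimal.\<close>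
  have "is_model L T (upow L M)" by (rule upow_model[OF assms(4,2) ball])
  then have bm: "b_minimal L (upow L M)" using assms(3) by (simp add: b_minimal_theory_def)
  interpret bmin ev L M
  proof unfold_locales
    show "ev (\<lambda>i. finite i \<and> k \<in> i)" for k using ev(2)[of "cone k"] by (simp add: cone_def)
    show "is_structure L M" using assms(4) by (simp add: is_model_def)
  qed (use assms(1,5) bm in auto)
  show ?thesis using dimension[OF assms(7-12)] by blast
qed

end
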